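(* Let $p$ be fixed, $\boldsymbol\beta^*\in\mathbb{R}^p$, and for each $n$ let $\mathbf{y}=(y_1,\dots,y_n)'$ and $\mathbf{X}$ the $n\times p$ matrix with rows $\mathbf{x}_i$, where (A1) $y_i=\mathbf{x}_i\boldsymbol\beta^*+\epsilon_i$ with $\epsilon_1,\dots,\epsilon_n$ i.i.d. with mean $0$ and variance $\sigma^2>0$; (A2) $\frac1n\mathbf{X}'\mathbf{X}\to\mathbf{C}$, with $\mathbf{C}$ a positive definite matrix. Let $\boldsymbol\beta^{(0)}_n$ be the least squares estimator, let $\alpha^{\dagger}_n>0$, $\eta^{\dagger}_n>0$, and define $$\boldsymbol\beta^{(1)}_n=\arg\min_{\boldsymbol\beta\in\mathbb{R}^p}\left\{(\mathbf{y}-\mathbf{X}\boldsymbol\beta)'(\mathbf{y}-\mathbf{X}\boldsymbol\beta)+\alpha^{\dagger}_n\sum_{j=1}^p\frac{|\beta_j|}{|\beta^{(0)}_{nj}|+\eta^{\dagger}_n}\right\}.$$ Let $\mathcal{A}=\{j:\beta^*_j\neq0\}$ and $\mathcal{A}_n=\{j:\beta^{(1)}_{nj}\neq0\}$. Suppose $\alpha^{\dagger}_n\to\infty$, $\alpha^{\dagger}_n/\sqrt n\to0$ and $\eta^{\dagger}_n\sqrt n\to c<\infty$. Then (1) $\lim_{n\to\infty}\mathbb{P}(\mathcal{A}_n=\mathcal{A})=1$; (2) $\sqrt n(\boldsymbol\beta^{(1)}_{n\mathcal{A}}-\boldsymbol\beta^*_{\mathcal{A}})\xrightarrow{d}\m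athrm{N}(\mathbf{0},\sigma^2\mathbf{C}_{\mathcal{A}}^{-1})$.
   Context: For a vector $\boldsymbol\beta$, $\boldsymbol\beta_{\mathcal{A}}$ is the subvector of entries indexed by $\mathcal{A}$; $\mathbf{C}_{\mathcal{A}}$ is the submatrix of $\mathbf{C}$ with rows and columns indexed by $\mathcal{A}$. $\boldsymbol\beta^{(1)}_n$ is the one-step (GDP(OS)) estimator, a weighted $\ell_1$-penalized least squares estimator with weights built from the initial estimate $\boldsymbol\beta^{(0)}_n$. *)

theory Defs
  imports "HOL-Probability.Probability"
begin

definition outer :: "real^'p \<Rightarrow> real^'p^'p" where
  "outer v = (\<chi> i j. v $ i * v $ j)"

(* X'X for the n x p design matrix with rows x 0, ..., x (n-1) *)
definition gram :: "(nat \<Rightarrow> real^'p) \<Rightarrow> nat \<Rightarrow> real^'p^'p" where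
  "gram x n = (\<Sum>i<n. outer (x i))"

definition pos_def :: "real^'p^'p \<Rightarrow> bool" where
  "pos_def C \<longleftrightarrow> transpose C = C \<and> (\<forall>v. v \<noteq> 0 \<longrightarrow> v \<bullet> (C *v v) > 0)"

definition ls_est :: "(nat \<Rightarrow> real^'p) \<Rightarrow> (nat \<Rightarrow> real) \<Rightarrow> nat \<Rightarrow> real^'p" where
  "ls_est x y n = matrix_inv (gram x n) *v (\<Sum>i<n. y i *\<^sub>R x i)"

definition gdp_obj :: "(nat \<Rightarrow> real^'p) \<Rightarrow> (nat \<Rightarrow> real) \<Rightarrow> nat \<Rightarrow> real \<Rightarrow> real
    \<Rightarrow> real^'p \<Rightarrow> real^'p \<Rightarrow> real" where
  "gdp_obj x y n \<alpha> \<eta> b0 b =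
     (\<Sum>i<n. (y i - x i \<bullet> b)^2) + \<alpha> * (\<Sum>j\<in>UNIV. \<bar>b $ j\<bar> / (\<bar>b0 $ j\<bar> + \<eta>))"

definition gdp_os :: "(nat \<Rightarrow> real^'p) \<Rightarrow> (nat \<Rightarrow> real) \<Rightarrow> nat \<Rightarrow> real \<Rightarrow> real \<Rightarrow> real^'p" where
  "gdp_os x y n \<alpha> \<eta> =
     (SOME b. \<forall>b'. gdp_obj x y n \<alpha> \<eta> (ls_est x y n) b \<le> gdp_obj x y n \<alpha> \<eta> (ls_est x y n) b')"

definition det_on :: "'i set \<Rightarrow> ('i \<Rightarrow> 'i \<Rightarrow> real) \<Rightarrow> real" where
  "det_on I M = (\<Sum>\<pi> | \<pi> permutes I. of_int (sign \<pi>) * (\<Prod>i\<in>I. M i (\<pi> i)))"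

definition inv_on :: "'i set \<Rightarrow> ('i \<Rightarrow> 'i \<Rightarrow> real) \<Rightarrow> ('i \<Rightarrow> 'i \<Rightarrow> real)" where
  "inv_on I M = (SOME N. (\<forall>i\<in>I. \<forall>k\<in>I. (\<Sum>j\<in>I. M i j * N j k) = (if i = k then 1 else 0)))"

definition submat :: "'i set \<Rightarrow> real^'i^'i \<Rightarrow> ('i \<Rightarrow> 'i \<Rightarrow> real)" where
  "submat A C = (\<lambda>i j. C $ i $ j)"

(* multivariate normal N(0, S) on R^I (S positive definite), via its Lebesgue density *)
definition mvn_density :: "'i set \<Rightarrow> ('i \<Rightarrow> 'i \<Rightarrow> real) \<Rightarrow> ('i \<Rightarrow> real) \<Rightarrow> real" where
  "mvn_density I S z =
     (2 * pi) powr (- real (card I) / 2) * det_on I S powr (- 1 / 2) *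
     exp (- (1/2) * (\<Sum>i\<in>I. \<Sum>j\<in>I. z i * inv_on I S i j * z j))"

definition mvn_on :: "'i set \<Rightarrow> ('i \<Rightarrow> 'i \<Rightarrow> real) \<Rightarrow> ('i \<Rightarrow> real) measure" where
  "mvn_on I S = density (PiM I (\<lambda>_. lborel)) (\<lambda>z. ennreal (mvn_density I S z))"

(* convergence in distribution of random vectors Z n (values in R^I, i.e. extensional
   functions on I) to the law mu: E g(Z_n) -> int g dmu for all bounded continuous g *)
definition conv_distr_on :: "'a measure \<Rightarrow> 'i set \<Rightarrow> (nat \<Rightarrow> 'a \<Rightarrow> ('i \<Rightarrow> real))
    \<Rightarrow> ('i \<Rightarrow> real) measure \<Rightarrow> bool" where
  "conv_distr_on M I Z \<mu> \<longleftrightarrow>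
     (\<forall>g :: ('i \<Rightarrow> real) \<Rightarrow> real.
        continuous_on (PiE I (\<lambda>_. UNIV)) g \<longrightarrow> bounded (g ` PiE I (\<lambda>_. UNIV)) \<longrightarrow>
        (\<lambda>n. \<integral>\<omega>. g (Z n \<omega>) \<partial>M) \<longlonglongrightarrow> (\<integral>z. g z \<partial>\<mu>))"

end

theory Submission
  imports Defs
begin

text \<open>Put \<open>W\<^sub>n = n\<^sup>-\<^sup>1\<^sup>/\<^sup>2 X'\<epsilon>\<close> and \<open>u = sqrt n (\<beta>1 - \<beta>star)\<close>. By Chebyshev \<open>W\<^sub>n\<close> is tight, and on the event
  \<open>norm W\<^sub>n \<le> K\<close> the rest is deterministic. The initial estimator is within \<open>O(n\<^sup>-\<^sup>1\<^sup>/\<^sup>2)\<close> of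
  \<open>\<beta>star\<close>, so the scaled penalty weights tend to 0 on \<open>A\<close> and to infinity off \<open>A\<close>. The
  Karush-Kuhn-Tucker conditions then bound \<open>u\<close>, force its coordinates off \<open>A\<close> to vanish, and give
  \<open>C\<^sub>A u\<^sub>A = W\<^sub>A + o(1)\<close> on \<open>A\<close>. Hence \<open>u\<^sub>A\<close> has the same limit law as \<open>C\<^sub>A\<^sup>-\<^sup>1 W\<^sub>A\<close>, which
  is found from characteristic functions. Convergence of these implies convergence in law because,
  by tightness, a bounded continuous function may be replaced by a trigonometric polynomial. The strong
  convexity of the objective makes the minimiser unique and a continuous function of the data, hence
  measurable.\<close>

section \<open>Convergence in law from trigonometric test functions\<close>

text \<open>For fixed \<open>n\<close> the least squares estimator and the penalised estimator are
  both functions of \<open>X'y\<close>, so the path from the noise to the estimator is a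
  deterministic map of \<open>W\<^sub>n\<close>, and selection can be proved for all noise sequences
  with \<open>W\<^sub>n\<close> in a ball at once. The rates all meet in the scaled weight
  \<open>L j = \<alpha> n / (sqrt n * (|b0 $ j| + \<eta> n))\<close>. On \<open>A\<close> its
  denominator grows like \<open>sqrt n\<close>, and \<open>\<alpha> n / sqrt n\<close> tends to 0.
  Off \<open>A\<close> the denominator stays bounded, because \<open>sqrt n * |b0 $ j|\<close> and
  \<open>sqrt n * \<eta> n\<close> do, while \<open>\<alpha> n\<close> tends to infinity. Diverging
  weights would ruin a bound on \<open>u\<close>, but they act only on coordinates whose true value
  is 0, where the penalty pulls in the favourable direction. The estimator is a chosen minimiser and
  is under control only once the Gram matrix is positive definite, so its measurability is an
  eventual statement. The limit law lives on functions on \<open>A\<close> and not on a matrix type;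
  its determinant and inverse are reached by padding with an identity block.\<close>

inductive trig_poly :: "('e::euclidean_space \<Rightarrow> real) \<Rightarrow> bool" where
  cos: "trig_poly (\<lambda>v. c * cos (t \<bullet> v + s))"
| add: "trig_poly f \<Longrightarrow> trig_poly g \<Longrightarrow> trig_poly (\<lambda>v. f v + g v)"

lemma trig_poly_const: "trig_poly (\<lambda>v. c)"
  using trig_poly.cos[of c 0 0] by simp

lemma trig_poly_sum: "finite B \<Longrightarrow> (\<And>b. b \<in> B \<Longrightarrow> trig_poly (f b)) \<Longrightarrow> trig_poly (\<lambda>v. \<Sum>b\<in>B. f b v)"
proof (induction B rule: finite_induct)
  case empty
  then show ?case using trig_poly_const[of 0] by simp
next
  case (insert b B)
  then show ?case using trig_poly.add[of "f b" "\<lambda>v. \<Sum>b\<in>B. f b v"] by simp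
qed

text \<open>The product-to-sum formula makes the class an algebra although it is generated by sums
  alone. The phase in the generator lets one rule cover cosines, sines and constants.\<close>

lemma trig_poly_cos_mult:
  assumes "trig_poly g"
  shows "trig_poly (\<lambda>v. (c * cos (t \<bullet> v + s)) * g v)"
  using assms
proof (induction rule: trig_poly.induct)
  case (cos d t' s')
  have *: "(c * A) * (d * B) = (c * d / 2) * X + (c * d / 2) * Y" if "X + Y = 2 * (A * B)" for A B X Y :: real
  proof -
    have "(c * d / 2) * X + (c * d / 2) * Y = (c * d / 2) * (X + Y)" by (simp only: distrib_left)
    then show ?thesis using that by simp
  qed
  have "(c * cos (t \<bullet> v + s)) * (d * cos (t' \<bullet> v + s')) =
      (c * d / 2) * cos ((t - t') \<bullet> v + (s - s')) + (c * d / 2) * cos ((t + t') \<bullet> v + (s + s'))" for v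
  proof -
    have "(t - t') \<bullet> v + (s - s') = (t \<bullet> v + s) - (t' \<bullet> v + s')"
      "(t + t') \<bullet> v + (s + s') = (t \<bullet> v + s) + (t' \<bullet> v + s')"
      by (simp_all add: inner_diff_left inner_add_left)
    then show ?thesis
      by (intro *) (simp only: cos_times_cos nonzero_mult_div_cancel_left times_divide_eq_right zero_neq_numeral not_False_eq_True)
  qed
  then show ?case
    using trig_poly.add[OF trig_poly.cos[of "c * d / 2" "t - t'" "s - s'"] trig_poly.cos[of "c * d / 2" "t + t'" "s + s'"]]
    by (simp only:)
next
  case (add f g)
  then show ?case
    using trig_poly.add[OF add.IH] by (simp only: distrib_left)
qed

lemma trig_poly_mult:
  assumes "trig_poly f" "trig_poly g"
  shows "trig_poly (\<lambda>v. f v * g v)"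
  using assms(1)
proof (induction rule: trig_poly.induct)
  case (cos c t s)
  then show ?case using trig_poly_cos_mult[OF assms(2)] .
next
  case (add f g)
  then show ?case using trig_poly.add[OF add.IH] by (simp only: distrib_right)
qed

text \<open>A linear function of the sines is a sum of sines, each a cosine with phase
  \<open>pi / 2\<close>, and products stay in the class. This turns algebraic approximation on a
  cube into approximation by functions that are bounded on the whole space.\<close>

lemma trig_poly_polynomial_sin:
  fixes p :: "'e::euclidean_space \<Rightarrow> real"
  assumes "real_polynomial_function p"
  shows "trig_poly (\<lambda>v. p (\<Sum>b\<in>Basis. sin ((v \<bullet> b) / L) *\<^sub>R b))"
  using assms
proof (induction rule: real_polynomial_function.induct)
  case (linear f)
  have sin_cos: "sin ((v \<bullet> b) / L) = cos ((- (b /\<^sub>R L)) \<bullet> v + pi / 2)" for v b :: 'e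
  proof -
    have "(- (b /\<^sub>R L)) \<bullet> v = - ((v \<bullet> b) / L)"
      by (simp add: inner_commute[of v b] divide_inverse_commute)
    then have "(- (b /\<^sub>R L)) \<bullet> v + pi / 2 = pi / 2 - (v \<bullet> b) / L" by linarith
    then show ?thesis by (simp only: sin_cos_eq of_real_eq_id id_apply)
  qed
  have "f (\<Sum>b\<in>Basis. sin ((v \<bullet> b) / L) *\<^sub>R b) = (\<Sum>b\<in>Basis. f b * sin ((v \<bullet> b) / L))" for v
    using linear by (simp add: linear_sum linear_cmul bounded_linear.linear mult.commute)
  then show ?case
    using trig_poly_sum[OF finite_Basis trig_poly.cos, of f "\<lambda>b. - (b /\<^sub>R L)" "\<lambda>b. pi / 2"]
    by (simp only: sin_cos)
next
  case (const c)
  show ?case by (rule trig_poly_const)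
next
  case (add f g)
  show ?case by (rule trig_poly.add[OF add.IH])
next
  case (mult f g)
  show ?case by (rule trig_poly_mult[OF mult.IH])
qed

lemma trig_poly_continuous: "trig_poly f \<Longrightarrow> continuous_on UNIV f"
  by (induction rule: trig_poly.induct) (auto intro!: continuous_intros)

lemma trig_poly_bounded: "trig_poly f \<Longrightarrow> \<exists>B. \<forall>v. \<bar>f v\<bar> \<le> B"
proof (induction rule: trig_poly.induct)
  case (cos c t s)
  have "\<bar>c * cos (t \<bullet> v + s)\<bar> \<le> \<bar>c\<bar> * 1" for v
    unfolding abs_mult by (rule mult_left_mono) auto
  then show ?case by blast
next
  case (add f g)
  then obtain B B' where "\<forall>v. \<bar>f v\<bar> \<le> B" "\<forall>v. \<bar>g v\<bar> \<le> B'" by blast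
  then have "\<forall>v. \<bar>f v + g v\<bar> \<le> B + B'"
    by (meson abs_triangle_ineq add_mono order_trans)
  then show ?case by blast
qed

text \<open>Each coordinate is replaced by \<open>K arcsin (sin (x / K))\<close>, which is the identity on the ball and
  bounded everywhere. So the Weierstrass theorem on a cube bounds the approximation outside the ball as well.\<close>
lemma trig_poly_approx:
  fixes h :: "'e::euclidean_space \<Rightarrow> real"
  assumes h: "continuous_on UNIV h" and B: "\<And>v. \<bar>h v\<bar> \<le> B" and K: "K > 0" and d: "\<delta> > 0"
  obtains T where "trig_poly T" "\<And>v. norm v \<le> K \<Longrightarrow> \<bar>h v - T v\<bar> \<le> \<delta>" "\<And>v. \<bar>T v\<bar> \<le> B + \<delta>"
proof -
  define G where "G u = h (\<Sum>b\<in>Basis. (K * arcsin (u \<bullet> b)) *\<^sub>R b)" for u :: 'e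
  define S where "S = cbox (- One) (One::'e)"
  have S: "u \<in> S \<longleftrightarrow> (\<forall>b\<in>Basis. \<bar>u \<bullet> b\<bar> \<le> 1)" for u
    unfolding S_def mem_box by (auto simp: abs_le_iff minus_le_iff)
  have "continuous_on S (\<lambda>u. \<Sum>b\<in>Basis. (K * arcsin (u \<bullet> b)) *\<^sub>R b)"
    using S by (intro continuous_intros) (auto simp: abs_le_iff minus_le_iff)
  then have "continuous_on S G"
    unfolding G_def by (rule continuous_on_compose2[OF h]) auto
  moreover have "compact S" unfolding S_def by simp
  ultimately obtain p where p: "real_polynomial_function p" "\<And>u. u \<in> S \<Longrightarrow> \<bar>G u - p u\<bar> < \<delta>"
    using Stone_Weierstrass_real_polynomial_function d by metis
  define e where "e v = (\<Sum>b\<in>Basis. sin ((v \<bullet> b) / K) *\<^sub>R b)" for v :: 'e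
  have eb: "e v \<bullet> b = sin ((v \<bullet> b) / K)" if "b \<in> Basis" for v b
    using that by (simp add: e_def inner_sum_left inner_Basis if_distrib sum.delta cong: if_cong)
  have eS: "e v \<in> S" for v
    using S eb by simp
  have close: "\<bar>G (e v) - p (e v)\<bar> \<le> \<delta>" for v
    using p(2)[OF eS, of v] by simp
  have Gh: "G (e v) = h v" if v: "norm v \<le> K" for v
  proof -
    have "K * arcsin (e v \<bullet> b) = v \<bullet> b" if b: "b \<in> Basis" for b
    proof -
      have "\<bar>v \<bullet> b\<bar> \<le> K" using Basis_le_norm[OF b, of v] v by simp
      then have "- 1 \<le> (v \<bullet> b) / K" "(v \<bullet> b) / K \<le> 1" using K by (auto simp: abs_le_iff field_simps)
      \<comment> \<open>The scaled coordinate lies in [-1, 1], and \<open>pi / 2\<close> is at least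
        1, so it lies in the range where arcsin inverts sin.\<close>
      then have "arcsin (sin ((v \<bullet> b) / K)) = (v \<bullet> b) / K"
        using pi_ge_two by (intro arcsin_sin) linarith+
      then show ?thesis using eb[OF b] K by simp
    qed
    then show ?thesis by (simp add: G_def euclidean_representation)
  qed
  show ?thesis
  proof (rule that)
    show "trig_poly (\<lambda>v. p (e v))"
      unfolding e_def by (rule trig_poly_polynomial_sin[OF p(1)])
    show "\<bar>h v - p (e v)\<bar> \<le> \<delta>" if "norm v \<le> K" for v
      using close[of v] Gh[OF that] by simp
    show "\<bar>p (e v)\<bar> \<le> B + \<delta>" for v
      using close[of v] B[of "\<Sum>b\<in>Basis. (K * arcsin (e v \<bullet> b)) *\<^sub>R b"] unfolding G_def by linarith
  qed
qed

lemma (in prob_space) integrable_bounded_continuous: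
  fixes f :: "'e::euclidean_space \<Rightarrow> real"
  assumes "Z \<in> borel_measurable M" "continuous_on UNIV f" "\<And>v. \<bar>f v\<bar> \<le> B"
  shows "integrable M (\<lambda>\<omega>. f (Z \<omega>))"
  using assms borel_measurable_continuous_onI[OF assms(2)]
  by (intro integrable_const_bound[of _ B]) auto

lemma trig_poly_expectation_tendsto:
  fixes X :: "nat \<Rightarrow> 'a \<Rightarrow> 'e::euclidean_space" and Y :: "'b \<Rightarrow> 'e"
  assumes M: "prob_space M" and N: "prob_space N"
    and X: "\<forall>\<^sub>F n in sequentially. X n \<in> borel_measurable M" and Y: "Y \<in> borel_measurable N"
    and cos: "\<And>t s. (\<lambda>n. \<integral>\<omega>. cos (t \<bullet> X n \<omega> + s) \<partial>M) \<longlonglongrightarrow> (\<integral>\<omega>. cos (t \<bullet> Y \<omega> + s) \<partial>N)"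
    and T: "trig_poly T"
  shows "(\<lambda>n. \<integral>\<omega>. T (X n \<omega>) \<partial>M) \<longlonglongrightarrow> (\<integral>\<omega>. T (Y \<omega>) \<partial>N)"
  using T
proof (induction rule: trig_poly.induct)
  case (cos c t s)
  then show ?case using tendsto_mult_left[OF assms(5)] by simp
next
  case (add f g)
  interpret M: prob_space M by fact
  interpret N: prob_space N by fact
  from add.hyps trig_poly_bounded obtain B B' where B: "\<And>v. \<bar>f v\<bar> \<le> B" "\<And>v. \<bar>g v\<bar> \<le> B'" by metis
  note cont = trig_poly_continuous[OF add.hyps(1)] trig_poly_continuous[OF add.hyps(2)]
  have "\<forall>\<^sub>F n in sequentially. (\<integral>\<omega>. f (X n \<omega>) \<partial>M) + (\<integral>\<omega>. g (X n \<omega>) \<partial>M) = (\<integral>\<omega>. f (X n \<omega>) + g (X n \<omega>) \<partial>M)"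
    using X by eventually_elim
      (use M.integrable_bounded_continuous cont B in \<open>intro Bochner_Integration.integral_add[symmetric]; blast\<close>)
  moreover have "(\<integral>\<omega>. f (Y \<omega>) + g (Y \<omega>) \<partial>N) = (\<integral>\<omega>. f (Y \<omega>) \<partial>N) + (\<integral>\<omega>. g (Y \<omega>) \<partial>N)"
    using N.integrable_bounded_continuous[OF Y] cont B by (intro Bochner_Integration.integral_add) blast+
  ultimately show ?case
    using Lim_transform_eventually[OF tendsto_add[OF add.IH]] by simp
qed

text \<open>Inside the ball the integrands differ by at most \<delta>, outside by at most the sum of
  their bounds, which costs only the probability of leaving the ball.\<close>

lemma (in prob_space) expectation_approx:
  fixes h T :: "'e::euclidean_space \<Rightarrow> real"
  assumes Z: "Z \<in> borel_measurable M"
    and h: "continuous_on UNIV h" "\<And>v. \<bar>h v\<bar> \<le> B"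
    and T: "continuous_on UNIV T" "\<And>v. \<bar>T v\<bar> \<le> B'"
    and close: "\<And>v. norm v \<le> K \<Longrightarrow> \<bar>h v - T v\<bar> \<le> \<delta>" and d: "\<delta> \<ge> 0"
  shows "\<bar>expectation (\<lambda>\<omega>. h (Z \<omega>)) - expectation (\<lambda>\<omega>. T (Z \<omega>))\<bar>
     \<le> \<delta> + (B + B') * prob {\<omega> \<in> space M. norm (Z \<omega>) > K}"
proof -
  note ih = integrable_bounded_continuous[OF Z h] and iT = integrable_bounded_continuous[OF Z T]
  let ?E = "{\<omega> \<in> space M. norm (Z \<omega>) > K}"
  have E[measurable]: "?E \<in> sets M" using Z by measurable
  have BB: "B + B' \<ge> 0" using h(2)[of 0] T(2)[of 0] by linarith
  have "\<bar>h (Z \<omega>) - T (Z \<omega>)\<bar> \<le> \<delta> + (B + B') * indicator ?E \<omega>" if "\<omega> \<in> space M" for \<omega>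
    using close[of "Z \<omega>"] h(2)[of "Z \<omega>"] T(2)[of "Z \<omega>"] that d
    by (cases "norm (Z \<omega>) \<le> K") (auto simp: indicator_def)
  moreover have "integrable M (\<lambda>\<omega>. \<delta> + (B + B') * indicator ?E \<omega> :: real)" by (intro Bochner_Integration.integrable_add integrable_mult_right) (auto simp: emeasure_eq_measure)
  ultimately have "expectation (\<lambda>\<omega>. \<bar>h (Z \<omega>) - T (Z \<omega>)\<bar>) \<le> expectation (\<lambda>\<omega>. \<delta> + (B + B') * indicator ?E \<omega>)"
    using ih iT by (intro integral_mono) auto
  also have "\<dots> = \<delta> + (B + B') * prob ?E"
    by (subst Bochner_Integration.integral_add) (auto simp: emeasure_eq_measure prob_space)
  finally show ?thesis
    using integral_abs_bound[of M "\<lambda>\<omega>. h (Z \<omega>) - T (Z \<omega>)"] ih iT by simp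
qed

lemma (in prob_space) tight_single:
  fixes Y :: "'a \<Rightarrow> 'e::euclidean_space"
  assumes Y[measurable]: "Y \<in> borel_measurable M" and e: "e > 0"
  shows "\<exists>K. prob {\<omega> \<in> space M. norm (Y \<omega>) > K} < e"
proof -
  have "(\<lambda>n. prob {\<omega> \<in> space M. norm (Y \<omega>) > real n}) \<longlonglongrightarrow> prob (\<Inter>n. {\<omega> \<in> space M. norm (Y \<omega>) > real n})"
    by (rule finite_Lim_measure_decseq) (auto simp: decseq_def)
  moreover have "(\<Inter>n. {\<omega> \<in> space M. norm (Y \<omega>) > real n}) = {}"
    by (auto simp: not_less) (meson not_less real_arch_simple)
  ultimately have "(\<lambda>n. prob {\<omega> \<in> space M. norm (Y \<omega>) > real n}) \<longlonglongrightarrow> 0" by simp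
  from order_tendstoD(2)[OF this e] show ?thesis
    by (auto simp: eventually_sequentially)
qed

text \<open>A continuity theorem of Levy's type for a limit law that is already at hand. One radius
  \<open>K\<close> serves both the sequence and the limit, so a single trigonometric polynomial
  replaces \<open>h\<close> on both sides. Measurability is demanded only eventually, as it is
  available for the estimator.\<close>

lemma expectation_tendsto_of_cos:
  fixes X :: "nat \<Rightarrow> 'a \<Rightarrow> 'e::euclidean_space" and Y :: "'b \<Rightarrow> 'e" and h :: "'e \<Rightarrow> real"
  assumes M: "prob_space M" and N: "prob_space N"
    and X: "\<forall>\<^sub>F n in sequentially. X n \<in> borel_measurable M" and Y: "Y \<in> borel_measurable N"
    and cos: "\<And>t s. (\<lambda>n. \<integral>\<omega>. cos (t \<bullet> X n \<omega> + s) \<partial>M) \<longlonglongrightarrow> (\<integral>\<omega>. cos (t \<bullet> Y \<omega> + s) \<partial>N)"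
    and tight: "\<And>e. e > 0 \<Longrightarrow> \<exists>K. \<forall>\<^sub>F n in sequentially. measure M {\<omega> \<in> space M. norm (X n \<omega>) > K} < e"
    and h: "continuous_on UNIV h" "\<And>v. \<bar>h v\<bar> \<le> B"
  shows "(\<lambda>n. \<integral>\<omega>. h (X n \<omega>) \<partial>M) \<longlonglongrightarrow> (\<integral>\<omega>. h (Y \<omega>) \<partial>N)"
proof (rule tendstoI)
  fix r :: real assume r: "r > 0"
  interpret M: prob_space M by fact
  interpret N: prob_space N by fact
  have B0: "B \<ge> 0" using h(2)[of 0] by linarith
  \<comment> \<open>The total error consists of five terms of size at most \<open>r / 5\<close>:
    \<delta> and a tail term on each side, and the convergence for \<open>T\<close>. Having \<delta>
    at most 1 bounds \<open>T\<close> by \<open>B + 1\<close> before \<open>T\<close> is known,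
    which allows \<open>e\<close> to be fixed first, with
    \<open>(2 * B + 1) * e = r / 5\<close>.\<close>
  define \<delta> where "\<delta> = min 1 (r / 5)"
  have d: "\<delta> > 0" "\<delta> \<le> 1" "5 * \<delta> \<le> r" using r by (auto simp: \<delta>_def)
  define e where "e = r / (5 * (2 * B + 1))"
  have e: "e > 0" using r B0 by (simp add: e_def)
  obtain K1 where K1: "\<forall>\<^sub>F n in sequentially. M.prob {\<omega> \<in> space M. norm (X n \<omega>) > K1} < e"
    using tight[OF e] by auto
  obtain K2 where K2: "N.prob {\<omega> \<in> space N. norm (Y \<omega>) > K2} < e"
    using N.tight_single[OF Y e] by auto
  define K where "K = max 1 (max K1 K2)"
  have K: "K > 0" "K1 \<le> K" "K2 \<le> K" by (auto simp: K_def)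
  obtain T where T: "trig_poly T" "\<And>v. norm v \<le> K \<Longrightarrow> \<bar>h v - T v\<bar> \<le> \<delta>" "\<And>v. \<bar>T v\<bar> \<le> B + \<delta>"
    using trig_poly_approx[OF h K(1) d(1)] by blast
  have T': "\<bar>T v\<bar> \<le> B + 1" for v using T(3)[of v] d by linarith
  note Tc = trig_poly_continuous[OF T(1)]
  have bd: "(B + (B + 1)) * q \<le> r / 5" if "q \<le> e" for q
  proof -
    have "(2 * B + 1) * e = r / 5" using B0 unfolding e_def by (simp add: field_simps add_nonneg_eq_0_iff)
    then show ?thesis using mult_left_mono[OF that, of "2 * B + 1"] B0 by (simp add: algebra_simps)
  qed
  have "N.prob {\<omega> \<in> space N. norm (Y \<omega>) > K} \<le> N.prob {\<omega> \<in> space N. norm (Y \<omega>) > K2}"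
    using Y K by (intro N.finite_measure_mono) auto
  then have "(B + (B + 1)) * N.prob {\<omega> \<in> space N. norm (Y \<omega>) > K} \<le> r / 5"
    using K2 by (intro bd) linarith
  moreover have "\<bar>(\<integral>\<omega>. h (Y \<omega>) \<partial>N) - (\<integral>\<omega>. T (Y \<omega>) \<partial>N)\<bar>
      \<le> \<delta> + (B + (B + 1)) * N.prob {\<omega> \<in> space N. norm (Y \<omega>) > K}"
    by (rule N.expectation_approx[OF Y h Tc T' T(2)]) (use d in auto)
  ultimately have YT: "\<bar>(\<integral>\<omega>. h (Y \<omega>) \<partial>N) - (\<integral>\<omega>. T (Y \<omega>) \<partial>N)\<bar> \<le> \<delta> + r / 5" by linarith
  have "\<forall>\<^sub>F n in sequentially. dist (\<integral>\<omega>. T (X n \<omega>) \<partial>M) (\<integral>\<omega>. T (Y \<omega>) \<partial>N) < r / 5"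
    using tendstoD[OF trig_poly_expectation_tendsto[OF M N X Y cos T(1)], of "r / 5"] r by auto
  with X K1 show "\<forall>\<^sub>F n in sequentially. dist (\<integral>\<omega>. h (X n \<omega>) \<partial>M) (\<integral>\<omega>. h (Y \<omega>) \<partial>N) < r"
  proof eventually_elim
    case (elim n)
    have "M.prob {\<omega> \<in> space M. norm (X n \<omega>) > K} \<le> M.prob {\<omega> \<in> space M. norm (X n \<omega>) > K1}"
      using elim(1) K by (intro M.finite_measure_mono) auto
    then have "(B + (B + 1)) * M.prob {\<omega> \<in> space M. norm (X n \<omega>) > K} \<le> r / 5"
      using elim(2) by (intro bd) linarith
    moreover have "\<bar>(\<integral>\<omega>. h (X n \<omega>) \<partial>M) - (\<integral>\<omega>. T (X n \<omega>) \<partial>M)\<bar>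
        \<le> \<delta> + (B + (B + 1)) * M.prob {\<omega> \<in> space M. norm (X n \<omega>) > K}"
      by (rule M.expectation_approx[OF elim(1) h Tc T' T(2)]) (use d in auto)
    ultimately have "\<bar>(\<integral>\<omega>. h (X n \<omega>) \<partial>M) - (\<integral>\<omega>. T (X n \<omega>) \<partial>M)\<bar> \<le> \<delta> + r / 5" by linarith
    then show ?case using elim(3) YT d unfolding dist_real_def by linarith
  qed
qed

section \<open>Gaussian integrals over a finite index set\<close>

definition pos_def_on :: "'i set \<Rightarrow> ('i \<Rightarrow> 'i \<Rightarrow> real) \<Rightarrow> bool" where
  "pos_def_on I Q \<longleftrightarrow> (\<forall>i\<in>I. \<forall>j\<in>I. Q i j = Q j i) \<and>
     (\<forall>z. (\<exists>i\<in>I. z i \<noteq> 0) \<longrightarrow> 0 < (\<Sum>i\<in>I. \<Sum>j\<in>I. z i * Q i j * z j))"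

text \<open>Padding with an identity block embeds matrices indexed by a set \<open>I\<close> into
  square matrices over the whole type, multiplicatively and with the same determinant. Product rule
  for determinants and equality of left and right inverses are then inherited.\<close>

definition block_mat :: "'i set \<Rightarrow> ('i \<Rightarrow> 'i \<Rightarrow> real) \<Rightarrow> real^'i^'i" where
  "block_mat I M = (\<chi> i j. if i \<in> I \<and> j \<in> I then M i j else if i = j then 1 else 0)"

text \<open>In the Leibniz expansion a permutation that moves some \<open>i\<close> outside
  \<open>J\<close> picks up a vanishing off-diagonal entry of row \<open>i\<close>, so only
  permutations of \<open>J\<close> survive.\<close>

lemma det_diagonal_rows:
  fixes A :: "real^'n^'n"
  assumes "\<And>i j. i \<notin> J \<Longrightarrow> j \<noteq> i \<Longrightarrow> A $ i $ j = 0"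
  shows "det A = (\<Prod>i\<in>- J. A $ i $ i) * det_on J (\<lambda>i j. A $ i $ j)"
proof -
  have "det A = (\<Sum>p | p permutes J. of_int (sign p) * (\<Prod>i\<in>UNIV. A $ i $ p i))"
    unfolding det_def
  proof (rule sum.mono_neutral_right)
    show "{p. p permutes J} \<subseteq> {p. p permutes (UNIV :: 'n set)}"
      using permutes_subset by blast
    show "\<forall>p\<in>{p. p permutes UNIV} - {p. p permutes J}. of_int (sign p) * (\<Prod>i\<in>UNIV. A $ i $ p i) = 0"
    proof (intro ballI)
      fix p :: "'n \<Rightarrow> 'n" assume "p \<in> {p. p permutes UNIV} - {p. p permutes J}"
      then obtain i where "i \<notin> J" "p i \<noteq> i" by (auto simp: permutes_def)
      then have "A $ i $ p i = 0" using assms by blast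
      then have "(\<Prod>i\<in>UNIV. A $ i $ p i) = 0" by (auto intro: prod_zero)
      then show "of_int (sign p) * (\<Prod>i\<in>UNIV. A $ i $ p i) = 0" by simp
    qed
  qed (simp add: finite_permutations)
  also have "\<dots> = (\<Sum>p | p permutes J. (\<Prod>i\<in>- J. A $ i $ i) * (of_int (sign p) * (\<Prod>i\<in>J. A $ i $ p i)))"
  proof (rule sum.cong[OF refl])
    fix p assume "p \<in> {p. p permutes J}"
    then have p: "p i = i" if "i \<in> - J" for i using that by (auto simp: permutes_def)
    have "(\<Prod>i\<in>UNIV. A $ i $ p i) = (\<Prod>i\<in>- J. A $ i $ p i) * (\<Prod>i\<in>J. A $ i $ p i)"
      using prod.union_disjoint[of "- J" J "\<lambda>i. A $ i $ p i"] by (simp add: Un_commute)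
    also have "(\<Prod>i\<in>- J. A $ i $ p i) = (\<Prod>i\<in>- J. A $ i $ i)" by (rule prod.cong) (auto simp: p)
    finally show "of_int (sign p) * (\<Prod>i\<in>UNIV. A $ i $ p i)
        = (\<Prod>i\<in>- J. A $ i $ i) * (of_int (sign p) * (\<Prod>i\<in>J. A $ i $ p i))" by simp
  qed
  finally show ?thesis by (simp add: det_on_def sum_distrib_left)
qed

lemma det_on_cong:
  assumes "\<And>i j. i \<in> I \<Longrightarrow> j \<in> I \<Longrightarrow> M i j = N i j"
  shows "det_on I M = det_on I N"
  unfolding det_on_def using assms
  by (intro sum.cong arg_cong2[of _ _ _ _ "(*)"] prod.cong) (auto simp: permutes_in_image)

lemma det_block_mat: "det (block_mat I M) = det_on I M"
  by (subst det_diagonal_rows[where J = I]) (auto simp: block_mat_def intro: det_on_cong)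

lemma block_mat_mult:
  "block_mat I M ** block_mat I N = block_mat I (\<lambda>i k. \<Sum>j\<in>I. M i j * N j k)"
proof -
  have "(\<Sum>j\<in>UNIV. block_mat I M $ i $ j * block_mat I N $ j $ k)
      = block_mat I (\<lambda>i k. \<Sum>j\<in>I. M i j * N j k) $ i $ k" for i k
  proof (cases "i \<in> I")
    case True
    have "(\<Sum>j\<in>UNIV. block_mat I M $ i $ j * block_mat I N $ j $ k)
        = (\<Sum>j\<in>I. block_mat I M $ i $ j * block_mat I N $ j $ k)"
      using True by (intro sum.mono_neutral_right) (auto simp: block_mat_def)
    also have "\<dots> = block_mat I (\<lambda>i k. \<Sum>j\<in>I. M i j * N j k) $ i $ k"
      using True by (cases "k \<in> I") (auto simp: block_mat_def intro!: sum.cong sum.neutral)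
    finally show ?thesis .
  next
    case False
    then have "(\<Sum>j\<in>UNIV. block_mat I M $ i $ j * block_mat I N $ j $ k)
        = (\<Sum>j\<in>{i}. block_mat I M $ i $ j * block_mat I N $ j $ k)"
      by (intro sum.mono_neutral_right) (auto simp: block_mat_def)
    then show ?thesis using False by (simp add: block_mat_def)
  qed
  then show ?thesis by (simp add: matrix_matrix_mult_def vec_eq_iff)
qed

lemma det_on_mult:
  fixes I :: "'i::finite set"
  shows "det_on I (\<lambda>i k. \<Sum>j\<in>I. M i j * N j k) = det_on I M * det_on I N"
  using det_mul[of "block_mat I M" "block_mat I N"] by (simp only: block_mat_mult det_block_mat)

lemma block_mat_eq_mat_1:
  assumes "\<And>i k. i \<in> I \<Longrightarrow> k \<in> I \<Longrightarrow> M i k = (if i = k then 1 else 0)"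
  shows "block_mat I M = mat 1"
  using assms by (auto simp: block_mat_def mat_def vec_eq_iff)

lemma det_on_identity:
  fixes I :: "'i::finite set"
  assumes "\<And>i k. i \<in> I \<Longrightarrow> k \<in> I \<Longrightarrow> M i k = (if i = k then 1 else 0)"
  shows "det_on I M = 1"
  using det_block_mat[of I M] by (simp add: block_mat_eq_mat_1 assms)

text \<open>One step of Gaussian elimination as a factorisation of \<open>Q\<close> into
  \<open>E\<close> and \<open>R\<close>. \<open>E\<close> is the identity except in column
  \<open>k\<close>, and row \<open>k\<close> of it is diagonal; \<open>R\<close> has column
  \<open>k\<close> cleared below and above the pivot. Both determinants reduce to the index set
  \<open>I\<close>, that of \<open>R\<close> after transposing, which is why the symmetry of
  \<open>Q\<close> enters.\<close>

lemma det_on_schur: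
  fixes Q :: "'i::finite \<Rightarrow> 'i \<Rightarrow> real"
  assumes k: "k \<notin> I" "Q k k \<noteq> 0" and sym: "\<And>i j. i \<in> insert k I \<Longrightarrow> j \<in> insert k I \<Longrightarrow> Q i j = Q j i"
  shows "det_on (insert k I) Q = Q k k * det_on I (\<lambda>i j. Q i j - Q i k * Q k j / Q k k)"
proof -
  define E where "E i j = (if j = k then Q i k / Q k k else if i = j then 1 else 0)" for i j
  define R where "R i j = (if i = k then Q k j else Q i j - Q i k * Q k j / Q k k)" for i j
  let ?J = "insert k I"
  have "det_on ?J Q = det_on ?J (\<lambda>i l. \<Sum>j\<in>?J. E i j * R j l)"
  proof (rule det_on_cong)
    fix i l assume "i \<in> ?J" "l \<in> ?J"
    have "(\<Sum>j\<in>?J. E i j * R j l) = E i k * R k l + (\<Sum>j\<in>I. E i j * R j l)"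
      using k by simp
    also have "(\<Sum>j\<in>I. E i j * R j l) = (\<Sum>j\<in>I. if i = j then Q i l - Q i k * Q k l / Q k k else 0)"
      using k by (intro sum.cong) (auto simp: E_def R_def)
    also have "E i k * R k l + \<dots> = Q i l"
      using k \<open>i \<in> ?J\<close> by (auto simp: E_def R_def)
    finally show "Q i l = (\<Sum>j\<in>?J. E i j * R j l)" by simp
  qed
  also have "\<dots> = det_on ?J E * det_on ?J R" by (rule det_on_mult)
  also have "det_on ?J E = 1"
  proof -
    have "det (block_mat ?J E) = (\<Prod>i\<in>- I. block_mat ?J E $ i $ i) * det_on I (\<lambda>i j. block_mat ?J E $ i $ j)"
      using k by (intro det_diagonal_rows) (auto simp: block_mat_def E_def)
    also have "(\<Prod>i\<in>- I. block_mat ?J E $ i $ i) = 1"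
      using k by (intro prod.neutral) (auto simp: block_mat_def E_def)
    also have "det_on I (\<lambda>i j. block_mat ?J E $ i $ j) = 1"
      using k by (intro det_on_identity) (auto simp: block_mat_def E_def)
    finally show ?thesis by (simp add: det_block_mat)
  qed
  also have "det_on ?J R = Q k k * det_on I (\<lambda>i j. Q i j - Q i k * Q k j / Q k k)"
  proof -
    let ?T = "transpose (block_mat ?J R)"
    have R0: "R i k = 0" if "i \<noteq> k" for i using that k by (simp add: R_def)
    have "det ?T = (\<Prod>i\<in>- I. ?T $ i $ i) * det_on I (\<lambda>i j. ?T $ i $ j)"
      using k R0 by (intro det_diagonal_rows) (auto simp: block_mat_def transpose_def)
    also have "(\<Prod>i\<in>- I. ?T $ i $ i) = (\<Prod>i\<in>- I. if i = k then Q k k else 1)"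
      by (intro prod.cong) (auto simp: block_mat_def transpose_def R_def)
    also have "\<dots> = Q k k" using k by (subst prod.delta) auto
    also have "det_on I (\<lambda>i j. ?T $ i $ j) = det_on I (\<lambda>i j. Q i j - Q i k * Q k j / Q k k)"
    proof (rule det_on_cong)
      fix i j assume ij: "i \<in> I" "j \<in> I"
      then show "?T $ i $ j = Q i j - Q i k * Q k j / Q k k"
        using k sym[of i j] sym[of i k] sym[of k j]
        by (auto simp: block_mat_def transpose_def R_def)
    qed
    finally show ?thesis by (simp add: det_transpose det_block_mat)
  qed
  finally show ?thesis by simp
qed

text \<open>Completing the square in the coordinate \<open>k\<close>. The argument has the form
  \<open>x(k := y)\<close> because this is what iterated integration over a product measure
  produces.\<close>

lemma quadratic_form_insert:
  fixes Q :: "'i \<Rightarrow> 'i \<Rightarrow> real"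
  assumes I: "finite I" "k \<notin> I" and sym: "\<And>i j. i \<in> insert k I \<Longrightarrow> j \<in> insert k I \<Longrightarrow> Q i j = Q j i"
    and Qk: "Q k k \<noteq> 0"
  shows "(\<Sum>i\<in>insert k I. \<Sum>j\<in>insert k I. (x(k := y)) i * Q i j * (x(k := y)) j)
    = Q k k * (y + (\<Sum>j\<in>I. Q k j * x j) / Q k k)\<^sup>2
      + (\<Sum>i\<in>I. \<Sum>j\<in>I. x i * (Q i j - Q i k * Q k j / Q k k) * x j)"
proof -
  let ?z = "x(k := y)"
  define P where "P = (\<Sum>j\<in>I. Q k j * x j)"
  have z: "?z i = x i" if "i \<in> I" for i using that I by auto
  have P': "(\<Sum>i\<in>I. x i * Q i k) = P"
    unfolding P_def using sym by (intro sum.cong) (auto simp: mult.commute)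
  have "(\<Sum>i\<in>insert k I. \<Sum>j\<in>insert k I. ?z i * Q i j * ?z j)
     = (y * Q k k * y + (\<Sum>j\<in>I. y * Q k j * x j)) + (\<Sum>i\<in>I. x i * Q i k * y + (\<Sum>j\<in>I. x i * Q i j * x j))"
    using I z by (simp cong: sum.cong)
  also have "\<dots> = y * Q k k * y + y * P + P * y + (\<Sum>i\<in>I. \<Sum>j\<in>I. x i * Q i j * x j)"
  proof -
    have "(\<Sum>j\<in>I. y * Q k j * x j) = y * P" by (simp add: P_def sum_distrib_left mult.assoc)
    moreover have "(\<Sum>i\<in>I. x i * Q i k * y) = P * y" by (simp add: P'[symmetric] sum_distrib_right)
    ultimately show ?thesis by (simp add: sum.distrib)
  qed
  finally have 1: "(\<Sum>i\<in>insert k I. \<Sum>j\<in>insert k I. ?z i * Q i j * ?z j)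
     = Q k k * y\<^sup>2 + 2 * P * y + (\<Sum>i\<in>I. \<Sum>j\<in>I. x i * Q i j * x j)"
    by (simp add: power2_eq_square algebra_simps)
  have "(\<Sum>i\<in>I. \<Sum>j\<in>I. x i * (Q i j - Q i k * Q k j / Q k k) * x j)
     = (\<Sum>i\<in>I. \<Sum>j\<in>I. x i * Q i j * x j - (x i * Q i k) * (Q k j * x j) / Q k k)"
    by (intro sum.cong refl) (simp add: algebra_simps)
  also have "\<dots> = (\<Sum>i\<in>I. \<Sum>j\<in>I. x i * Q i j * x j) - P * P / Q k k"
    unfolding sum_subtractf P'[symmetric] by (subst (2) P') (simp add: P_def sum_product sum_divide_distrib)
  finally have 2: "(\<Sum>i\<in>I. \<Sum>j\<in>I. x i * (Q i j - Q i k * Q k j / Q k k) * x j)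
     = (\<Sum>i\<in>I. \<Sum>j\<in>I. x i * Q i j * x j) - P * P / Q k k" .
  show ?thesis
    unfolding 1 2 P_def[symmetric] using Qk by (simp add: power2_eq_square field_simps)
qed

text \<open>The real part of \<open>iexp s\<close> times the characteristic function of the standard
  normal law. The phase \<open>s\<close> is carried along because, in several variables, integrating
  out one coordinate leaves the others in the argument of the cosine.\<close>

lemma gaussian_cos_integral_std:
  "has_bochner_integral lborel (\<lambda>x. exp (- (x\<^sup>2 / 2)) * cos (t * x + s)) (sqrt (2 * pi) * exp (- (t\<^sup>2 / 2)) * cos s)"
proof -
  interpret real_distribution std_normal_distribution by (rule real_dist_normal_dist)
  have "integrable std_normal_distribution (\<lambda>x. iexp (t * x))"
    by (intro integrable_iexp) auto
  then have ib: "has_bochner_integral std_normal_distribution (\<lambda>x. iexp (t * x)) (of_real (exp (- (t\<^sup>2 / 2))))"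
    using fun_cong[OF char_std_normal_distribution, of t] by (simp add: has_bochner_integral_iff char_def)
  have re: "Re (iexp y) = cos y" for y :: real by (simp add: Re_exp)
  have "iexp s * iexp (t * x) = iexp (t * x + s)" for x
    by (simp only: exp_add[symmetric] distrib_left of_real_add add.commute)
  then have 1: "Re (iexp s * iexp (t * x)) = cos (t * x + s)" for x by (simp only: re)
  have "Re (iexp s * of_real (exp (- (t\<^sup>2 / 2)))) = exp (- (t\<^sup>2 / 2)) * cos s"
    by (simp only: Re_complex_of_real times_complex.simps Im_complex_of_real re mult_zero_right diff_zero mult.commute)
  moreover have "has_bochner_integral std_normal_distribution (\<lambda>x. Re (iexp s * iexp (t * x))) (Re (iexp s * of_real (exp (- (t\<^sup>2 / 2)))))"
    by (rule has_bochner_integral_Re has_bochner_integral_mult_right ib)+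
  ultimately have "has_bochner_integral std_normal_distribution (\<lambda>x. cos (t * x + s)) (exp (- (t\<^sup>2 / 2)) * cos s)"
    unfolding 1 by (simp only:)
  moreover have *: "(\<lambda>x. cos (t * x + s)) \<in> borel_measurable lborel" by measurable
  have m2: "std_normal_density \<in> borel_measurable lborel" by simp
  have nn: "AE x in lborel. 0 \<le> std_normal_density x" by simp
  from calculation have 2: "has_bochner_integral lborel (\<lambda>x. std_normal_density x * cos (t * x + s)) (exp (- (t\<^sup>2 / 2)) * cos s)"
    using integrable_density[OF * m2 nn] integral_density[OF * m2 nn]
    by (simp only: has_bochner_integral_iff real_scaleR_def)
  have "sqrt (2 * pi) * (std_normal_density x * c) = exp (- (x\<^sup>2 / 2)) * c" for x c
    by (simp add: std_normal_density_def)
  then show ?thesis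
    using has_bochner_integral_mult_right[OF 2, of "sqrt (2 * pi)"] by (simp only: mult.assoc)
qed

text \<open>The substitution of \<open>sqrt a * (y + m)\<close> for the standard variable;
  recentring by \<open>m\<close> moves \<open>- t * m\<close> into the phase.\<close>

lemma gaussian_cos_integral_1:
  assumes a: "a > 0"
  shows "has_bochner_integral lborel (\<lambda>y. exp (- (a * (y + m)\<^sup>2 / 2)) * cos (t * y + s))
    (sqrt (2 * pi / a) * exp (- (t\<^sup>2 / a / 2)) * cos (s - t * m))"
proof -
  define r where "r = sqrt a"
  have r: "r > 0" "r\<^sup>2 = a" using a by (auto simp: r_def)
  have "has_bochner_integral lborel (\<lambda>y. exp (- ((r * m + r * y)\<^sup>2 / 2)) * cos (t / r * (r * m + r * y) + (s - t * m)))
     ((sqrt (2 * pi) * exp (- ((t / r)\<^sup>2 / 2)) * cos (s - t * m)) /\<^sub>R \<bar>r\<bar>)"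
    using gaussian_cos_integral_std[of "t / r" "s - t * m"] r
    by (subst (asm) lborel_has_bochner_integral_real_affine_iff[of r _ _ "r * m"]) auto
  moreover have "(r * m + r * y)\<^sup>2 = a * (y + m)\<^sup>2" for y
    by (simp add: r(2)[symmetric] power2_eq_square algebra_simps)
  moreover have "t / r * (r * m + r * y) + (s - t * m) = t * y + s" for y
    using r by (simp add: distrib_left)
  moreover have "(t / r)\<^sup>2 = t\<^sup>2 / a" by (simp add: power_divide r)
  moreover have "(sqrt (2 * pi) * e * c) /\<^sub>R \<bar>r\<bar> = sqrt (2 * pi / a) * e * c" for e c
    using r(1) by (simp add: r_def real_sqrt_divide field_simps)
  ultimately show ?thesis by (simp only:)
qed

section \<open>Positive definite forms, Schur complements and the Gaussian integral\<close>

lemma pos_def_on_sym: "pos_def_on I Q \<Longrightarrow> i \<in> I \<Longrightarrow> j \<in> I \<Longrightarrow> Q i j = Q j i"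
  unfolding pos_def_on_def by blast

lemma pos_def_on_pos:
  assumes "pos_def_on I Q" "i \<in> I" "z i \<noteq> 0"
  shows "0 < (\<Sum>i\<in>I. \<Sum>j\<in>I. z i * Q i j * z j)"
proof -
  have "\<forall>z. (\<exists>i\<in>I. z i \<noteq> 0) \<longrightarrow> 0 < (\<Sum>i\<in>I. \<Sum>j\<in>I. z i * Q i j * z j)"
    using assms(1) unfolding pos_def_on_def by (rule conjunct2)
  then show ?thesis
    by (rule mp[OF spec[of _ z]]) (use assms in blast)
qed

lemma pos_def_on_diag:
  assumes I: "finite I" and pd: "pos_def_on I Q" and k: "k \<in> I"
  shows "Q k k > 0"
proof -
  let ?z = "\<lambda>i. if i = k then 1 else 0 :: real"
  have "0 < (\<Sum>i\<in>I. \<Sum>j\<in>I. ?z i * Q i j * ?z j)"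
    by (rule pos_def_on_pos[OF pd k]) simp
  also have "\<dots> = (\<Sum>i\<in>I. if i = k then Q k k else 0)"
  proof (rule sum.cong[OF refl])
    fix i
    have "(\<Sum>j\<in>I. ?z i * Q i j * ?z j) = (\<Sum>j\<in>I. if j = k then ?z i * Q i k else 0)"
      by (rule sum.cong) auto
    then show "(\<Sum>j\<in>I. ?z i * Q i j * ?z j) = (if i = k then Q k k else 0)"
      using I k by simp
  qed
  also have "\<dots> = Q k k" using I k by simp
  finally show ?thesis .
qed

lemma pos_def_on_schur:
  assumes I: "finite I" "k \<notin> I" and pd: "pos_def_on (insert k I) Q"
  shows "pos_def_on I (\<lambda>i j. Q i j - Q i k * Q k j / Q k k)"
  unfolding pos_def_on_def
proof (intro conjI ballI allI impI)
  have sym: "Q i j = Q j i" if "i \<in> insert k I" "j \<in> insert k I" for i j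
    using pos_def_on_sym[OF pd] that .
  fix i j assume "i \<in> I" "j \<in> I"
  then show "Q i j - Q i k * Q k j / Q k k = Q j i - Q j k * Q k i / Q k k"
    using sym[of i j] sym[of i k] sym[of k j] by simp
next
  have sym: "Q i j = Q j i" if "i \<in> insert k I" "j \<in> insert k I" for i j
    using pos_def_on_sym[OF pd] that .
  have Qk: "Q k k > 0" using pos_def_on_diag[OF _ pd, of k] I by auto
  fix x :: "'a \<Rightarrow> real" assume x: "\<exists>i\<in>I. x i \<noteq> 0"
  \<comment> \<open>For given \<open>x\<close> this is the value of coordinate \<open>k\<close> that
    minimises the form: the completed square vanishes and only the form of the Schur complement is
    left.\<close>
  let ?y = "- ((\<Sum>j\<in>I. Q k j * x j) / Q k k)"
  obtain i where i: "i \<in> I" "x i \<noteq> 0" using x by blast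
  have "0 < (\<Sum>i\<in>insert k I. \<Sum>j\<in>insert k I. (x(k := ?y)) i * Q i j * (x(k := ?y)) j)"
    by (rule pos_def_on_pos[OF pd, of i]) (use i I in auto)
  also have "\<dots> = (\<Sum>i\<in>I. \<Sum>j\<in>I. x i * (Q i j - Q i k * Q k j / Q k k) * x j)"
    by (rule trans[OF quadratic_form_insert[of I k Q x ?y, OF I sym less_imp_neq[OF Qk, symmetric]]]) simp_all
  finally show "0 < (\<Sum>i\<in>I. \<Sum>j\<in>I. x i * (Q i j - Q i k * Q k j / Q k k) * x j)" .
qed

text \<open>Integrating out the coordinate \<open>k\<close> completes the square and replaces \<open>Q\<close> by its Schur
  complement; the vector \<open>w = Q\<^sup>-\<^sup>1 t\<close> restricts to the corresponding vector for the complement, so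
  no inverse has to be tracked through the induction.\<close>
lemma gaussian_cos_integral:
  fixes I :: "'i::finite set"
  assumes "pos_def_on I Q" and "\<And>i. i \<in> I \<Longrightarrow> (\<Sum>j\<in>I. Q i j * w j) = t i"
  shows "det_on I Q > 0 \<and>
    integrable (PiM I (\<lambda>_. lborel)) (\<lambda>z. exp (- ((\<Sum>i\<in>I. \<Sum>j\<in>I. z i * Q i j * z j) / 2))) \<and>
    (\<integral>z. exp (- ((\<Sum>i\<in>I. \<Sum>j\<in>I. z i * Q i j * z j) / 2)) * cos ((\<Sum>i\<in>I. t i * z i) + s) \<partial>PiM I (\<lambda>_. lborel))
    = sqrt ((2 * pi) ^ card I / det_on I Q) * exp (- ((\<Sum>i\<in>I. t i * w i) / 2)) * cos s"
  using finite[of I] assms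
proof (induction I arbitrary: Q t rule: finite_induct)
  case empty
  have "det_on {} Q = 1" by (rule det_on_identity) auto
  then show ?case
    by (simp add: PiM_empty integrable_count_space lebesgue_integral_count_space_finite)
next
  case (insert k I)
  interpret product_sigma_finite "\<lambda>_ :: 'i. lborel :: real measure" by standard
  let ?L = "\<lambda>I :: 'i set. PiM I (\<lambda>_. lborel :: real measure)"
  let ?q = "\<lambda>I Q (z :: 'i \<Rightarrow> real). \<Sum>i\<in>I. \<Sum>j\<in>I. z i * Q i j * z j :: real"
  define Q' where "Q' i j = Q i j - Q i k * Q k j / Q k k" for i j
  define a where "a = Q k k"
  define m where "m x = (\<Sum>j\<in>I. Q k j * x j) / a" for x :: "'i \<Rightarrow> real"
  \<comment> \<open>The phase shift \<open>- t k * m x\<close> is linear in \<open>x\<close>, so it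
    can be absorbed into the frequencies of the remaining coordinates; \<open>t'\<close> is the
    result.\<close>
  define t' where "t' i = t i - Q i k * t k / a" for i
  note I = insert.hyps
  have sym: "Q i j = Q j i" if "i \<in> insert k I" "j \<in> insert k I" for i j
    using pos_def_on_sym[OF insert.prems(1)] that .
  have a: "a > 0" using pos_def_on_diag[OF _ insert.prems(1), of k] I by (auto simp: a_def)
  have pd': "pos_def_on I Q'"
    unfolding Q'_def using pos_def_on_schur[OF I insert.prems(1)] .
  have Qw: "(\<Sum>j\<in>I. Q i j * w j) = t i - Q i k * w k" if "i \<in> insert k I" for i
    using insert.prems(2)[OF that] I by simp
  have w': "(\<Sum>j\<in>I. Q' i j * w j) = t' i" if i: "i \<in> I" for i
  proof -
    have "(\<Sum>j\<in>I. Q' i j * w j) = (\<Sum>j\<in>I. Q i j * w j) - Q i k / a * (\<Sum>j\<in>I. Q k j * w j)"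
      by (simp add: Q'_def a_def sum_subtractf left_diff_distrib sum_distrib_left mult.assoc)
    also have "\<dots> = t' i" unfolding Qw[OF insertI1] Qw[OF insertI2[OF i]] using a
      by (simp add: t'_def a_def[symmetric] field_simps)
    finally show ?thesis .
  qed
  note IH = insert.IH[OF pd' w']
  have det: "det_on (insert k I) Q = a * det_on I Q'"
    unfolding a_def Q'_def using I a sym by (intro det_on_schur) (auto simp: a_def)
  have q: "?q (insert k I) Q (x(k := y)) = a * (y + m x)\<^sup>2 + ?q I Q' x" for x y
    unfolding a_def Q'_def m_def by (rule quadratic_form_insert[of I k Q, OF I sym]) (use a in \<open>simp_all add: a_def\<close>)
  have tw: "(\<Sum>i\<in>insert k I. t i * w i) = (t k)\<^sup>2 / a + (\<Sum>i\<in>I. t' i * w i)"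
  proof -
    have "(\<Sum>i\<in>I. t' i * w i) = (\<Sum>i\<in>I. t i * w i - t k / a * (Q k i * w i))"
      by (intro sum.cong) (auto simp: t'_def left_diff_distrib sym[of _ k])
    also have "\<dots> = (\<Sum>i\<in>I. t i * w i) - t k / a * (t k - a * w k)"
      unfolding sum_subtractf sum_distrib_left[symmetric] Qw[OF insertI1] a_def ..
    finally show ?thesis using I a by (simp add: power2_eq_square field_simps)
  qed
  have tx: "(\<Sum>i\<in>insert k I. t i * (x(k := y)) i) = t k * y + (\<Sum>i\<in>I. t i * x i)" for x y
    using I by (auto intro!: sum.cong)
  have tm: "(\<Sum>i\<in>I. t i * x i) + s - t k * m x = (\<Sum>i\<in>I. t' i * x i) + s" for x
  proof -
    have "(\<Sum>i\<in>I. t' i * x i) = (\<Sum>i\<in>I. t i * x i - t k / a * (Q k i * x i))"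
      by (intro sum.cong) (auto simp: t'_def left_diff_distrib sym[of _ k])
    also have "\<dots> = (\<Sum>i\<in>I. t i * x i) - t k * m x"
      unfolding sum_subtractf sum_distrib_left[symmetric] m_def by simp
    finally show ?thesis by simp
  qed
  have meas: "(\<lambda>z. ?q J R z) \<in> borel_measurable (?L J)" for J R
    by measurable
  \<comment> \<open>Tonelli handles the positive integrand without any integrability; the result
    dominates the oscillating integrand and so permits Fubini for it.\<close>
  have int: "integrable (?L (insert k I)) (\<lambda>z. exp (- (?q (insert k I) Q z / 2)))"
  proof (rule integrableI_nonneg)
    have "(\<integral>\<^sup>+z. ennreal (exp (- (?q (insert k I) Q z / 2))) \<partial>?L (insert k I))
      = (\<integral>\<^sup>+x. \<integral>\<^sup>+y. ennreal (exp (- (?q (insert k I) Q (x(k := y)) / 2))) \<partial>lborel \<partial>?L I)"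
      by (rule product_nn_integral_insert[OF I]) measurable
    also have "\<dots> = (\<integral>\<^sup>+x. ennreal (sqrt (2 * pi / a) * exp (- (?q I Q' x / 2))) \<partial>?L I)"
    proof (rule nn_integral_cong)
      fix x
      have "has_bochner_integral lborel (\<lambda>y. exp (- (?q I Q' x / 2)) * (exp (- (a * (y + m x)\<^sup>2 / 2))))
         (exp (- (?q I Q' x / 2)) * sqrt (2 * pi / a))"
        using gaussian_cos_integral_1[OF a, of "m x" 0 0] by (intro has_bochner_integral_mult_right) simp
      moreover have "exp (- (?q I Q' x / 2)) * exp (- (a * (y + m x)\<^sup>2 / 2)) = exp (- (?q (insert k I) Q (x(k := y)) / 2))" for y
        unfolding q by (simp add: exp_add[symmetric] field_simps)
      ultimately have "has_bochner_integral lborel (\<lambda>y. exp (- (?q (insert k I) Q (x(k := y)) / 2)))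
         (sqrt (2 * pi / a) * exp (- (?q I Q' x / 2)))" by (simp add: mult.commute)
      then show "(\<integral>\<^sup>+y. ennreal (exp (- (?q (insert k I) Q (x(k := y)) / 2))) \<partial>lborel)
          = ennreal (sqrt (2 * pi / a) * exp (- (?q I Q' x / 2)))"
        by (subst nn_integral_eq_integral) (auto simp: has_bochner_integral_iff)
    qed
    also have "\<dots> < \<infinity>"
      using a IH by (subst nn_integral_eq_integral) auto
    finally show "(\<integral>\<^sup>+z. ennreal (exp (- (?q (insert k I) Q z / 2))) \<partial>?L (insert k I)) < \<infinity>" .
  qed (use meas in auto)
  have intc: "integrable (?L (insert k I)) (\<lambda>z. exp (- (?q (insert k I) Q z / 2)) * cos ((\<Sum>i\<in>insert k I. t i * z i) + s))"
  proof (rule Bochner_Integration.integrable_bound[OF int])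
    show "(\<lambda>z. exp (- (?q (insert k I) Q z / 2)) * cos ((\<Sum>i\<in>insert k I. t i * z i) + s)) \<in> borel_measurable (?L (insert k I))"
      by measurable
  qed (auto simp: abs_mult intro!: AE_I2 mult_left_le)
  have "(\<integral>z. exp (- (?q (insert k I) Q z / 2)) * cos ((\<Sum>i\<in>insert k I. t i * z i) + s) \<partial>?L (insert k I))
    = (\<integral>x. \<integral>y. exp (- (?q (insert k I) Q (x(k := y)) / 2)) * cos ((\<Sum>i\<in>insert k I. t i * (x(k := y)) i) + s) \<partial>lborel \<partial>?L I)"
    by (rule product_integral_insert[OF I intc])
  also have "\<dots> = (\<integral>x. (sqrt (2 * pi / a) * exp (- ((t k)\<^sup>2 / a / 2))) * (exp (- (?q I Q' x / 2)) * cos ((\<Sum>i\<in>I. t' i * x i) + s)) \<partial>?L I)"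
  proof (rule Bochner_Integration.integral_cong[OF refl])
    fix x
    have E: "exp (- (?q (insert k I) Q (x(k := y)) / 2)) * c = exp (- (?q I Q' x / 2)) * (exp (- (a * (y + m x)\<^sup>2 / 2)) * c)" for y c
      unfolding q mult.assoc[symmetric] by (simp add: exp_add[symmetric] field_simps)
    have "has_bochner_integral lborel
       (\<lambda>y. exp (- (?q I Q' x / 2)) * (exp (- (a * (y + m x)\<^sup>2 / 2)) * cos (t k * y + ((\<Sum>i\<in>I. t i * x i) + s))))
       (exp (- (?q I Q' x / 2)) * (sqrt (2 * pi / a) * exp (- ((t k)\<^sup>2 / a / 2)) * cos ((\<Sum>i\<in>I. t i * x i) + s - t k * m x)))"
      by (intro has_bochner_integral_mult_right gaussian_cos_integral_1 a)
    then show "(\<integral>y. exp (- (?q (insert k I) Q (x(k := y)) / 2)) * cos ((\<Sum>i\<in>insert k I. t i * (x(k := y)) i) + s) \<partial>lborel)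
        = (sqrt (2 * pi / a) * exp (- ((t k)\<^sup>2 / a / 2))) * (exp (- (?q I Q' x / 2)) * cos ((\<Sum>i\<in>I. t' i * x i) + s))"
      unfolding E tx tm add.assoc has_bochner_integral_iff by (simp only: mult_ac)
  qed
  also have "\<dots> = (sqrt (2 * pi / a) * exp (- ((t k)\<^sup>2 / a / 2))) *
      (sqrt ((2 * pi) ^ card I / det_on I Q') * exp (- ((\<Sum>i\<in>I. t' i * w i) / 2)) * cos s)"
    using IH by simp
  also have "\<dots> = (sqrt (2 * pi / a) * sqrt ((2 * pi) ^ card I / det_on I Q')) *
      (exp (- ((t k)\<^sup>2 / a / 2)) * exp (- ((\<Sum>i\<in>I. t' i * w i) / 2))) * cos s"
    by (simp only: mult_ac)
  also have "sqrt (2 * pi / a) * sqrt ((2 * pi) ^ card I / det_on I Q')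
      = sqrt ((2 * pi) ^ card (insert k I) / det_on (insert k I) Q)"
    using I unfolding det by (simp add: real_sqrt_mult[symmetric])
  also have "exp (- ((t k)\<^sup>2 / a / 2)) * exp (- ((\<Sum>i\<in>I. t' i * w i) / 2)) = exp (- ((\<Sum>i\<in>insert k I. t i * w i) / 2))"
    unfolding tw exp_add[symmetric] by (simp add: add_divide_distrib)
  finally show ?case using int det a IH by simp
qed

text \<open>\<open>inv_on\<close> is a chosen right inverse. Its values on \<open>I\<close> are
  forced since a right inverse of a square matrix is two-sided and hence unique; elsewhere the
  choice is arbitrary.\<close>

lemma inv_on_eqI:
  fixes I :: "'i::finite set"
  assumes S: "\<And>i k. i \<in> I \<Longrightarrow> k \<in> I \<Longrightarrow> (\<Sum>j\<in>I. S i j * Q j k) = (if i = k then 1 else 0)"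
    and ik: "i \<in> I" "k \<in> I"
  shows "inv_on I S i k = Q i k"
proof -
  have 1: "block_mat I S ** block_mat I N = mat 1"
    if "\<And>i k. i \<in> I \<Longrightarrow> k \<in> I \<Longrightarrow> (\<Sum>j\<in>I. S i j * N j k) = (if i = k then 1 else 0)" for N
    unfolding block_mat_mult by (rule block_mat_eq_mat_1[OF that])
  have "\<forall>i\<in>I. \<forall>k\<in>I. (\<Sum>j\<in>I. S i j * inv_on I S j k) = (if i = k then 1 else 0)"
    unfolding inv_on_def by (rule someI[of _ Q]) (use S in simp)
  then have 2: "block_mat I S ** block_mat I (inv_on I S) = mat 1"
    by (intro 1) simp
  have "block_mat I Q ** (block_mat I S ** block_mat I (inv_on I S)) = block_mat I Q"
    using 2 by simp
  moreover have "block_mat I Q ** block_mat I S = mat 1"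
    using 1[OF S] by (simp add: matrix_left_right_inverse)
  ultimately have "block_mat I (inv_on I S) = block_mat I Q"
    by (simp add: matrix_mul_assoc)
  then have "block_mat I (inv_on I S) $ i $ k = block_mat I Q $ i $ k" by (rule arg_cong)
  then show ?thesis using ik by (simp add: block_mat_def)
qed

text \<open>\<open>Q\<close> is the precision matrix, the inverse of the covariance
  \<open>S\<close>. The density is a multiple \<open>k\<close> of the Gaussian exponential for
  \<open>Q\<close>, and since the determinants of \<open>S\<close> and \<open>Q\<close> are
  reciprocal, \<open>k\<close> cancels the constant of the Gaussian integral. Zero frequency and
  zero phase then give total mass 1.\<close>

lemma mvn_on_cos:
  fixes I :: "'i::finite set"
  assumes pd: "pos_def_on I Q"
    and SQ: "\<And>i k. i \<in> I \<Longrightarrow> k \<in> I \<Longrightarrow> (\<Sum>j\<in>I. S i j * Q j k) = (if i = k then 1 else 0)"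
  shows prob_space_mvn_on: "prob_space (mvn_on I S)"
    and integral_mvn_on_cos: "(\<integral>z. cos ((\<Sum>i\<in>I. t i * z i) + s) \<partial>mvn_on I S)
      = exp (- ((\<Sum>i\<in>I. t i * (\<Sum>j\<in>I. S i j * t j)) / 2)) * cos s"
proof -
  let ?L = "PiM I (\<lambda>_. lborel :: real measure)"
  let ?q = "\<lambda>z. \<Sum>i\<in>I. \<Sum>j\<in>I. z i * Q i j * z j :: real"
  define k where "k = (2 * pi) powr (- real (card I) / 2) * det_on I S powr (- 1 / 2)"
  have "block_mat I S ** block_mat I Q = mat 1"
    unfolding block_mat_mult by (rule block_mat_eq_mat_1[OF SQ])
  then have "block_mat I Q ** block_mat I S = mat 1" by (simp add: matrix_left_right_inverse)
  then have B: "block_mat I (\<lambda>i k. \<Sum>j\<in>I. Q i j * S j k) = mat 1"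
    by (simp only: block_mat_mult)
  have QS: "(\<Sum>j\<in>I. Q i j * S j k) = (if i = k then 1 else 0)" if "i \<in> I" "k \<in> I" for i k
    using arg_cong[OF B, of "\<lambda>A. A $ i $ k"] that by (simp add: block_mat_def mat_def)
  \<comment> \<open>The preimage of the frequency \<open>t\<close> under \<open>Q\<close>, as the
    Gaussian integral asks for it, is \<open>S\<close> applied to \<open>t\<close>; this turns its
    exponent into the quadratic form of the covariance.\<close>
  have w: "(\<Sum>j\<in>I. Q i j * (\<Sum>l\<in>I. S j l * t l)) = t i" if i: "i \<in> I" for i t
  proof -
    have "(\<Sum>j\<in>I. Q i j * (\<Sum>l\<in>I. S j l * t l)) = (\<Sum>l\<in>I. (\<Sum>j\<in>I. Q i j * S j l) * t l)"
      unfolding sum_distrib_left sum_distrib_right by (subst sum.swap) (simp only: mult.assoc)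
    also have "\<dots> = (\<Sum>l\<in>I. if i = l then t l else 0)"
      by (rule sum.cong) (use QS i in auto)
    finally show ?thesis using i by simp
  qed
  have G: "(\<integral>z. exp (- (?q z / 2)) * cos ((\<Sum>i\<in>I. t i * z i) + s) \<partial>?L)
      = sqrt ((2 * pi) ^ card I / det_on I Q) * exp (- ((\<Sum>i\<in>I. t i * (\<Sum>j\<in>I. S i j * t j)) / 2)) * cos s" for t s
    using gaussian_cos_integral[OF pd w[of _ t]] by blast
  have detQ: "det_on I Q > 0" and intQ: "integrable ?L (\<lambda>z. exp (- (?q z / 2)))"
    using gaussian_cos_integral[OF pd w] by blast+
  have detS: "det_on I S * det_on I Q = 1"
    using det_on_mult[of I S Q] det_on_identity[of I "\<lambda>i k. \<Sum>j\<in>I. S i j * Q j k"] SQ by simp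
  have "det_on I S = 1 / det_on I Q" using detS detQ by (simp add: field_simps)
  then have "det_on I S powr (- 1 / 2) = sqrt (det_on I Q)"
    using detQ powr_minus_divide[of "1 / det_on I Q" "1 / 2"] powr_half_sqrt[of "1 / det_on I Q"]
    by (simp add: real_sqrt_divide)
  moreover have "(2 * pi) powr (- real (card I) / 2) = 1 / sqrt ((2 * pi) ^ card I)"
  proof -
    have "sqrt ((2 * pi) ^ card I) = ((2 * pi) powr real (card I)) powr (1 / 2)"
      by (subst powr_realpow) (simp_all add: powr_half_sqrt)
    also have "\<dots> = (2 * pi) powr (real (card I) / 2)" by (simp only: powr_powr times_divide_eq_right mult_1_right)
    finally show ?thesis using powr_minus_divide[of "2 * pi" "real (card I) / 2"] by simp
  qed
  ultimately have k: "k * sqrt ((2 * pi) ^ card I / det_on I Q) = 1" and k0: "k \<ge> 0"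
    using detQ by (simp_all add: k_def real_sqrt_divide)
  have dens: "mvn_density I S z = k * exp (- (?q z / 2))" for z
  proof -
    have "(\<Sum>i\<in>I. \<Sum>j\<in>I. z i * inv_on I S i j * z j) = ?q z"
      using inv_on_eqI[OF SQ] by (intro sum.cong refl) auto
    then show ?thesis by (simp add: mvn_density_def k_def)
  qed
  have meas[measurable]: "(\<lambda>z. k * exp (- (?q z / 2))) \<in> borel_measurable ?L" by measurable
  have int: "integrable ?L (\<lambda>z. k * exp (- (?q z / 2)))"
    using intQ by (rule integrable_mult_right)
  have cosint: "(\<integral>z. k * exp (- (?q z / 2)) * cos ((\<Sum>i\<in>I. t i * z i) + s) \<partial>?L)
      = exp (- ((\<Sum>i\<in>I. t i * (\<Sum>j\<in>I. S i j * t j)) / 2)) * cos s" for t s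
  proof -
    have "(\<integral>z. k * exp (- (?q z / 2)) * cos ((\<Sum>i\<in>I. t i * z i) + s) \<partial>?L)
      = k * (sqrt ((2 * pi) ^ card I / det_on I Q) * exp (- ((\<Sum>i\<in>I. t i * (\<Sum>j\<in>I. S i j * t j)) / 2)) * cos s)"
      unfolding mult.assoc[of k] integral_mult_right_zero G ..
    then show ?thesis using k by (simp only: mult.assoc[symmetric] mult_1_left)
  qed
  have "(\<integral>z. k * exp (- (?q z / 2)) \<partial>?L) = 1"
    using cosint[of "\<lambda>_. 0" 0] by simp
  then have "(\<integral>\<^sup>+z. ennreal (k * exp (- (?q z / 2))) \<partial>?L) = 1"
    using k0 by (subst nn_integral_eq_integral[OF int]) auto
  then show "prob_space (mvn_on I S)"
    unfolding mvn_on_def dens by (intro prob_spaceI) (simp add: emeasure_density cong: nn_integral_cong)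
  have "(\<integral>z. cos ((\<Sum>i\<in>I. t i * z i) + s) \<partial>mvn_on I S) = (\<integral>z. (k * exp (- (?q z / 2))) *\<^sub>R cos ((\<Sum>i\<in>I. t i * z i) + s) \<partial>?L)"
    unfolding mvn_on_def dens by (rule integral_density) (use k0 in auto)
  then show "(\<integral>z. cos ((\<Sum>i\<in>I. t i * z i) + s) \<partial>mvn_on I S)
      = exp (- ((\<Sum>i\<in>I. t i * (\<Sum>j\<in>I. S i j * t j)) / 2)) * cos s"
    unfolding real_scaleR_def cosint .
qed

section \<open>A central limit theorem for weighted sums\<close>

lemma exp_minus_quadratic_bound:
  fixes v :: real
  assumes "v \<ge> 0"
  shows "\<bar>exp (- v) - (1 - v)\<bar> \<le> v\<^sup>2 / 2"
proof -
  have lo: "exp (- v) \<ge> 1 - v" using exp_ge_add_one_self[of "- v"] by simp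
  have "(\<lambda>x. 1 - x + x\<^sup>2 / 2 - exp (- x)) 0 \<le> (\<lambda>x. 1 - x + x\<^sup>2 / 2 - exp (- x)) v"
  proof (rule DERIV_nonneg_imp_nondecreasing[OF assms])
    fix x :: real assume "0 \<le> x" "x \<le> v"
    have "((\<lambda>x. 1 - x + x\<^sup>2 / 2 - exp (- x)) has_real_derivative (- 1 + x + exp (- x))) (at x)"
      by (auto intro!: derivative_eq_intros)
    moreover have "- 1 + x + exp (- x) \<ge> 0" using exp_ge_add_one_self[of "- x"] by simp
    ultimately show "\<exists>y. ((\<lambda>x. 1 - x + x\<^sup>2 / 2 - exp (- x)) has_real_derivative y) (at x) \<and> 0 \<le> y" by blast
  qed
  then show ?thesis using lo by simp
qed

context prob_space
begin

text \<open>The comparison is made with the Gaussian exponential and not with the quadratic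
  polynomial of the expansion, because products of factors will be compared and this requires
  factors of modulus at most 1. The polynomial satisfies that only for small
  \<open>s\<close>.\<close>

lemma char_gaussian_approx:
  fixes X :: "'a \<Rightarrow> real"
  assumes rv[measurable]: "random_variable borel X" and i: "integrable M X" "integrable M (\<lambda>\<omega>. (X \<omega>)\<^sup>2)"
    and m: "expectation X = 0" and v: "variance X = \<sigma>\<^sup>2" and e: "e > 0"
  shows "\<exists>r>0. \<forall>s. \<bar>s\<bar> < r \<longrightarrow> cmod (char (distr M borel X) s - exp (- (\<sigma>\<^sup>2 * s\<^sup>2 / 2))) \<le> e * s\<^sup>2"
proof -
  \<comment> \<open>The remainder factor of the second-order expansion. With only two moments
    available the cubic term need not be integrable; the minimum with the quadratic one is dominated
    by an integrable function and tends to 0 pointwise, so \<open>H\<close> tends to 0.\<close>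
  define H where "H s = expectation (\<lambda>\<omega>. min (6 * (X \<omega>)\<^sup>2) (\<bar>s\<bar> * \<bar>X \<omega>\<bar> ^ 3))" for s
  have "(\<lambda>n. H (S n)) \<longlonglongrightarrow> expectation (\<lambda>\<omega>. 0)" if S: "S \<longlonglongrightarrow> 0" for S :: "nat \<Rightarrow> real"
    unfolding H_def
  proof (rule integral_dominated_convergence[where w = "\<lambda>\<omega>. 6 * (X \<omega>)\<^sup>2"])
    have "(\<lambda>n. min (6 * (X \<omega>)\<^sup>2) (\<bar>S n\<bar> * \<bar>X \<omega>\<bar> ^ 3)) \<longlonglongrightarrow> min (6 * (X \<omega>)\<^sup>2) (\<bar>0\<bar> * \<bar>X \<omega>\<bar> ^ 3)" for \<omega>
      by (intro tendsto_intros S)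
    then show "AE \<omega> in M. (\<lambda>n. min (6 * (X \<omega>)\<^sup>2) (\<bar>S n\<bar> * \<bar>X \<omega>\<bar> ^ 3)) \<longlonglongrightarrow> 0"
      by (simp add: min_absorb2)
  qed (use i in auto)
  then have "(H \<longlongrightarrow> 0) (at 0)"
    by (simp flip: LIMSEQ_SEQ_conv)
  moreover have "((\<lambda>s. \<sigma>^4 * s\<^sup>2 / 8) \<longlongrightarrow> \<sigma>^4 * 0\<^sup>2 / 8) (at (0::real))" by (intro tendsto_intros) auto
  ultimately have "((\<lambda>s. H s / 6 + \<sigma>^4 * s\<^sup>2 / 8) \<longlongrightarrow> 0 / 6 + \<sigma>^4 * 0\<^sup>2 / 8) (at 0)" by (intro tendsto_intros) auto
  then have "\<forall>\<^sub>F s in at 0. H s / 6 + \<sigma>^4 * s\<^sup>2 / 8 < e" using e by (intro order_tendstoD(2)) auto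
  then obtain r where r: "r > 0" "\<And>s. s \<noteq> 0 \<Longrightarrow> \<bar>s\<bar> < r \<Longrightarrow> H s / 6 + \<sigma>^4 * s\<^sup>2 / 8 < e"
    unfolding eventually_at by (auto simp: dist_real_def)
  have "cmod (char (distr M borel X) s - exp (- (\<sigma>\<^sup>2 * s\<^sup>2 / 2))) \<le> e * s\<^sup>2" if s: "\<bar>s\<bar> < r" for s
  proof (cases "s = 0")
    case True
    interpret D: real_distribution "distr M borel X" by (rule real_distribution_distr) simp
    show ?thesis using True D.char_zero by simp
  next
    case False
    let ?q = "1 - s\<^sup>2 * \<sigma>\<^sup>2 / 2"
    have 1: "cmod (char (distr M borel X) s - ?q) \<le> (s\<^sup>2 / 6) * H s"
      unfolding H_def by (rule char_approx3'[OF rv i m v refl])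
    have "cmod (of_real (exp (- (\<sigma>\<^sup>2 * s\<^sup>2 / 2))) - of_real ?q) = \<bar>exp (- (\<sigma>\<^sup>2 * s\<^sup>2 / 2)) - (1 - (\<sigma>\<^sup>2 * s\<^sup>2 / 2))\<bar>"
      by (simp add: norm_of_real mult.commute flip: of_real_diff)
    also have "\<dots> \<le> (\<sigma>\<^sup>2 * s\<^sup>2 / 2)\<^sup>2 / 2" by (rule exp_minus_quadratic_bound) simp
    also have "\<dots> = s\<^sup>2 * (\<sigma>^4 * s\<^sup>2 / 8)" by (simp add: power2_eq_square power4_eq_xxxx)
    finally have 2: "cmod (of_real (exp (- (\<sigma>\<^sup>2 * s\<^sup>2 / 2))) - of_real ?q) \<le> s\<^sup>2 * (\<sigma>^4 * s\<^sup>2 / 8)" .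
    have "cmod (char (distr M borel X) s - exp (- (\<sigma>\<^sup>2 * s\<^sup>2 / 2)))
       \<le> cmod (char (distr M borel X) s - of_real ?q) + cmod (of_real (exp (- (\<sigma>\<^sup>2 * s\<^sup>2 / 2))) - of_real ?q)"
      using norm_triangle_ineq4[of "char (distr M borel X) s - of_real ?q" "of_real (exp (- (\<sigma>\<^sup>2 * s\<^sup>2 / 2))) - of_real ?q"]
      by (simp add: algebra_simps flip: exp_of_real)
    also have "\<dots> \<le> (s\<^sup>2 / 6) * H s + s\<^sup>2 * (\<sigma>^4 * s\<^sup>2 / 8)" using 1 2 by (intro add_mono) auto
    also have "\<dots> = s\<^sup>2 * (H s / 6 + \<sigma>^4 * s\<^sup>2 / 8)" by (simp add: algebra_simps)
    also have "\<dots> \<le> s\<^sup>2 * e" using r(2)[OF False s] by (intro mult_left_mono) auto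
    finally show ?thesis by (simp add: mult.commute)
  qed
  then show ?thesis using r(1) by blast
qed

text \<open>Independence turns the characteristic function into a product of values of one fixed
  characteristic function at the weights. Replacing each factor by a Gaussian one costs a small
  multiple of the squared weight, provided that all weights are small, and the squared weights have
  bounded sum.\<close>

lemma char_weighted_sum_tendsto:
  fixes \<epsilon> :: "nat \<Rightarrow> 'a \<Rightarrow> real" and a :: "nat \<Rightarrow> nat \<Rightarrow> real"
  assumes indep: "indep_vars (\<lambda>_. borel) \<epsilon> UNIV" and ident: "\<And>i. distr M borel (\<epsilon> i) = distr M borel (\<epsilon> 0)"
    and i: "integrable M (\<epsilon> 0)" "integrable M (\<lambda>\<omega>. (\<epsilon> 0 \<omega>)\<^sup>2)"
    and m: "expectation (\<epsilon> 0) = 0" and v: "variance (\<epsilon> 0) = \<sigma>\<^sup>2"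
    and sq: "(\<lambda>n. \<Sum>i<n. (a n i)\<^sup>2) \<longlonglongrightarrow> S"
    and small: "\<And>r. r > 0 \<Longrightarrow> \<forall>\<^sub>F n in sequentially. \<forall>i<n. \<bar>a n i\<bar> < r"
  shows "(\<lambda>n. CLINT \<omega>|M. iexp (\<Sum>i<n. a n i * \<epsilon> i \<omega>)) \<longlonglongrightarrow> of_real (exp (- (\<sigma>\<^sup>2 * S / 2)))"
proof -
  have rv[measurable]: "random_variable borel (\<epsilon> k)" for k
    using indep unfolding indep_vars_def2 by simp
  let ?\<phi> = "char (distr M borel (\<epsilon> 0))"
  interpret D: real_distribution "distr M borel (\<epsilon> 0)" by (rule real_distribution_distr) simp
  have prod: "(CLINT \<omega>|M. iexp (\<Sum>i<n. a n i * \<epsilon> i \<omega>)) = (\<Prod>i<n. ?\<phi> (a n i))" for n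
  proof -
    have "(CLINT \<omega>|M. iexp (\<Sum>i<n. a n i * \<epsilon> i \<omega>)) = char (distr M borel (\<lambda>\<omega>. \<Sum>i<n. a n i * \<epsilon> i \<omega>)) 1"
      by (simp add: char_def integral_distr)
    also have "\<dots> = (\<Prod>i<n. char (distr M borel (\<lambda>\<omega>. a n i * \<epsilon> i \<omega>)) 1)"
      by (rule char_distr_sum, rule indep_vars_compose2[where X=\<epsilon>], rule indep_vars_subset[OF indep]) auto
    also have "\<dots> = (\<Prod>i<n. char (distr M borel (\<epsilon> i)) (a n i))"
      by (simp add: char_def integral_distr)
    also have "\<dots> = (\<Prod>i<n. ?\<phi> (a n i))" by (subst ident) simp
    finally show ?thesis .
  qed
  let ?g = "\<lambda>s::real. of_real (exp (- (\<sigma>\<^sup>2 * s\<^sup>2 / 2))) :: complex"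
  have gsum: "(\<Prod>i<n. ?g (a n i)) = of_real (exp (- (\<sigma>\<^sup>2 * (\<Sum>i<n. (a n i)\<^sup>2) / 2)))" for n
    by (simp add: sum_distrib_left sum_divide_distrib exp_sum flip: of_real_prod sum_negf)
  have "(\<lambda>n. (\<Prod>i<n. ?\<phi> (a n i)) - (\<Prod>i<n. ?g (a n i))) \<longlonglongrightarrow> 0"
  proof (rule tendstoI)
    fix e :: real assume e: "e > 0"
    have Sp: "0 \<le> S" by (rule LIMSEQ_le_const[OF sq]) (auto intro!: sum_nonneg)
    \<comment> \<open>The squared weights eventually sum to less than \<open>S + 1\<close>; dividing
      by \<open>S + 2\<close> makes the final bound strictly smaller than \<open>e\<close>.\<close>
    define d where "d = e / (S + 2)"
    have d: "d > 0" using e Sp by (simp add: d_def)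
    obtain r where r: "r > 0" "\<And>s. \<bar>s\<bar> < r \<Longrightarrow> cmod (?\<phi> s - ?g s) \<le> d * s\<^sup>2"
      using char_gaussian_approx[OF rv i m v d] by (auto simp: exp_of_real)
    have "\<forall>\<^sub>F n in sequentially. (\<Sum>i<n. (a n i)\<^sup>2) < S + 1" using sq by (intro order_tendstoD(2)) auto
    with small[OF r(1)]
    show "\<forall>\<^sub>F n in sequentially. dist ((\<Prod>i<n. ?\<phi> (a n i)) - (\<Prod>i<n. ?g (a n i))) 0 < e"
    proof eventually_elim
      case (elim n)
      have "cmod ((\<Prod>i<n. ?\<phi> (a n i)) - (\<Prod>i<n. ?g (a n i))) \<le> (\<Sum>i<n. cmod (?\<phi> (a n i) - ?g (a n i)))"
        by (rule norm_prod_diff) (auto simp: D.cmod_char_le_1)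
      also have "\<dots> \<le> (\<Sum>i<n. d * (a n i)\<^sup>2)" using elim(1) r(2) by (intro sum_mono) auto
      also have "\<dots> = d * (\<Sum>i<n. (a n i)\<^sup>2)" by (simp add: sum_distrib_left)
      also have "\<dots> \<le> d * (S + 1)" using elim(2) d by (intro mult_left_mono) auto
      also have "\<dots> < d * (S + 2)" using d by simp
      also have "\<dots> = e" using Sp by (simp add: d_def)
      finally show ?case by simp
    qed
  qed
  moreover have "(\<lambda>n. \<Prod>i<n. ?g (a n i)) \<longlonglongrightarrow> of_real (exp (- (\<sigma>\<^sup>2 * S / 2)))"
    unfolding gsum by (intro tendsto_intros sq) auto
  ultimately have "(\<lambda>n. (\<Prod>i<n. ?\<phi> (a n i)) - (\<Prod>i<n. ?g (a n i)) + (\<Prod>i<n. ?g (a n i)))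
     \<longlonglongrightarrow> 0 + of_real (exp (- (\<sigma>\<^sup>2 * S / 2)))" by (rule tendsto_add)
  then show ?thesis unfolding prod by simp
qed

end

section \<open>Penalised least squares\<close>

text \<open>A quantitative form of positive definiteness: \<kappa> is kept explicit because for the
  Gram matrix it grows linearly in the sample size, and that growth drives the rates.\<close>

definition coercive :: "real \<Rightarrow> real^'p^'p \<Rightarrow> bool" where
  "coercive \<kappa> G \<longleftrightarrow> \<kappa> > 0 \<and> (\<forall>v. \<kappa> * (norm v)\<^sup>2 \<le> v \<bullet> (G *v v))"

text \<open>The least squares objective without the term that is constant in \<open>b\<close>, with
  \<open>w\<close> in the role of \<open>X'y\<close>. Data enter only through \<open>w\<close> and
  the weights, so continuity in these two is all that measurability requires.\<close>

definition pen_obj :: "real^'p^'p \<Rightarrow> real^'p \<Rightarrow> ('p \<Rightarrow> real) \<Rightarrow> real^'p \<Rightarrow> real" where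
  "pen_obj G w l b = b \<bullet> (G *v b) - 2 * (b \<bullet> w) + (\<Sum>j\<in>UNIV. l j * \<bar>b $ j\<bar>)"

definition pen_min :: "real^'p^'p \<Rightarrow> real^'p \<Rightarrow> ('p \<Rightarrow> real) \<Rightarrow> real^'p" where
  "pen_min G w l = (SOME b. \<forall>b'. pen_obj G w l b \<le> pen_obj G w l b')"

lemma outer_mult_vec: "outer v *v b = (v \<bullet> b) *\<^sub>R v"
  by (simp add: outer_def matrix_vector_mult_def inner_vec_def vec_eq_iff sum_distrib_left sum_distrib_right mult_ac)

lemma sum_matrix_vector_mult: "(\<Sum>i\<in>S. M i) *v b = (\<Sum>i\<in>S. M i *v b)" for M :: "'i \<Rightarrow> real^'p^'q"
  by (induction S rule: infinite_finite_induct) (auto simp: matrix_vector_mult_add_rdistrib)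

lemma gram_mult_vec: "gram x n *v b = (\<Sum>i<n. (x i \<bullet> b) *\<^sub>R x i)"
  by (simp add: gram_def sum_matrix_vector_mult outer_mult_vec)

lemma inner_gram: "v \<bullet> (gram x n *v v) = (\<Sum>i<n. (x i \<bullet> v)\<^sup>2)"
  by (simp add: gram_mult_vec inner_sum_right power2_eq_square inner_commute)

lemma transpose_gram: "transpose (gram x n) = gram x n"
  by (simp add: transpose_def gram_def outer_def vec_eq_iff mult.commute)

lemma gdp_obj_eq_pen_obj:
  "gdp_obj x y n \<alpha> \<eta> b0 b = (\<Sum>i<n. (y i)\<^sup>2)
     + pen_obj (gram x n) (\<Sum>i<n. y i *\<^sub>R x i) (\<lambda>j. \<alpha> / (\<bar>b0 $ j\<bar> + \<eta>)) b"
proof -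
  have "(\<Sum>i<n. (y i - x i \<bullet> b)\<^sup>2) = (\<Sum>i<n. (y i)\<^sup>2 - 2 * (y i * (x i \<bullet> b)) + (x i \<bullet> b)\<^sup>2)"
    by (intro sum.cong refl) (simp add: power2_diff)
  also have "\<dots> = (\<Sum>i<n. (y i)\<^sup>2) - 2 * (\<Sum>i<n. y i * (x i \<bullet> b)) + b \<bullet> (gram x n *v b)"
    by (simp add: inner_gram sum.distrib sum_subtractf sum_distrib_left)
  also have "(\<Sum>i<n. y i * (x i \<bullet> b)) = b \<bullet> (\<Sum>i<n. y i *\<^sub>R x i)"
    by (simp add: inner_sum_right inner_commute)
  finally have 1: "(\<Sum>i<n. (y i - x i \<bullet> b)\<^sup>2) = (\<Sum>i<n. (y i)\<^sup>2) - 2 * (b \<bullet> (\<Sum>i<n. y i *\<^sub>R x i)) + b \<bullet> (gram x n *v b)" .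
  have "\<alpha> * (\<Sum>j\<in>UNIV. \<bar>b $ j\<bar> / (\<bar>b0 $ j\<bar> + \<eta>)) = (\<Sum>j\<in>UNIV. \<alpha> / (\<bar>b0 $ j\<bar> + \<eta>) * \<bar>b $ j\<bar>)"
    by (simp only: sum_distrib_left times_divide_eq_left times_divide_eq_right)
  then show ?thesis
    unfolding gdp_obj_def pen_obj_def 1 by linarith
qed

lemma gdp_os_eq_pen_min:
  "gdp_os x y n \<alpha> \<eta> = pen_min (gram x n) (\<Sum>i<n. y i *\<^sub>R x i) (\<lambda>j. \<alpha> / (\<bar>ls_est x y n $ j\<bar> + \<eta>))"
  by (simp add: gdp_os_def pen_min_def gdp_obj_eq_pen_obj)

lemma continuous_on_pen_obj: "continuous_on S (pen_obj G w l)"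
  unfolding pen_obj_def by (intro continuous_intros matrix_vector_mult_linear_continuous_on)

text \<open>A chosen minimiser has its property only if one exists. Outside the ball of radius
  \<open>R\<close> the quadratic part outweighs the linear one, so the objective is at least 0, its
  value at the origin; inside, compactness gives a minimum.\<close>

lemma pen_min_minimises:
  assumes G: "coercive \<kappa> G" and l: "\<And>j. l j \<ge> 0"
  shows "pen_obj G w l (pen_min G w l) \<le> pen_obj G w l b"
proof -
  have k: "\<kappa> > 0" using G by (simp add: coercive_def)
  define R where "R = 2 * norm w / \<kappa> + 1"
  have R: "R > 0" using k by (simp add: R_def add_nonneg_pos)
  have out: "pen_obj G w l b \<ge> 0" if b: "norm b \<ge> R" for b
  proof -
    have "2 * norm w \<le> \<kappa> * norm b"
      using b k mult_left_mono[of R "norm b" \<kappa>] by (simp add: R_def distrib_left)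
    then have "norm b * (2 * norm w) \<le> norm b * (\<kappa> * norm b)" by (intro mult_left_mono) auto
    also have "\<dots> = \<kappa> * (norm b)\<^sup>2" by (simp add: power2_eq_square)
    also have "\<dots> \<le> b \<bullet> (G *v b)" using G by (simp add: coercive_def)
    finally have "2 * (b \<bullet> w) \<le> b \<bullet> (G *v b)"
      using norm_cauchy_schwarz[of b w] by simp
    moreover have "0 \<le> (\<Sum>j\<in>UNIV. l j * \<bar>b $ j\<bar>)" using l by (intro sum_nonneg) auto
    ultimately show ?thesis by (simp add: pen_obj_def)
  qed
  obtain b0 where b0: "b0 \<in> cball 0 R" "\<And>b. b \<in> cball 0 R \<Longrightarrow> pen_obj G w l b0 \<le> pen_obj G w l b"
    using continuous_attains_inf[OF compact_cball _ continuous_on_pen_obj, of 0 R G w l] R by auto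
  have "pen_obj G w l 0 = 0" by (simp add: pen_obj_def)
  then have "pen_obj G w l b0 \<le> 0" using b0(2)[of 0] R by simp
  then have "\<forall>b. pen_obj G w l b0 \<le> pen_obj G w l b"
    using b0(2) out by (metis dist_0_norm linear mem_cball order_trans)
  then have "\<forall>b. pen_obj G w l (pen_min G w l) \<le> pen_obj G w l b"
    unfolding pen_min_def by (rule someI[of "\<lambda>b. \<forall>b'. pen_obj G w l b \<le> pen_obj G w l b'"])
  then show ?thesis ..
qed

text \<open>Strong convexity in midpoint form: the parallelogram identity for the quadratic part,
  the triangle inequality for the penalty.\<close>

lemma pen_obj_midpoint:
  fixes G :: "real^'a^'a"
  assumes l: "\<And>j. l j \<ge> 0"
  shows "pen_obj G w l ((1/2) *\<^sub>R (a + b)) \<le> pen_obj G w l a / 2 + pen_obj G w l b / 2 - (b - a) \<bullet> (G *v (b - a)) / 4"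
proof -
  have "l j * \<bar>((1/2) *\<^sub>R (a + b)) $ j\<bar> \<le> (l j * \<bar>a $ j\<bar> + l j * \<bar>b $ j\<bar>) / 2" for j
  proof -
    have "\<bar>((1/2) *\<^sub>R (a + b)) $ j\<bar> \<le> (\<bar>a $ j\<bar> + \<bar>b $ j\<bar>) / 2" by simp
    then show ?thesis using mult_left_mono[OF _ l[of j]] by (fastforce simp: distrib_left)
  qed
  then have "(\<Sum>j\<in>UNIV. l j * \<bar>((1/2) *\<^sub>R (a + b)) $ j\<bar>) \<le> (\<Sum>j\<in>UNIV. (l j * \<bar>a $ j\<bar> + l j * \<bar>b $ j\<bar>) / 2)"
    by (rule sum_mono)
  also have "\<dots> = (\<Sum>j\<in>UNIV. l j * \<bar>a $ j\<bar>) / 2 + (\<Sum>j\<in>UNIV. l j * \<bar>b $ j\<bar>) / 2"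
    by (simp add: sum.distrib add_divide_distrib sum_divide_distrib)
  finally have 1: "(\<Sum>j\<in>UNIV. l j * \<bar>((1/2) *\<^sub>R (a + b)) $ j\<bar>) \<le> \<dots>" .
  have "((1/2) *\<^sub>R (a + b)) \<bullet> (G *v ((1/2) *\<^sub>R (a + b)))
     = (a \<bullet> (G *v a)) / 2 + (b \<bullet> (G *v b)) / 2 - (b - a) \<bullet> (G *v (b - a)) / 4"
  proof -
    have "((1/2) *\<^sub>R (a + b)) \<bullet> (G *v ((1/2) *\<^sub>R (a + b)))
       = (a \<bullet> (G *v a) + a \<bullet> (G *v b) + b \<bullet> (G *v a) + b \<bullet> (G *v b)) / 4"
    proof -
      have "G *v ((1/2) *\<^sub>R (a + b)) = (1/2) *\<^sub>R (G *v a + G *v b)"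
        by (simp only: matrix_vector_mult_scaleR matrix_vector_right_distrib)
      moreover have "((1/2) *\<^sub>R u) \<bullet> ((1/2) *\<^sub>R v) = (u \<bullet> v) / 4" for u v :: "real^'a" by simp
      ultimately show ?thesis by (simp only: inner_add_left inner_add_right add_ac)
    qed
    moreover have "(b - a) \<bullet> (G *v (b - a)) = b \<bullet> (G *v b) - b \<bullet> (G *v a) - a \<bullet> (G *v b) + a \<bullet> (G *v a)"
      by (simp add: matrix_vector_mult_diff_distrib inner_diff_left inner_diff_right)
    moreover have "(A + B + B' + D) / 4 = A / 2 + D / 2 - (D - B' - B + A) / 4" for A B B' D :: real
      by (simp add: field_simps)
    ultimately show ?thesis by (simp only:)
  qed
  moreover have "2 * (((1/2) *\<^sub>R (a + b)) \<bullet> w) = a \<bullet> w + b \<bullet> w" by (simp add: inner_add_left)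
  moreover define m where "m = (1/2) *\<^sub>R (a + b)"
  moreover define D where "D = (b - a) \<bullet> (G *v (b - a))"
  moreover define P where "P v = (\<Sum>j\<in>UNIV. l j * \<bar>v $ j\<bar>)" for v
  ultimately have "pen_obj G w l m \<le> pen_obj G w l a / 2 + pen_obj G w l b / 2 - D / 4"
    using 1 unfolding pen_obj_def m_def[symmetric] D_def[symmetric] P_def[symmetric]
    by (simp only: add_divide_distrib diff_divide_distrib)
  then show ?thesis by (simp only: m_def D_def)
qed

text \<open>The minimiser is compared with the midpoint between itself and \<open>b\<close>. The
  resulting quadratic growth forces uniqueness and controls how far the minimiser moves with the
  data.\<close>

lemma pen_min_gap:
  assumes G: "coercive \<kappa> G" and l: "\<And>j. l j \<ge> 0"
  shows "pen_obj G w l (pen_min G w l) + \<kappa> / 2 * (norm (b - pen_min G w l))\<^sup>2 \<le> pen_obj G w l b"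
proof -
  let ?m = "pen_min G w l"
  have "pen_obj G w l ?m \<le> pen_obj G w l ((1/2) *\<^sub>R (?m + b))" by (rule pen_min_minimises[OF G l])
  also have "\<dots> \<le> pen_obj G w l ?m / 2 + pen_obj G w l b / 2 - (b - ?m) \<bullet> (G *v (b - ?m)) / 4"
    by (rule pen_obj_midpoint[OF l])
  finally have "pen_obj G w l ?m + (b - ?m) \<bullet> (G *v (b - ?m)) / 2 \<le> pen_obj G w l b" by linarith
  moreover have "\<kappa> * (norm (b - ?m))\<^sup>2 \<le> (b - ?m) \<bullet> (G *v (b - ?m))" using G by (simp add: coercive_def)
  ultimately show ?thesis by linarith
qed

text \<open>Each problem is tested at the minimiser of the other and the two growth inequalities are
  added. The quadratic parts cancel, and what remains on the right is of first order in the distance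
  of the minimisers, so one factor of it can be divided out.\<close>

lemma pen_min_lipschitz:
  assumes G: "coercive \<kappa> G" and l: "\<And>j. l j \<ge> 0" "\<And>j. l' j \<ge> 0"
  shows "\<kappa> * norm (pen_min G w' l' - pen_min G w l) \<le> 2 * norm (w' - w) + (\<Sum>j\<in>UNIV. \<bar>l' j - l j\<bar>)"
proof -
  let ?b = "pen_min G w l" and ?b' = "pen_min G w' l'"
  let ?d = "?b' - ?b"
  have 1: "pen_obj G w l ?b + \<kappa> / 2 * (norm ?d)\<^sup>2 \<le> pen_obj G w l ?b'"
    by (rule pen_min_gap[OF G l(1)])
  have 2: "pen_obj G w' l' ?b' + \<kappa> / 2 * (norm ?d)\<^sup>2 \<le> pen_obj G w' l' ?b"
    using pen_min_gap[of \<kappa> G l' w' ?b, OF G l(2)] by (simp add: norm_minus_commute)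
  have 3: "pen_obj G w l ?b' - pen_obj G w' l' ?b' + (pen_obj G w' l' ?b - pen_obj G w l ?b)
     = 2 * (?d \<bullet> (w' - w)) + (\<Sum>j\<in>UNIV. (l' j - l j) * (\<bar>?b $ j\<bar> - \<bar>?b' $ j\<bar>))"
    by (simp add: pen_obj_def inner_diff_left inner_diff_right left_diff_distrib right_diff_distrib sum_subtractf)
  have "(\<Sum>j\<in>UNIV. (l' j - l j) * (\<bar>?b $ j\<bar> - \<bar>?b' $ j\<bar>)) \<le> (\<Sum>j\<in>UNIV. \<bar>l' j - l j\<bar> * norm ?d)"
  proof (rule sum_mono)
    fix j
    have "(l' j - l j) * (\<bar>?b $ j\<bar> - \<bar>?b' $ j\<bar>) \<le> \<bar>l' j - l j\<bar> * \<bar>\<bar>?b $ j\<bar> - \<bar>?b' $ j\<bar>\<bar>"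
      by (metis abs_ge_self abs_mult)
    also have "\<bar>\<bar>?b $ j\<bar> - \<bar>?b' $ j\<bar>\<bar> \<le> norm ?d"
      using component_le_norm_cart[of ?d j] by simp
    finally show "(l' j - l j) * (\<bar>?b $ j\<bar> - \<bar>?b' $ j\<bar>) \<le> \<bar>l' j - l j\<bar> * norm ?d"
      by (simp add: mult_left_mono)
  qed
  moreover have "?d \<bullet> (w' - w) \<le> norm ?d * norm (w' - w)" by (rule norm_cauchy_schwarz)
  ultimately have "\<kappa> * (norm ?d)\<^sup>2 \<le> 2 * (norm ?d * norm (w' - w)) + (\<Sum>j\<in>UNIV. \<bar>l' j - l j\<bar> * norm ?d)"
    using 1 2 3 by linarith
  then have "norm ?d * (\<kappa> * norm ?d) \<le> norm ?d * (2 * norm (w' - w) + (\<Sum>j\<in>UNIV. \<bar>l' j - l j\<bar>))"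
    by (simp add: power2_eq_square algebra_simps flip: sum_distrib_right)
  then show ?thesis
  proof (cases "norm ?d = 0")
    case True
    then show ?thesis by (auto intro: add_nonneg_nonneg sum_nonneg)
  next
    case False
    then have "norm ?d > 0" by simp
    then show ?thesis using \<open>norm ?d * _ \<le> _\<close> mult_le_cancel_left_pos by blast
  qed
qed

section \<open>First-order optimality conditions\<close>

lemma inner_symmetric_matrix:
  fixes G :: "real^'p^'p"
  assumes "transpose G = G"
  shows "v \<bullet> (G *v u) = u \<bullet> (G *v v)"
  by (metis assms dot_lmul_matrix inner_commute vector_transpose_matrix)

lemma pen_min_perturb:
  fixes G :: "real^'p^'p" and w :: "real^'p"
  assumes G: "coercive \<kappa> G" "transpose G = G" and l: "\<And>j. l j \<ge> 0"
  defines "b \<equiv> pen_min G w l"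
  shows "0 \<le> 2 * s * (G *v b - w) $ j + s\<^sup>2 * (G $ j $ j) + l j * (\<bar>b $ j + s\<bar> - \<bar>b $ j\<bar>)"
proof -
  let ?e = "axis j 1 :: real^'p"
  have "pen_obj G w l b \<le> pen_obj G w l (b + s *\<^sub>R ?e)"
    unfolding b_def by (rule pen_min_minimises[OF G(1) l])
  also have "pen_obj G w l (b + s *\<^sub>R ?e) = b \<bullet> (G *v b) + 2 * s * (G *v b) $ j + s\<^sup>2 * (G $ j $ j)
      - 2 * (b \<bullet> w) - 2 * s * w $ j + (\<Sum>i\<in>UNIV. l i * \<bar>(b + s *\<^sub>R ?e) $ i\<bar>)"
  proof -
    have "b \<bullet> (G *v ?e) = (G *v b) $ j"
      using inner_symmetric_matrix[OF G(2), of b ?e] by (simp add: inner_axis' )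
    moreover have "?e \<bullet> (G *v ?e) = G $ j $ j"
      by (simp add: inner_axis' matrix_vector_mul_component inner_axis)
    ultimately show ?thesis
      by (simp add: pen_obj_def matrix_vector_right_distrib matrix_vector_mult_scaleR inner_add_left inner_add_right
          inner_axis' power2_eq_square algebra_simps)
  qed
  also have "(\<Sum>i\<in>UNIV. l i * \<bar>(b + s *\<^sub>R ?e) $ i\<bar>)
      = (\<Sum>i\<in>UNIV. l i * \<bar>b $ i\<bar> + (if i = j then l j * (\<bar>b $ j + s\<bar> - \<bar>b $ j\<bar>) else 0))"
    by (intro sum.cong) (auto simp: axis_def algebra_simps)
  also have "\<dots> = (\<Sum>i\<in>UNIV. l i * \<bar>b $ i\<bar>) + l j * (\<bar>b $ j + s\<bar> - \<bar>b $ j\<bar>)"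
    by (simp add: sum.distrib)
  finally show ?thesis by (simp add: pen_obj_def algebra_simps)
qed

text \<open>Division by \<open>s\<close> and the limit from the right extract the first-order term.
  One-sided perturbations are the right tool because the penalty has only one-sided derivatives
  where a coordinate vanishes.\<close>

lemma nonneg_of_small_perturbation:
  fixes A D :: real
  assumes "\<And>s. 0 < s \<Longrightarrow> s < 1 \<Longrightarrow> 0 \<le> s * A + s\<^sup>2 * D"
  shows "0 \<le> A"
proof -
  have "((\<lambda>s. A + s * D) \<longlongrightarrow> A + 0 * D) (at_right 0)" by (intro tendsto_intros)
  moreover have "\<forall>\<^sub>F s in at_right 0. 0 \<le> A + s * D"
    unfolding eventually_at_right_field
  proof (intro exI[of _ 1] conjI allI impI)
    fix s :: real assume s: "0 < s" "s < 1"
    have "0 \<le> s * (A + s * D)" using assms[OF s] by (simp add: power2_eq_square algebra_simps)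
    then show "0 \<le> A + s * D" using s by (simp add: zero_le_mult_iff)
  qed simp
  ultimately show ?thesis by (simp add: tendsto_lowerbound)
qed

text \<open>The Karush-Kuhn-Tucker conditions: the second part says that an active coordinate has the full
  penalty as its score, with the opposite sign.\<close>
lemma pen_min_kkt:
  fixes G :: "real^'p^'p" and w :: "real^'p"
  assumes G: "coercive \<kappa> G" "transpose G = G" and l: "\<And>j. l j \<ge> 0"
  defines "b \<equiv> pen_min G w l"
  shows pen_min_kkt_le: "2 * \<bar>(G *v b - w) $ j\<bar> \<le> l j"
    and pen_min_kkt_sign: "2 * (b $ j * (G *v b - w) $ j) \<le> - l j * \<bar>b $ j\<bar>"
proof -
  let ?g = "(G *v b - w) $ j"
  have P: "0 \<le> 2 * s * ?g + s\<^sup>2 * (G $ j $ j) + l j * (\<bar>b $ j + s\<bar> - \<bar>b $ j\<bar>)" for s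
    unfolding b_def by (rule pen_min_perturb[OF G l])
  \<comment> \<open>The values 1 and -1 of \<open>r\<close> are the two directions along the
    coordinate; in either one the penalty rises by at most \<open>l j * s\<close>, which gives the
    two halves of the bound on the score.\<close>
  have up: "0 \<le> l j + 2 * (r * ?g)" if r: "\<bar>r\<bar> = 1" for r
  proof (rule nonneg_of_small_perturbation)
    fix s :: real assume s: "0 < s" "s < 1"
    have "l j * (\<bar>b $ j + s * r\<bar> - \<bar>b $ j\<bar>) \<le> l j * s"
    proof (rule mult_left_mono[OF _ l])
      have "\<bar>s * r\<bar> = s" using s r by (simp add: abs_mult)
      then show "\<bar>b $ j + s * r\<bar> - \<bar>b $ j\<bar> \<le> s" using abs_triangle_ineq[of "b $ j" "s * r"] by linarith
    qed
    moreover have "(s * r)\<^sup>2 = s\<^sup>2" using r by (simp add: power_mult_distrib flip: power2_abs[of r])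
    moreover have "s * (l j + 2 * (r * g)) + s\<^sup>2 * D = 2 * (s * r) * g + s\<^sup>2 * D + l j * s" for g D
      by (simp add: algebra_simps)
    ultimately show "0 \<le> s * (l j + 2 * (r * ?g)) + s\<^sup>2 * (G $ j $ j)"
      using P[of "s * r"] by (simp only:)
  qed
  show "2 * \<bar>?g\<bar> \<le> l j" using up[of 1] up[of "- 1"] by (simp add: abs_if)
  \<comment> \<open>The perturbation \<open>- s * b $ j\<close> shrinks the coordinate by the factor
    \<open>1 - s\<close>, so the penalty changes by exactly
    \<open>- s * l j * |b $ j|\<close>.\<close>
  have "0 \<le> - (2 * (b $ j * ?g)) - l j * \<bar>b $ j\<bar>"
  proof (rule nonneg_of_small_perturbation)
    fix s :: real assume s: "0 < s" "s < 1"
    have "\<bar>b $ j + - s * b $ j\<bar> = \<bar>(1 - s) * b $ j\<bar>" by (simp add: algebra_simps)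
    also have "\<dots> = (1 - s) * \<bar>b $ j\<bar>" using s by (simp add: abs_mult)
    finally have "\<bar>b $ j + - s * b $ j\<bar> - \<bar>b $ j\<bar> = - s * \<bar>b $ j\<bar>" by (simp add: algebra_simps)
    moreover have "2 * (- s * B) * g + (- s * B)\<^sup>2 * D + l j * (- s * C)
        = s * (- (2 * (B * g)) - l j * C) + s\<^sup>2 * (B\<^sup>2 * D)" for B C D g
      by (simp add: algebra_simps power_mult_distrib)
    ultimately show "0 \<le> s * (- (2 * (b $ j * ?g)) - l j * \<bar>b $ j\<bar>) + s\<^sup>2 * ((b $ j)\<^sup>2 * G $ j $ j)"
      using P[of "- s * b $ j"] by (simp only:)
  qed
  then show "2 * (b $ j * ?g) \<le> - l j * \<bar>b $ j\<bar>" by simp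
qed

section \<open>Asymptotics of the one-step estimator\<close>

lemma matrix_vector_component_le:
  fixes M :: "real^'p^'q"
  shows "\<bar>(M *v v) $ j\<bar> \<le> norm M * norm v"
proof -
  have "\<bar>(M *v v) $ j\<bar> \<le> norm (M $ j) * norm v"
    unfolding matrix_vector_mul_component by (rule Cauchy_Schwarz_ineq2)
  also have "\<dots> \<le> norm M * norm v"
    using Finite_Cartesian_Product.norm_nth_le[of M j] by (intro mult_right_mono) auto
  finally show ?thesis .
qed

lemma inner_matrix_vector_le:
  fixes M :: "real^'p^'p"
  shows "\<bar>v \<bullet> (M *v v)\<bar> \<le> real CARD('p) * norm M * (norm v)\<^sup>2"
proof -
  have "\<bar>v \<bullet> (M *v v)\<bar> \<le> (\<Sum>j\<in>UNIV. \<bar>v $ j * (M *v v) $ j\<bar>)"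
    unfolding inner_vec_def inner_real_def by (rule sum_abs)
  also have "\<dots> \<le> (\<Sum>j\<in>(UNIV::'p set). norm v * (norm M * norm v))"
    unfolding abs_mult
    by (intro sum_mono mult_mono component_le_norm_cart matrix_vector_component_le) auto
  finally show ?thesis by (simp add: power2_eq_square mult_ac)
qed

lemma pos_def_coercive:
  fixes C :: "real^'p^'p"
  assumes "pos_def C"
  shows "\<exists>\<kappa>. coercive \<kappa> C"
proof -
  have "continuous_on (sphere 0 1) (\<lambda>v. v \<bullet> (C *v v))"
    by (intro continuous_intros matrix_vector_mult_linear_continuous_on)
  moreover have "(axis undefined 1 :: real^'p) \<in> sphere 0 1" by simp
  ultimately obtain u where u: "u \<in> sphere 0 1" "\<And>v. v \<in> sphere 0 1 \<Longrightarrow> u \<bullet> (C *v u) \<le> v \<bullet> (C *v v)"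
    using continuous_attains_inf[OF compact_sphere, of 0 1 "\<lambda>v. v \<bullet> (C *v v)"] by blast
  let ?k = "u \<bullet> (C *v u)"
  have "u \<noteq> 0" using u(1) by auto
  then have k: "?k > 0" using assms by (simp add: pos_def_def)
  have "?k * (norm v)\<^sup>2 \<le> v \<bullet> (C *v v)" for v
  proof (cases "v = 0")
    case False
    define e where "e = (1 / norm v) *\<^sub>R v"
    have e: "e \<in> sphere 0 1" "v = norm v *\<^sub>R e" using False by (auto simp: e_def)
    have "v \<bullet> (C *v v) = (norm v)\<^sup>2 * (e \<bullet> (C *v e))"
      by (subst (1 2) e(2)) (simp add: matrix_vector_mult_scaleR power2_eq_square)
    then show ?thesis using mult_right_mono[OF u(2)[OF e(1)], of "(norm v)\<^sup>2"] by (simp add: mult.commute)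
  qed simp
  then show ?thesis using k by (auto simp: coercive_def)
qed

text \<open>The quadratic form of the difference to \<open>C\<close> is at most a multiple of its
  norm, so once that is small half of the constant of \<open>C\<close> survives.\<close>

lemma eventually_coercive_gram:
  fixes C :: "real^'p^'p"
  assumes A2: "(\<lambda>n. (1 / real n) *\<^sub>R gram x n) \<longlonglongrightarrow> C" and C: "pos_def C"
  shows "\<exists>\<kappa>>0. \<forall>\<^sub>F n in sequentially. coercive (\<kappa> * real n) (gram x n)"
proof -
  obtain k where k: "coercive k C" using pos_def_coercive[OF C] by blast
  then have k0: "k > 0" by (simp add: coercive_def)
  let ?D = "\<lambda>n. (1 / real n) *\<^sub>R gram x n - C"
  have "(\<lambda>n. real CARD('p) * norm (?D n)) \<longlonglongrightarrow> real CARD('p) * norm (C - C)"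
    by (intro tendsto_intros A2)
  then have "\<forall>\<^sub>F n in sequentially. real CARD('p) * norm (?D n) < k / 2"
    using k0 by (intro order_tendstoD(2)[of _ "real CARD('p) * norm (C - C)"]) auto
  then have "\<forall>\<^sub>F n in sequentially. coercive (k / 2 * real n) (gram x n)"
    using eventually_gt_at_top[of 0]
  proof eventually_elim
    case (elim n)
    have "k / 2 * real n * (norm v)\<^sup>2 \<le> v \<bullet> (gram x n *v v)" for v
    proof -
      define D where "D = ?D n"
      have "gram x n = real n *\<^sub>R (C + D)" using elim by (simp add: D_def)
      then have "gram x n *v v = real n *\<^sub>R (C *v v + D *v v)"
        by (simp add: scaleR_matrix_vector_assoc[symmetric] matrix_vector_mult_add_rdistrib)
      then have 1: "v \<bullet> (gram x n *v v) = real n * (v \<bullet> (C *v v) + v \<bullet> (D *v v))"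
        by (simp only: inner_scaleR_right inner_add_right)
      have "real CARD('p) * norm (D) * (norm v)\<^sup>2 \<le> k / 2 * (norm v)\<^sup>2"
        using elim by (intro mult_right_mono) (auto simp: D_def)
      then have "- (k / 2 * (norm v)\<^sup>2) \<le> v \<bullet> (D *v v)"
        using inner_matrix_vector_le[of v "D"] by linarith
      moreover have "k * (norm v)\<^sup>2 \<le> v \<bullet> (C *v v)" using k by (simp add: coercive_def)
      ultimately have "k / 2 * (norm v)\<^sup>2 \<le> v \<bullet> (C *v v) + v \<bullet> (D *v v)" by linarith
      then have "real n * (k / 2 * (norm v)\<^sup>2) \<le> v \<bullet> (gram x n *v v)"
        unfolding 1 by (rule mult_left_mono) simp
      then show ?thesis by (simp only: mult_ac)
    qed
    then show ?case using k0 elim by (simp add: coercive_def)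
  qed
  then show ?thesis using k0 by (intro exI[of _ "k / 2"]) auto
qed

lemma coercive_invertible:
  fixes G :: "real^'p^'p"
  assumes "coercive \<kappa> G"
  shows "invertible G"
proof -
  have "v = 0" if "G *v v = 0" for v
  proof -
    have "\<kappa> > 0" "\<kappa> * (norm v)\<^sup>2 \<le> 0" using assms that unfolding coercive_def by (metis inner_zero_right)+
    then show ?thesis by (simp add: mult_le_0_iff)
  qed
  then show ?thesis
    by (simp add: invertible_left_inverse matrix_left_invertible_ker)
qed

lemma coercive_norm_le:
  assumes "coercive \<kappa> G"
  shows "\<kappa> * norm v \<le> norm (G *v v)"
proof (cases "v = 0")
  case False
  have "\<kappa> * (norm v)\<^sup>2 \<le> v \<bullet> (G *v v)" using assms by (simp add: coercive_def)
  also have "\<dots> \<le> norm v * norm (G *v v)" by (rule norm_cauchy_schwarz)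
  finally have "norm v * (\<kappa> * norm v) \<le> norm v * norm (G *v v)" by (simp add: power2_eq_square mult_ac)
  then show ?thesis using False by simp
qed simp

lemma response_sum:
  "(\<Sum>i<n. (x i \<bullet> \<beta> + \<nu> i) *\<^sub>R x i) = gram x n *v \<beta> + (\<Sum>i<n. \<nu> i *\<^sub>R x i)"
  by (simp add: gram_mult_vec scaleR_add_left sum.distrib)

text \<open>The normal equations. They express the error of the initial estimator by the same vector
  \<open>X'\<epsilon>\<close> that drives the penalised one, so one event controls both.\<close>

lemma gram_ls_est:
  assumes "coercive \<kappa> (gram x n)"
  shows "gram x n *v (ls_est x (\<lambda>i. x i \<bullet> \<beta> + \<nu> i) n - \<beta>) = (\<Sum>i<n. \<nu> i *\<^sub>R x i)"
proof -
  have "gram x n ** matrix_inv (gram x n) = mat 1"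
    using someI_ex[OF coercive_invertible[OF assms, unfolded invertible_def]] unfolding matrix_inv_def by (rule conjunct1)
  then have "gram x n *v ls_est x (\<lambda>i. x i \<bullet> \<beta> + \<nu> i) n = (\<Sum>i<n. (x i \<bullet> \<beta> + \<nu> i) *\<^sub>R x i)"
    unfolding ls_est_def by (simp add: matrix_vector_mul_assoc)
  then show ?thesis by (simp add: matrix_vector_mult_diff_distrib response_sum)
qed

text \<open>The local coordinates \<open>u = sqrt n (b - \<beta>)\<close> are those in which the quadratic part of the
  objective is of order one.\<close>
lemma gdp_os_local:
  fixes x :: "nat \<Rightarrow> real^'p" and \<beta> :: "real^'p" and \<nu> :: "nat \<Rightarrow> real"
  assumes G: "coercive (\<kappa> * real n) (gram x n)" and n: "n > 0" and ae: "\<alpha> > 0" "\<eta> > 0"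
  defines "y \<equiv> (\<lambda>i. x i \<bullet> \<beta> + \<nu> i)"
  defines "b \<equiv> gdp_os x y n \<alpha> \<eta>" and "b0 \<equiv> ls_est x y n"
  defines "W \<equiv> (1 / sqrt (real n)) *\<^sub>R (\<Sum>i<n. \<nu> i *\<^sub>R x i)"
  defines "u \<equiv> sqrt (real n) *\<^sub>R (b - \<beta>)" and "Cn \<equiv> (1 / real n) *\<^sub>R gram x n"
  defines "L \<equiv> (\<lambda>j. \<alpha> / (sqrt (real n) * (\<bar>b0 $ j\<bar> + \<eta>)))"
  shows local_kkt: "2 * \<bar>(Cn *v u - W) $ j\<bar> \<le> L j"
    and local_kkt_active: "b $ j \<noteq> 0 \<Longrightarrow> L j \<le> 2 * \<bar>(Cn *v u - W) $ j\<bar>"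
    and local_norm_le: "\<kappa> * norm u \<le> norm W + (\<Sum>j | \<beta> $ j \<noteq> 0. L j)"
    and local_initial: "\<kappa> * sqrt (real n) * norm (b0 - \<beta>) \<le> norm W"
proof -
  let ?G = "gram x n" and ?r = "sqrt (real n)" and ?e = "\<Sum>i<n. \<nu> i *\<^sub>R x i"
  have r: "?r > 0" "?r * ?r = real n" using n by auto
  have k: "\<kappa> > 0" using G n by (simp add: coercive_def zero_less_mult_iff)
  define l where "l j = \<alpha> / (\<bar>b0 $ j\<bar> + \<eta>)" for j
  have l: "l j \<ge> 0" for j using ae by (simp add: l_def)
  have lL: "L j = l j / ?r" for j by (simp add: L_def l_def)
  have b: "b = pen_min ?G (?G *v \<beta> + ?e) l"
    unfolding b_def gdp_os_eq_pen_min y_def response_sum l_def b0_def ..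
  define g where "g = Cn *v u - W"
  have eW: "?e = ?r *\<^sub>R W" using r by (simp add: W_def)
  have bu: "b - \<beta> = (1 / ?r) *\<^sub>R u" using r by (simp add: u_def)
  have GC: "?G = real n *\<^sub>R Cn" using n by (simp add: Cn_def)
  have "?G *v b - (?G *v \<beta> + ?e) = ?G *v (b - \<beta>) - ?e" by (simp add: matrix_vector_mult_diff_distrib)
  also have "\<dots> = ?r *\<^sub>R g"
  proof -
    have "?G *v (b - \<beta>) = real n *\<^sub>R (1 / ?r) *\<^sub>R (Cn *v u)"
      unfolding bu GC by (simp add: matrix_vector_mult_scaleR scaleR_matrix_vector_assoc[symmetric])
    also have "\<dots> = ?r *\<^sub>R (Cn *v u)" using r(1) by (simp add: real_div_sqrt)
    finally show ?thesis by (simp add: g_def eW scaleR_diff_right)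
  qed
  finally have res: "(?G *v b - (?G *v \<beta> + ?e)) $ j = ?r * g $ j" for j by simp
  have "2 * \<bar>?r * g $ j\<bar> \<le> l j" for j
    using pen_min_kkt_le[where l = l and w = "?G *v \<beta> + ?e" and j = j, OF G transpose_gram l] unfolding b[symmetric] res .
  then have "2 * (?r * \<bar>g $ j\<bar>) \<le> l j" for j using r by (simp add: abs_mult)
  then have 1: "2 * \<bar>g $ j\<bar> \<le> L j" for j unfolding lL using r(1) by (simp add: pos_le_divide_eq mult_ac)
  then show "2 * \<bar>(Cn *v u - W) $ j\<bar> \<le> L j" unfolding g_def .
  have "2 * (b $ j * (?r * g $ j)) \<le> - l j * \<bar>b $ j\<bar>" for j
    using pen_min_kkt_sign[where l = l and w = "?G *v \<beta> + ?e" and j = j, OF G transpose_gram l] unfolding b[symmetric] res .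
  then have "2 * (b $ j * g $ j) * ?r \<le> - l j * \<bar>b $ j\<bar>" for j by (simp only: mult_ac)
  then have "2 * (b $ j * g $ j) \<le> - l j * \<bar>b $ j\<bar> / ?r" for j using r(1) by (simp only: pos_le_divide_eq)
  then have 2: "2 * (b $ j * g $ j) \<le> - (L j * \<bar>b $ j\<bar>)" for j unfolding lL by simp
  show "L j \<le> 2 * \<bar>(Cn *v u - W) $ j\<bar>" if "b $ j \<noteq> 0"
  proof -
    have "L j * \<bar>b $ j\<bar> \<le> - (2 * (b $ j * g $ j))" using 2[of j] by linarith
    also have "\<dots> \<le> \<bar>2 * (b $ j * g $ j)\<bar>" by (rule abs_ge_minus_self)
    also have "\<dots> = 2 * \<bar>g $ j\<bar> * \<bar>b $ j\<bar>" by (simp add: abs_mult)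
    finally show ?thesis using that by (simp add: g_def)
  qed
  have ucoerc: "\<kappa> * (norm u)\<^sup>2 \<le> u \<bullet> (Cn *v u)"
  proof -
    have "\<kappa> * real n * (norm u)\<^sup>2 \<le> u \<bullet> (?G *v u)" using G by (simp add: coercive_def)
    also have "u \<bullet> (?G *v u) = real n * (u \<bullet> (Cn *v u))"
      unfolding GC by (simp add: scaleR_matrix_vector_assoc[symmetric])
    finally have "real n * (\<kappa> * (norm u)\<^sup>2) \<le> real n * (u \<bullet> (Cn *v u))" by (simp only: mult_ac)
    then show ?thesis using n by simp
  qed
  \<comment> \<open>Where the true coefficient is 0, \<open>u $ j\<close> is a positive multiple of
    \<open>b $ j\<close>, and the sign condition makes the product nonpositive however large the
    weight is. So only the weights on the support, which tend to 0, enter the bound on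
    \<open>u\<close>.\<close>
  have ug: "u $ j * g $ j \<le> (if \<beta> $ j \<noteq> 0 then L j * norm u else 0)" for j
  proof (cases "\<beta> $ j = 0")
    case True
    then have "u $ j * g $ j = ?r * (b $ j * g $ j)" by (simp add: u_def)
    have "b $ j * g $ j \<le> 0"
      using 2[of j] 1[of j] by (smt (verit) mult_nonneg_nonneg abs_ge_zero)
    then have "?r * (b $ j * g $ j) \<le> 0" by (rule mult_nonneg_nonpos[OF less_imp_le[OF r(1)]])
    with \<open>u $ j * g $ j = _\<close> show ?thesis using True by (simp only: simp_thms if_False)
  next
    case False
    have "u $ j * g $ j \<le> \<bar>u $ j\<bar> * \<bar>g $ j\<bar>" by (metis abs_ge_self abs_mult)
    also have "\<dots> \<le> norm u * L j"
      using 1[of j] by (intro mult_mono component_le_norm_cart) auto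
    finally show ?thesis using False by (simp add: mult.commute)
  qed
  have "\<kappa> * (norm u)\<^sup>2 \<le> u \<bullet> W + u \<bullet> g" using ucoerc by (simp add: g_def inner_diff_right)
  also have "u \<bullet> W \<le> norm u * norm W" by (rule norm_cauchy_schwarz)
  also have "u \<bullet> g \<le> (\<Sum>j\<in>UNIV. if \<beta> $ j \<noteq> 0 then L j * norm u else 0)"
    unfolding inner_vec_def inner_real_def by (rule sum_mono[OF ug])
  also have "\<dots> = norm u * (\<Sum>j | \<beta> $ j \<noteq> 0. L j)"
    by (simp add: sum.If_cases sum_distrib_left mult.commute)
  finally have "norm u * (\<kappa> * norm u) \<le> norm u * (norm W + (\<Sum>j | \<beta> $ j \<noteq> 0. L j))"
    by (simp add: power2_eq_square distrib_left mult_ac)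
  moreover have "0 \<le> norm W + (\<Sum>j | \<beta> $ j \<noteq> 0. L j)"
    using l r by (intro add_nonneg_nonneg sum_nonneg) (auto simp: lL)
  ultimately show "\<kappa> * norm u \<le> norm W + (\<Sum>j | \<beta> $ j \<noteq> 0. L j)"
    by (cases "norm u = 0") auto
  have "\<kappa> * real n * norm (b0 - \<beta>) \<le> norm ?e"
    using coercive_norm_le[OF G, of "b0 - \<beta>"] gram_ls_est[OF G] unfolding b0_def y_def by simp
  also have "\<dots> = ?r * norm W" using eW r by simp
  also have "\<kappa> * real n * norm (b0 - \<beta>) = ?r * (\<kappa> * ?r * norm (b0 - \<beta>))"
    by (subst r(2)[symmetric]) (simp only: mult_ac)
  finally show "\<kappa> * ?r * norm (b0 - \<beta>) \<le> norm W" by (simp only: mult_le_cancel_left_pos[OF r(1)])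
qed

text \<open>The quantifier over the noise \<nu> stands inside the eventuality: the threshold for
  \<open>n\<close> depends on the noise only through the radius \<open>K\<close>. Hence no null sets
  or measurability arise here, and the probability of the conclusion is at least that of the
  ball.\<close>

lemma gdp_os_selection_eventually:
  fixes x :: "nat \<Rightarrow> real^'p" and \<beta> :: "real^'p" and \<Gamma> :: "'p \<Rightarrow> 'p \<Rightarrow> real"
  assumes A2: "(\<lambda>n. (1 / real n) *\<^sub>R gram x n) \<longlonglongrightarrow> C" and Cpd: "pos_def C"
    and \<alpha>pos: "\<And>n. \<alpha> n > 0" and \<eta>pos: "\<And>n. \<eta> n > 0"
    and \<alpha>inf: "filterlim \<alpha> at_top sequentially"
    and \<alpha>rate: "(\<lambda>n. \<alpha> n / sqrt (real n)) \<longlonglongrightarrow> 0"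
    and \<eta>rate: "(\<lambda>n. \<eta> n * sqrt (real n)) \<longlonglongrightarrow> c"
    and A: "A = {j. \<beta> $ j \<noteq> 0}"
    and \<Gamma>: "\<And>i k. i \<in> A \<Longrightarrow> k \<in> A \<Longrightarrow> (\<Sum>j\<in>A. \<Gamma> i j * C $ j $ k) = (if i = k then 1 else 0)"
    and K: "K \<ge> 0" and \<delta>: "\<delta> > 0"
  shows "\<forall>\<^sub>F n in sequentially. \<forall>\<nu>.
    norm ((1 / sqrt (real n)) *\<^sub>R (\<Sum>i<n. \<nu> i *\<^sub>R x i)) \<le> K \<longrightarrow>
    {j. gdp_os x (\<lambda>i. x i \<bullet> \<beta> + \<nu> i) n (\<alpha> n) (\<eta> n) $ j \<noteq> 0} = A \<and>
    (\<forall>i\<in>A. \<bar>sqrt (real n) * (gdp_os x (\<lambda>i. x i \<bullet> \<beta> + \<nu> i) n (\<alpha> n) (\<eta> n) $ i - \<beta> $ i)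
       - (\<Sum>j\<in>A. \<Gamma> i j * ((1 / sqrt (real n)) *\<^sub>R (\<Sum>i<n. \<nu> i *\<^sub>R x i)) $ j)\<bar> \<le> \<delta>)"
proof -
  obtain \<kappa> where \<kappa>: "\<kappa> > 0" and ec: "\<forall>\<^sub>F n in sequentially. coercive (\<kappa> * real n) (gram x n)"
    using eventually_coercive_gram[OF A2 Cpd] by blast
  have c: "c \<ge> 0"
    by (rule LIMSEQ_le_const[OF \<eta>rate]) (auto intro!: mult_nonneg_nonneg less_imp_le[OF \<eta>pos])
  \<comment> \<open>A bound for \<open>norm u\<close>: the local estimate gives
    \<open>\<kappa> * norm u\<close> at most \<open>K\<close> plus the sum of the weights on
    \<open>A\<close>, which is eventually below 1.\<close>
  define K3 where "K3 = (K + 1) / \<kappa>"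
  have K3: "K3 \<ge> 0" using K \<kappa> by (simp add: K3_def)
  \<comment> \<open>A bound off \<open>A\<close> for \<open>sqrt n * (|b0 $ j| + \<eta> n)\<close>:
    the error of the initial estimator contributes \<open>K / \<kappa>\<close>, and
    \<open>\<eta> n * sqrt n\<close> is eventually below \<open>c + 1\<close>.\<close>
  define m where "m = K / \<kappa> + (c + 1)"
  have m: "m > 0" using K \<kappa> c by (simp add: m_def add_nonneg_pos)
  define B where "B = (\<Sum>i\<in>A. \<Sum>j\<in>A. \<bar>\<Gamma> i j\<bar>)"
  have B: "(\<Sum>j\<in>A. \<bar>\<Gamma> i j\<bar>) \<le> B" if "i \<in> A" for i
    unfolding B_def by (rule member_le_sum[OF that]) (auto intro: sum_nonneg)
  define \<rho> where "\<rho> n = norm ((1 / real n) *\<^sub>R gram x n - C)" for n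
  \<comment> \<open>Dominates the scaled weights on \<open>A\<close> and their sum. The factor 2
    appears because the initial estimate of a nonzero coefficient is only known to exceed half its
    size.\<close>
  define \<Lambda> where "\<Lambda> n = (\<Sum>j\<in>A. \<alpha> n / sqrt (real n) * (2 / \<bar>\<beta> $ j\<bar>))" for n
  have "\<rho> \<longlonglongrightarrow> norm (C - C)" unfolding \<rho>_def by (intro tendsto_intros A2)
  then have \<rho>0: "\<rho> \<longlonglongrightarrow> 0" by simp
  have "\<Lambda> \<longlonglongrightarrow> (\<Sum>j\<in>A. 0 * (2 / \<bar>\<beta> $ j\<bar>))" unfolding \<Lambda>_def by (intro tendsto_intros \<alpha>rate)
  then have \<Lambda>0: "\<Lambda> \<longlonglongrightarrow> 0" by simp
  have inv: "(\<lambda>n. r / sqrt (real n)) \<longlonglongrightarrow> 0" for r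
    by (rule tendsto_divide_0[OF tendsto_const]) (intro filterlim_at_top_imp_at_infinity filterlim_compose[OF sqrt_at_top] filterlim_real_sequentially)
  have e1: "\<forall>\<^sub>F n in sequentially. \<forall>j\<in>A. (K / \<kappa>) / sqrt (real n) < \<bar>\<beta> $ j\<bar> / 2"
    unfolding eventually_ball_finite_distrib[OF finite]
    by (intro ballI order_tendstoD(2)[OF inv]) (simp add: A)
  have e2: "\<forall>\<^sub>F n in sequentially. \<forall>j\<in>A. K3 / sqrt (real n) < \<bar>\<beta> $ j\<bar>"
    unfolding eventually_ball_finite_distrib[OF finite]
    by (intro ballI order_tendstoD(2)[OF inv]) (simp add: A)
  have e3: "\<forall>\<^sub>F n in sequentially. \<Lambda> n < 1" by (rule order_tendstoD(2)[OF \<Lambda>0]) simp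
  have e4: "\<forall>\<^sub>F n in sequentially. \<rho> n < 1" by (rule order_tendstoD(2)[OF \<rho>0]) simp
  have "(\<lambda>n. B * (\<rho> n * K3 + \<Lambda> n)) \<longlonglongrightarrow> B * (0 * K3 + 0)" by (intro tendsto_intros \<rho>0 \<Lambda>0)
  then have e5: "\<forall>\<^sub>F n in sequentially. B * (\<rho> n * K3 + \<Lambda> n) < \<delta>"
    by (rule order_tendstoD(2)) (use \<delta> in simp)
  have e6: "\<forall>\<^sub>F n in sequentially. \<eta> n * sqrt (real n) < c + 1" by (rule order_tendstoD(2)[OF \<eta>rate]) simp
  \<comment> \<open>The entries of the score \<open>Cn *v u - W\<close> are at most
    \<open>(norm C + 1) * K3 + K\<close> once \<open>\<rho> n < 1\<close>. An active coordinate off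
    \<open>A\<close> would need \<open>\<alpha> n / m\<close> to be at most twice this.\<close>
  have e7: "\<forall>\<^sub>F n in sequentially. m * (2 * ((norm C + 1) * K3 + K)) < \<alpha> n"
    using \<alpha>inf unfolding filterlim_at_top_dense by blast
  show ?thesis
    using ec eventually_gt_at_top[of 0] e1 e2 e3 e4 e5 e6 e7
  proof eventually_elim
    case (elim n)
    show ?case
    proof (intro allI impI)
      fix \<nu> :: "nat \<Rightarrow> real"
      define y where "y = (\<lambda>i. x i \<bullet> \<beta> + \<nu> i)"
      define b where "b = gdp_os x y n (\<alpha> n) (\<eta> n)"
      define b0 where "b0 = ls_est x y n"
      define r where "r = sqrt (real n)"
      define W where "W = (1 / r) *\<^sub>R (\<Sum>i<n. \<nu> i *\<^sub>R x i)"
      define u where "u = r *\<^sub>R (b - \<beta>)"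
      define Cn where "Cn = (1 / real n) *\<^sub>R gram x n"
      define L where "L = (\<lambda>j. \<alpha> n / (r * (\<bar>b0 $ j\<bar> + \<eta> n)))"
      note defs = b_def b0_def y_def r_def W_def u_def Cn_def L_def
      note loc = elim(1,2) \<alpha>pos[of n] \<eta>pos[of n]
      assume "norm ((1 / sqrt (real n)) *\<^sub>R (\<Sum>i<n. \<nu> i *\<^sub>R x i)) \<le> K"
      then have WK: "norm W \<le> K" by (simp only: W_def r_def)
      have r: "r > 0" using elim(2) by (simp add: r_def)
      have kkt: "2 * \<bar>(Cn *v u - W) $ j\<bar> \<le> L j" for j
        unfolding defs by (rule local_kkt[OF loc])
      have active: "L j \<le> 2 * \<bar>(Cn *v u - W) $ j\<bar>" if "b $ j \<noteq> 0" for j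
        using that unfolding defs by (rule local_kkt_active[OF loc])
      have un: "\<kappa> * norm u \<le> norm W + (\<Sum>j\<in>A. L j)"
        unfolding defs A by (rule local_norm_le[OF loc])
      have ini: "\<kappa> * r * norm (b0 - \<beta>) \<le> norm W"
        unfolding defs by (rule local_initial[OF loc])
      have b0: "r * norm (b0 - \<beta>) \<le> K / \<kappa>"
      proof -
        have "(r * norm (b0 - \<beta>)) * \<kappa> \<le> K" using order_trans[OF ini WK] by (simp only: mult_ac)
        then show ?thesis using \<kappa> by (simp add: pos_le_divide_eq)
      qed
      have LA: "L j \<le> \<alpha> n / r * (2 / \<bar>\<beta> $ j\<bar>)" if j: "j \<in> A" for j
      proof -
        have bj: "\<bar>\<beta> $ j\<bar> > 0" using j A by simp
        have "norm (b0 - \<beta>) \<le> (K / \<kappa>) / r" using b0 by (simp only: pos_le_divide_eq[OF r] mult.commute)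
        also have "\<dots> < \<bar>\<beta> $ j\<bar> / 2" using elim(3) j by (simp add: r_def)
        finally have "\<bar>b0 $ j - \<beta> $ j\<bar> < \<bar>\<beta> $ j\<bar> / 2"
          using component_le_norm_cart[of "b0 - \<beta>" j] by simp
        then have "\<bar>\<beta> $ j\<bar> / 2 \<le> \<bar>b0 $ j\<bar> + \<eta> n" using \<eta>pos[of n] by linarith
        then have "\<alpha> n / (r * (\<bar>b0 $ j\<bar> + \<eta> n)) \<le> \<alpha> n / (r * (\<bar>\<beta> $ j\<bar> / 2))"
          using r bj \<alpha>pos[of n] by (intro divide_left_mono mult_left_mono mult_pos_pos) auto
        then show ?thesis by (simp add: L_def mult_ac)
      qed
      have "(\<Sum>j\<in>A. L j) \<le> \<Lambda> n" unfolding \<Lambda>_def r_def[symmetric] by (rule sum_mono[OF LA])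
      then have "\<kappa> * norm u \<le> K + 1" using un WK elim(5) by linarith
      then have uK: "norm u \<le> K3" using \<kappa> by (simp add: K3_def pos_le_divide_eq mult.commute)
      have L\<Lambda>: "L j \<le> \<Lambda> n" if j: "j \<in> A" for j
      proof -
        have "\<alpha> n / r * (2 / \<bar>\<beta> $ j\<bar>) \<le> \<Lambda> n"
          unfolding \<Lambda>_def r_def[symmetric] using r \<alpha>pos[of n] j
          by (intro member_le_sum) auto
        then show ?thesis using LA[OF j] by linarith
      qed
      have bu: "b $ j - \<beta> $ j = u $ j / r" for j using r by (simp add: u_def)
      have nz: "b $ j \<noteq> 0" if j: "j \<in> A" for j
      proof
        assume "b $ j = 0"
        then have "\<bar>\<beta> $ j\<bar> = \<bar>u $ j\<bar> / r" using bu[of j] r by (simp add: abs_divide[symmetric] flip: abs_minus_cancel[of "\<beta> $ j"])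
        also have "\<dots> \<le> K3 / r"
          using component_le_norm_cart[of u j] uK r by (intro divide_right_mono) auto
        also have "\<dots> < \<bar>\<beta> $ j\<bar>" using elim(4) j by (simp add: r_def)
        finally show False by simp
      qed
      have z: "b $ j = 0" if j: "j \<notin> A" for j
      proof (rule ccontr)
        assume nz: "b $ j \<noteq> 0"
        have "\<beta> $ j = 0" using j A by simp
        then have "\<bar>b0 $ j\<bar> \<le> norm (b0 - \<beta>)" using component_le_norm_cart[of "b0 - \<beta>" j] by simp
        then have "r * \<bar>b0 $ j\<bar> \<le> r * norm (b0 - \<beta>)" using r by (intro mult_left_mono) auto
        then have "r * (\<bar>b0 $ j\<bar> + \<eta> n) \<le> m"
          using b0 elim(8) by (simp add: m_def distrib_left r_def mult.commute)
        then have "\<alpha> n / m \<le> L j"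
          unfolding L_def using r \<alpha>pos[of n] \<eta>pos[of n] m
          by (intro divide_left_mono mult_pos_pos) (auto intro: add_nonneg_pos)
        also have "L j \<le> 2 * \<bar>(Cn *v u - W) $ j\<bar>" by (rule active[OF nz])
        also have "\<dots> \<le> 2 * ((norm C + 1) * K3 + K)"
        proof -
          have "norm Cn \<le> norm C + 1" using elim(6) norm_triangle_ineq2[of Cn C] by (simp add: \<rho>_def Cn_def)
          then have "norm Cn * norm u \<le> (norm C + 1) * K3" using uK by (intro mult_mono) auto
          then have "\<bar>(Cn *v u) $ j\<bar> \<le> (norm C + 1) * K3" using matrix_vector_component_le[of Cn u j] by linarith
          moreover have "\<bar>W $ j\<bar> \<le> K" using component_le_norm_cart[of W j] WK by linarith
          ultimately show ?thesis
            using abs_triangle_ineq4[of "(Cn *v u) $ j" "W $ j"] by simp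
        qed
        finally have "\<alpha> n \<le> m * (2 * ((norm C + 1) * K3 + K))" using m by (simp add: pos_divide_le_eq mult.commute)
        then show False using elim(9) by linarith
      qed
      have u0: "u $ k = 0" if "k \<notin> A" for k using z[OF that] that A by (simp add: u_def)
      have close: "\<bar>u $ i - (\<Sum>j\<in>A. \<Gamma> i j * W $ j)\<bar> \<le> \<delta>" if i: "i \<in> A" for i
      proof -
        \<comment> \<open>Since \<open>u\<close> vanishes off \<open>A\<close>, only the block of
          \<open>C\<close> on \<open>A\<close> acts, and the left inverse \<Gamma> recovers
          \<open>u\<close> exactly. The error is then \<Gamma> applied to \<open>C *v u - W\<close>,
          which is the score bounded by the weights, up to the replacement of \<open>Cn\<close> by
          \<open>C\<close>.\<close>
        have Cu: "(C *v u) $ j = (\<Sum>k\<in>A. C $ j $ k * u $ k)" for j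
          unfolding matrix_vector_mult_def by (simp, rule sum.mono_neutral_right) (auto simp: u0)
        have "(\<Sum>j\<in>A. \<Gamma> i j * (C *v u) $ j) = (\<Sum>k\<in>A. (\<Sum>j\<in>A. \<Gamma> i j * C $ j $ k) * u $ k)"
          unfolding Cu sum_distrib_left sum_distrib_right by (subst sum.swap) (simp only: mult.assoc)
        also have "\<dots> = (\<Sum>k\<in>A. if i = k then u $ k else 0)"
          by (rule sum.cong) (use \<Gamma> i in auto)
        also have "\<dots> = u $ i" using i by simp
        finally have "u $ i - (\<Sum>j\<in>A. \<Gamma> i j * W $ j) = (\<Sum>j\<in>A. \<Gamma> i j * ((C *v u) $ j - W $ j))"
          by (simp add: right_diff_distrib sum_subtractf)
        also have "\<bar>\<dots>\<bar> \<le> (\<Sum>j\<in>A. \<bar>\<Gamma> i j\<bar> * (\<rho> n * K3 + \<Lambda> n))"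
        proof (rule order_trans[OF sum_abs sum_mono])
          fix j assume j: "j \<in> A"
          have "(C *v u) $ j - W $ j = (Cn *v u - W) $ j - ((Cn - C) *v u) $ j"
            by (simp add: matrix_vector_mult_diff_rdistrib)
          moreover have "\<bar>(Cn *v u - W) $ j\<bar> \<le> \<Lambda> n" using kkt[of j] L\<Lambda>[OF j] by linarith
          moreover have "\<bar>((Cn - C) *v u) $ j\<bar> \<le> \<rho> n * K3"
            using matrix_vector_component_le[of "Cn - C" u j] mult_left_mono[OF uK, of "norm (Cn - C)"]
            by (simp add: \<rho>_def Cn_def)
          ultimately have "\<bar>(C *v u) $ j - W $ j\<bar> \<le> \<rho> n * K3 + \<Lambda> n" by linarith
          then show "\<bar>\<Gamma> i j * ((C *v u) $ j - W $ j)\<bar> \<le> \<bar>\<Gamma> i j\<bar> * (\<rho> n * K3 + \<Lambda> n)"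
            unfolding abs_mult by (rule mult_left_mono) simp
        qed
        also have "\<dots> = (\<Sum>j\<in>A. \<bar>\<Gamma> i j\<bar>) * (\<rho> n * K3 + \<Lambda> n)" by (simp only: sum_distrib_right)
        also have "\<dots> \<le> B * (\<rho> n * K3 + \<Lambda> n)"
          by (rule mult_right_mono[OF B[OF i]])
            (use K3 \<alpha>pos[of n] in \<open>auto simp: \<rho>_def \<Lambda>_def intro!: add_nonneg_nonneg sum_nonneg mult_nonneg_nonneg\<close>)
        finally show ?thesis using elim(7) by linarith
      qed
      have "{j. b $ j \<noteq> 0} = A" using nz z by blast
      then show "{j. gdp_os x (\<lambda>i. x i \<bullet> \<beta> + \<nu> i) n (\<alpha> n) (\<eta> n) $ j \<noteq> 0} = A \<and>
        (\<forall>i\<in>A. \<bar>sqrt (real n) * (gdp_os x (\<lambda>i. x i \<bullet> \<beta> + \<nu> i) n (\<alpha> n) (\<eta> n) $ i - \<beta> $ i)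
          - (\<Sum>j\<in>A. \<Gamma> i j * ((1 / sqrt (real n)) *\<^sub>R (\<Sum>i<n. \<nu> i *\<^sub>R x i)) $ j)\<bar> \<le> \<delta>)"
        using close unfolding u_def vector_scaleR_component vector_minus_component b_def y_def W_def r_def by simp
    qed
  qed
qed

text \<open>The weights depend on \<open>w\<close> as well, because the initial estimator is
  computed from the same data; this is why the Lipschitz bound allows both arguments to
  vary.\<close>

lemma pen_min_continuous:
  fixes G :: "real^'p^'p" and l :: "real^'p \<Rightarrow> 'p \<Rightarrow> real"
  assumes G: "coercive \<kappa> G" and l: "\<And>w j. l w j \<ge> 0" and cont: "\<And>j. continuous_on UNIV (\<lambda>w. l w j)"
  shows "continuous_on UNIV (\<lambda>w. pen_min G w (l w))"
  unfolding continuous_on_eq_continuous_at[OF open_UNIV]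
proof (intro ballI)
  fix w :: "real^'p"
  have k: "\<kappa> > 0" using G by (simp add: coercive_def)
  let ?b = "\<lambda>v. (2 * norm (v - w) + (\<Sum>j\<in>UNIV. \<bar>l v j - l w j\<bar>)) / \<kappa>"
  have "((\<lambda>v. l v j) \<longlongrightarrow> l w j) (at w)" for j
    using cont[of j] by (simp add: continuous_on_eq_continuous_at isCont_def)
  then have "(?b \<longlongrightarrow> (2 * norm (w - w) + (\<Sum>j\<in>UNIV. \<bar>l w j - l w j\<bar>)) / \<kappa>) (at w)"
    using k by (intro tendsto_intros) auto
  then have b0: "(?b \<longlongrightarrow> 0) (at w)" by simp
  have "norm (pen_min G v (l v) - pen_min G w (l w)) \<le> ?b v" for v
  proof -
    have "\<kappa> * norm (pen_min G v (l v) - pen_min G w (l w)) \<le> 2 * norm (v - w) + (\<Sum>j\<in>UNIV. \<bar>l v j - l w j\<bar>)"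
      by (rule pen_min_lipschitz[OF G l l])
    then show ?thesis using k by (simp only: pos_le_divide_eq mult.commute)
  qed
  then have "((\<lambda>v. pen_min G v (l v) - pen_min G w (l w)) \<longlongrightarrow> 0) (at w)"
    by (intro Lim_null_comparison[OF _ b0] always_eventually) simp
  then show "isCont (\<lambda>w. pen_min G w (l w)) w"
    unfolding isCont_def by (rule LIM_zero_cancel)
qed

text \<open>The estimator is a continuous function of the single random vector \<open>X'y\<close>,
  since least squares is a fixed matrix applied to it and positive \<eta> keeps the denominators of
  the weights away from 0.\<close>

lemma gdp_os_measurable:
  fixes x :: "nat \<Rightarrow> real^'p"
  assumes G: "coercive \<kappa> (gram x n)" and "\<alpha> > 0" "\<eta> > 0" and [measurable]: "\<And>i. y i \<in> borel_measurable M"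
  shows "(\<lambda>\<omega>. gdp_os x (\<lambda>i. y i \<omega>) n \<alpha> \<eta>) \<in> borel_measurable M"
proof -
  let ?l = "\<lambda>w j. \<alpha> / (\<bar>(matrix_inv (gram x n) *v w) $ j\<bar> + \<eta>)"
  have "continuous_on UNIV (\<lambda>w. pen_min (gram x n) w (?l w))"
  proof (rule pen_min_continuous[OF G])
    show "continuous_on UNIV (\<lambda>w. ?l w j)" for j
      using assms(3) by (intro continuous_intros matrix_vector_mult_linear_continuous_on) (auto simp: add_nonneg_eq_0_iff)
  qed (use assms in auto)
  then have "(\<lambda>w. pen_min (gram x n) w (?l w)) \<in> borel_measurable borel"
    by (rule borel_measurable_continuous_onI)
  then have "(\<lambda>\<omega>. (\<lambda>w. pen_min (gram x n) w (?l w)) (\<Sum>i<n. y i \<omega> *\<^sub>R x i)) \<in> borel_measurable M"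
    by (rule measurable_compose[rotated]) measurable
  then show ?thesis unfolding gdp_os_eq_pen_min ls_est_def .
qed

section \<open>Moments, negligible terms and principal submatrices\<close>

lemma (in prob_space) second_moment_weighted_sum:
  fixes \<epsilon> :: "nat \<Rightarrow> 'a \<Rightarrow> real" and a :: "nat \<Rightarrow> real"
  assumes indep: "indep_vars (\<lambda>_. borel) \<epsilon> UNIV"
    and i: "\<And>i. integrable M (\<epsilon> i)" "\<And>i. integrable M (\<lambda>\<omega>. (\<epsilon> i \<omega>)\<^sup>2)"
    and m: "\<And>i. expectation (\<epsilon> i) = 0" and v: "\<And>i. expectation (\<lambda>\<omega>. (\<epsilon> i \<omega>)\<^sup>2) = v"
  shows "integrable M (\<lambda>\<omega>. (\<Sum>i<n. a i * \<epsilon> i \<omega>)\<^sup>2) \<and>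
    expectation (\<lambda>\<omega>. (\<Sum>i<n. a i * \<epsilon> i \<omega>)\<^sup>2) = v * (\<Sum>i<n. (a i)\<^sup>2)"
proof (induction n)
  case (Suc n)
  let ?S = "\<lambda>\<omega>. \<Sum>i<n. a i * \<epsilon> i \<omega>" and ?X = "\<lambda>\<omega>. a n * \<epsilon> n \<omega>"
  have "indep_vars (\<lambda>_. borel) (\<lambda>i \<omega>. a i * \<epsilon> i \<omega>) (insert n {..<n})"
    by (rule indep_vars_compose2[where X = \<epsilon>], rule indep_vars_subset[OF indep]) auto
  then have ind: "indep_var borel ?X borel ?S" by (intro indep_vars_sum) auto
  have iX: "integrable M ?X" and iS: "integrable M ?S"
    using i by (auto intro!: Bochner_Integration.integrable_sum)
  have XS: "expectation (\<lambda>\<omega>. ?X \<omega> * ?S \<omega>) = 0"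
    using indep_var_lebesgue_integral[OF ind iX iS] m by simp
  have iXS: "integrable M (\<lambda>\<omega>. ?X \<omega> * ?S \<omega>)" by (rule indep_var_integrable[OF ind iX iS])
  have iX2: "integrable M (\<lambda>\<omega>. (?X \<omega>)\<^sup>2)" using i by (simp add: power_mult_distrib)
  have eq: "(\<Sum>i<Suc n. a i * \<epsilon> i \<omega>)\<^sup>2 = ((?S \<omega>)\<^sup>2 + (?X \<omega>)\<^sup>2) + 2 * (?X \<omega> * ?S \<omega>)" for \<omega>
    by (simp only: sum.lessThan_Suc power2_sum mult_ac)
  have "expectation (\<lambda>\<omega>. (?X \<omega>)\<^sup>2) = (a n)\<^sup>2 * v" using v by (simp add: power_mult_distrib)
  then show ?case
    unfolding eq using Suc iX2 iXS XS by (simp add: distrib_left mult.commute)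
qed simp

text \<open>Up to the factor \<open>n / (n + 1)\<close>, the quotient \<open>d n / (n + 1)\<close> is a difference of consecutive
  averages, so it tends to 0.\<close>
lemma terms_negligible_of_average_tendsto:
  fixes d :: "nat \<Rightarrow> real"
  assumes avg: "(\<lambda>n. (\<Sum>k<n. d k) / real n) \<longlonglongrightarrow> Q" and d: "\<And>k. d k \<ge> 0" and r: "r > 0"
  shows "\<forall>\<^sub>F n in sequentially. \<forall>k<n. d k < r * real n"
proof -
  have "(\<lambda>n. (\<Sum>k<Suc n. d k) / real (Suc n) - (\<Sum>k<n. d k) / real n * (real n / real (Suc n))) \<longlonglongrightarrow> Q - Q * 1"
    by (intro tendsto_intros LIMSEQ_Suc[OF avg] avg LIMSEQ_n_over_Suc_n)
  moreover have "(\<Sum>k<Suc n. d k) / real (Suc n) - (\<Sum>k<n. d k) / real n * (real n / real (Suc n)) = d n / real (Suc n)" for n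
    by (cases "n = 0") (simp_all add: add_divide_distrib del: of_nat_Suc)
  ultimately have "(\<lambda>n. d n / real (Suc n)) \<longlonglongrightarrow> 0" by simp
  then have "\<forall>\<^sub>F n in sequentially. d n / real (Suc n) < r" by (rule order_tendstoD(2)) (rule r)
  then obtain N where N: "\<And>n. n \<ge> N \<Longrightarrow> d n / real (Suc n) < r"
    unfolding eventually_sequentially by blast
  \<comment> \<open>The indices below \<open>N\<close> are finitely many, so their terms are bounded
    by a fixed number that \<open>r * real n\<close> eventually exceeds. A later index
    \<open>k\<close> satisfies \<open>d k < r * (k + 1)\<close>, and \<open>k < n\<close> turns this
    into the claim.\<close>
  define D where "D = (\<Sum>k<N. d k)"
  have "\<forall>\<^sub>F n in sequentially. D / r < real n"
    using filterlim_real_sequentially unfolding filterlim_at_top_dense by blast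
  then show ?thesis
  proof eventually_elim
    case (elim n)
    show ?case
    proof (intro allI impI)
      fix k assume k: "k < n"
      show "d k < r * real n"
      proof (cases "k < N")
        case True
        then have "d k \<le> D" unfolding D_def using d by (intro member_le_sum) auto
        also have "D < r * real n" using elim r by (simp add: pos_divide_less_eq mult.commute)
        finally show ?thesis .
      next
        case False
        then have "d k < r * real (Suc k)" using N[of k] by (simp add: pos_divide_less_eq del: of_nat_Suc)
        also have "\<dots> \<le> r * real n" using k r by (intro mult_left_mono) auto
        finally show ?thesis .
      qed
    qed
  qed
qed

text \<open>The chosen inverse is one from the right, whereas solving for \<open>u\<close> needs one
  from the left. Existence follows from a nonzero determinant, whose positivity comes from the
  Gaussian integral at frequency 0.\<close>

lemma inv_on_left:
  fixes I :: "'i::finite set"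
  assumes pd: "pos_def_on I Q"
    and ik: "i \<in> I" "k \<in> I"
  shows "(\<Sum>j\<in>I. inv_on I Q i j * Q j k) = (if i = k then 1 else 0)"
proof -
  define w where "w = (\<lambda>_::'i. 0::real)"
  have "det_on I Q > 0" using gaussian_cos_integral[OF pd, of w w] by (auto simp: w_def)
  then have "invertible (block_mat I Q)" by (simp add: invertible_det_nz det_block_mat)
  then obtain B where B: "block_mat I Q ** B = mat 1" unfolding invertible_def by blast
  have "\<forall>i\<in>I. \<forall>k\<in>I. (\<Sum>j\<in>I. Q i j * B $ j $ k) = (if i = k then 1 else 0)"
  proof (intro ballI)
    fix i k assume i: "i \<in> I" and k: "k \<in> I"
    have "(block_mat I Q ** B) $ i $ k = (\<Sum>j\<in>I. block_mat I Q $ i $ j * B $ j $ k)"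
      unfolding matrix_matrix_mult_def using i by (simp, intro sum.mono_neutral_right) (auto simp: block_mat_def)
    also have "\<dots> = (\<Sum>j\<in>I. Q i j * B $ j $ k)" using i by (intro sum.cong) (auto simp: block_mat_def)
    finally show "(\<Sum>j\<in>I. Q i j * B $ j $ k) = (if i = k then 1 else 0)" by (simp add: B mat_def)
  qed
  then have R: "\<forall>i\<in>I. \<forall>k\<in>I. (\<Sum>j\<in>I. Q i j * inv_on I Q j k) = (if i = k then 1 else 0)"
    unfolding inv_on_def
    by (rule someI[where P = "\<lambda>N. \<forall>i\<in>I. \<forall>k\<in>I. (\<Sum>j\<in>I. Q i j * N j k) = (if i = k then 1 else 0)" and x = "\<lambda>j k. B $ j $ k"])
  have "block_mat I Q ** block_mat I (inv_on I Q) = mat 1"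
    unfolding block_mat_mult using R by (intro block_mat_eq_mat_1) blast
  then have "block_mat I (inv_on I Q) ** block_mat I Q = mat 1" by (simp add: matrix_left_right_inverse)
  then have "block_mat I (\<lambda>i k. \<Sum>j\<in>I. inv_on I Q i j * Q j k) = mat 1" by (simp only: block_mat_mult)
  from arg_cong[OF this, of "\<lambda>A. A $ i $ k"] show ?thesis
    using ik by (simp add: block_mat_def mat_def)
qed

lemma pos_def_on_submat:
  fixes C :: "real^'p^'p"
  assumes "pos_def C"
  shows "pos_def_on A (submat A C)"
  unfolding pos_def_on_def submat_def
proof (intro conjI ballI allI impI)
  fix i j show "C $ i $ j = C $ j $ i"
    using assms unfolding pos_def_def by (metis transpose_def vec_lambda_beta)
next
  fix z :: "'p \<Rightarrow> real" assume "\<exists>i\<in>A. z i \<noteq> 0"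
  then obtain i where i: "i \<in> A" "z i \<noteq> 0" by blast
  define v where "v = (\<chi> i. if i \<in> A then z i else 0)"
  have "v $ i \<noteq> 0" using i by (simp add: v_def)
  then have "v \<noteq> 0" by auto
  then have "0 < v \<bullet> (C *v v)" using assms by (simp add: pos_def_def)
  also have "\<dots> = (\<Sum>i\<in>UNIV. \<Sum>j\<in>UNIV. v $ i * C $ i $ j * v $ j)"
    by (simp add: inner_vec_def matrix_vector_mult_def sum_distrib_left mult.assoc)
  also have "\<dots> = (\<Sum>i\<in>A. \<Sum>j\<in>UNIV. v $ i * C $ i $ j * v $ j)"
    by (rule sum.mono_neutral_right) (auto simp: v_def)
  also have "\<dots> = (\<Sum>i\<in>A. \<Sum>j\<in>A. v $ i * C $ i $ j * v $ j)"
    by (intro sum.cong refl sum.mono_neutral_right) (auto simp: v_def)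
  also have "\<dots> = (\<Sum>i\<in>A. \<Sum>j\<in>A. z i * C $ i $ j * z j)"
    by (intro sum.cong refl) (auto simp: v_def)
  finally show "0 < (\<Sum>i\<in>A. \<Sum>j\<in>A. z i * C $ i $ j * z j)" .
qed

context prob_space
begin

lemma expectation_cos_shift:
  assumes [measurable]: "S \<in> borel_measurable M"
  shows "expectation (\<lambda>\<omega>. cos (S \<omega> + s)) = Re (iexp s * (CLINT \<omega>|M. iexp (S \<omega>)))"
proof -
  have int: "integrable M (\<lambda>\<omega>. iexp s * iexp (S \<omega>))"
    by (intro integrable_mult_right integrable_iexp) auto
  have "iexp s * iexp (S \<omega>) = iexp (S \<omega> + s)" for \<omega>
    by (simp only: exp_add[symmetric] distrib_left of_real_add add.commute)
  then have "Re (iexp s * iexp (S \<omega>)) = cos (S \<omega> + s)" for \<omega>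
    by (simp add: Re_exp)
  then have "expectation (\<lambda>\<omega>. cos (S \<omega> + s)) = expectation (\<lambda>\<omega>. Re (iexp s * iexp (S \<omega>)))" by (simp only:)
  also have "\<dots> = Re (CLINT \<omega>|M. iexp s * iexp (S \<omega>))" by (rule integral_Re[OF int])
  also have "(CLINT \<omega>|M. iexp s * iexp (S \<omega>)) = iexp s * (CLINT \<omega>|M. iexp (S \<omega>))"
    by (rule integral_mult_right_zero)
  finally show ?thesis .
qed

lemma abs_cos_diff_le: "\<bar>cos a - cos b\<bar> \<le> \<bar>a - b\<bar>" for a b :: real
proof -
  have "\<bar>cos a - cos b\<bar> = \<bar>sin ((a + b) / 2)\<bar> * \<bar>sin ((b - a) / 2)\<bar> * 2"
    unfolding cos_diff_cos by (simp only: abs_mult abs_numeral)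
  also have "\<dots> \<le> 1 * \<bar>(b - a) / 2\<bar> * 2"
    by (intro mult_right_mono mult_mono abs_sin_le_one abs_sin_x_le_abs_x) auto
  also have "\<dots> = \<bar>a - b\<bar>" by (simp add: abs_minus_commute)
  finally show ?thesis .
qed

text \<open>The quantitative core of Slutsky's theorem: the cosine is Lipschitz with constant 1 off
  \<open>E\<close>, and two cosines never differ by more than 2 on it.\<close>

lemma expectation_cos_diff_le:
  assumes [measurable]: "S \<in> borel_measurable M" "T \<in> borel_measurable M" "E \<in> sets M"
    and close: "\<And>\<omega>. \<omega> \<in> space M \<Longrightarrow> \<omega> \<notin> E \<Longrightarrow> \<bar>S \<omega> - T \<omega>\<bar> \<le> d" and d: "d \<ge> 0"
  shows "\<bar>expectation (\<lambda>\<omega>. cos (S \<omega> + s)) - expectation (\<lambda>\<omega>. cos (T \<omega> + s))\<bar> \<le> d + 2 * prob E"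
proof -
  have iS: "integrable M (\<lambda>\<omega>. cos (S \<omega> + s))" and iT: "integrable M (\<lambda>\<omega>. cos (T \<omega> + s))"
    by (rule integrable_const_bound[of _ 1]; simp)+
  have iE: "integrable M (\<lambda>\<omega>. 2 * indicator E \<omega> :: real)" by (simp add: emeasure_eq_measure)
  have "\<bar>cos (S \<omega> + s) - cos (T \<omega> + s)\<bar> \<le> d + 2 * indicator E \<omega>" if "\<omega> \<in> space M" for \<omega>
  proof (cases "\<omega> \<in> E")
    case True
    have "\<bar>cos (S \<omega> + s) - cos (T \<omega> + s)\<bar> \<le> \<bar>cos (S \<omega> + s)\<bar> + \<bar>cos (T \<omega> + s)\<bar>" by (rule abs_triangle_ineq4)
    also have "\<dots> \<le> 1 + 1" by (intro add_mono abs_cos_le_one)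
    finally show ?thesis using True d by simp
  next
    case False
    then show ?thesis using abs_cos_diff_le[of "S \<omega> + s" "T \<omega> + s"] close[OF that] by simp
  qed
  then have "expectation (\<lambda>\<omega>. \<bar>cos (S \<omega> + s) - cos (T \<omega> + s)\<bar>) \<le> expectation (\<lambda>\<omega>. d + 2 * indicator E \<omega>)"
    using iS iT iE by (intro integral_mono) auto
  also have "\<dots> = d + 2 * prob E"
    using iE by (subst Bochner_Integration.integral_add) (auto simp: prob_space)
  finally show ?thesis
    using integral_abs_bound[of M "\<lambda>\<omega>. cos (S \<omega> + s) - cos (T \<omega> + s)"]
    by (simp only: Bochner_Integration.integral_diff[OF iS iT])
qed

end

theorem theorem2:
  fixes M :: "'a measure"
    and x :: "nat \<Rightarrow> real^'p"
    and \<beta>star :: "real^'p"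
    and \<epsilon> :: "nat \<Rightarrow> 'a \<Rightarrow> real"
    and \<sigma> :: real
    and C :: "real^'p^'p"
    and \<alpha> \<eta> :: "nat \<Rightarrow> real"
    and c :: real
  assumes M: "prob_space M"
    and indep: "prob_space.indep_vars M (\<lambda>_. borel) \<epsilon> UNIV"
    and ident: "\<forall>i. distr M borel (\<epsilon> i) = distr M borel (\<epsilon> 0)"
    and int1: "integrable M (\<epsilon> 0)"
    and int2: "integrable M (\<lambda>\<omega>. (\<epsilon> 0 \<omega>)^2)"
    and mean0: "prob_space.expectation M (\<epsilon> 0) = 0"
    and var: "prob_space.variance M (\<epsilon> 0) = \<sigma>^2"
    and \<sigma>pos: "\<sigma> > 0"
    and A2: "(\<lambda>n. (1 / real n) *\<^sub>R gram x n) \<longlonglongrightarrow> C"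
    and Cpd: "pos_def C"
    and \<alpha>pos: "\<forall>n. \<alpha> n > 0"
    and \<eta>pos: "\<forall>n. \<eta> n > 0"
    and \<alpha>inf: "filterlim \<alpha> at_top sequentially"
    and \<alpha>rate: "(\<lambda>n. \<alpha> n / sqrt (real n)) \<longlonglongrightarrow> 0"
    and \<eta>rate: "(\<lambda>n. \<eta> n * sqrt (real n)) \<longlonglongrightarrow> c"
  defines "\<beta>1 \<equiv> (\<lambda>n \<omega>. gdp_os x (\<lambda>i. x i \<bullet> \<beta>star + \<epsilon> i \<omega>) n (\<alpha> n) (\<eta> n))"
    and "A \<equiv> {j. \<beta>star $ j \<noteq> 0}"
  shows "(\<lambda>n. measure M {\<omega> \<in> space M. {j. \<beta>1 n \<omega> $ j \<noteq> 0} = A}) \<longlonglongrightarrow> 1 \<and>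
         conv_distr_on M A
           (\<lambda>n \<omega>. restrict (\<lambda>j. sqrt (real n) * (\<beta>1 n \<omega> $ j - \<beta>star $ j)) A)
           (mvn_on A (\<lambda>i j. \<sigma>^2 * inv_on A (submat A C) i j))"
proof -
  interpret prob_space M by (rule M)
  have rv[measurable]: "random_variable borel (\<epsilon> i)" for i
    using indep unfolding indep_vars_def2 by simp
  have var0: "expectation (\<lambda>\<omega>. (\<epsilon> 0 \<omega>)\<^sup>2) = \<sigma>\<^sup>2" using var mean0 by simp
  have i1: "integrable M (\<epsilon> i)" for i
    using integrable_distr_eq[OF rv, of "\<lambda>x. x" i] integrable_distr_eq[OF rv, of "\<lambda>x. x" 0] ident[rule_format, of i] int1 by simp
  have i2: "integrable M (\<lambda>\<omega>. (\<epsilon> i \<omega>)\<^sup>2)" for i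
    using integrable_distr_eq[OF rv, of "\<lambda>x. x\<^sup>2" i] integrable_distr_eq[OF rv, of "\<lambda>x. x\<^sup>2" 0] ident[rule_format, of i] int2 by simp
  have m1: "expectation (\<epsilon> i) = 0" for i
    using integral_distr[OF rv, of "\<lambda>x. x" i] integral_distr[OF rv, of "\<lambda>x. x" 0] ident[rule_format, of i] mean0 by simp
  have m2: "expectation (\<lambda>\<omega>. (\<epsilon> i \<omega>)\<^sup>2) = \<sigma>\<^sup>2" for i
    using integral_distr[OF rv, of "\<lambda>x. x\<^sup>2" i] integral_distr[OF rv, of "\<lambda>x. x\<^sup>2" 0] ident[rule_format, of i] var0 by simp
  define Cn where "Cn n = (1 / real n) *\<^sub>R gram x n" for n
  have CnC: "Cn \<longlonglongrightarrow> C" using A2 unfolding Cn_def .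
  define W where "W n \<omega> = (1 / sqrt (real n)) *\<^sub>R (\<Sum>i<n. \<epsilon> i \<omega> *\<^sub>R x i)" for n \<omega>
  have Wm[measurable]: "W n \<in> borel_measurable M" for n
    unfolding W_def by measurable
  have Wdot: "t \<bullet> W n \<omega> = (\<Sum>i<n. (t \<bullet> x i / sqrt (real n)) * \<epsilon> i \<omega>)" for t n \<omega>
    by (simp add: W_def inner_sum_right sum_divide_distrib mult.commute)
  \<comment> \<open>The squared weights of the noise in direction \<open>t\<close> sum to the
    quadratic form of the normalised Gram matrix. Hence (A2) gives both the bound on second moments
    and the limiting variance.\<close>
  have adot: "(\<Sum>i<n. (t \<bullet> x i / sqrt (real n))\<^sup>2) = t \<bullet> (Cn n *v t)" for t n
    unfolding Cn_def scaleR_matrix_vector_assoc[symmetric] inner_scaleR_right inner_gram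
    by (simp add: power_divide sum_divide_distrib inner_commute)
  have qlim: "(\<lambda>n. t \<bullet> (Cn n *v t)) \<longlonglongrightarrow> t \<bullet> (C *v t)" for t
  proof -
    have "(\<lambda>n. real CARD('p) * norm (Cn n - C) * (norm t)\<^sup>2) \<longlonglongrightarrow> real CARD('p) * norm (C - C) * (norm t)\<^sup>2"
      by (intro tendsto_intros CnC)
    then have "(\<lambda>n. real CARD('p) * norm (Cn n - C) * (norm t)\<^sup>2) \<longlonglongrightarrow> 0" by simp
    then have "(\<lambda>n. t \<bullet> ((Cn n - C) *v t)) \<longlonglongrightarrow> 0"
      by (rule Lim_null_comparison[rotated])
        (intro always_eventually allI, simp only: real_norm_def inner_matrix_vector_le)
    then show ?thesis
      unfolding matrix_vector_mult_diff_rdistrib inner_diff_right by (rule LIM_zero_cancel)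
  qed
  have tight: "\<exists>K\<ge>0. \<forall>\<^sub>F n in sequentially. prob {\<omega> \<in> space M. norm (W n \<omega>) > K} < e" if e: "e > 0" for e
  proof -
    have W2: "integrable M (\<lambda>\<omega>. (norm (W n \<omega>))\<^sup>2)"
      "expectation (\<lambda>\<omega>. (norm (W n \<omega>))\<^sup>2) = (\<Sum>b\<in>Basis. \<sigma>\<^sup>2 * (b \<bullet> (Cn n *v b)))" for n
    proof -
      have nW: "(norm (W n \<omega>))\<^sup>2 = (\<Sum>b\<in>Basis. (b \<bullet> W n \<omega>)\<^sup>2)" for \<omega>
        unfolding power2_norm_eq_inner
        by (subst euclidean_inner) (simp only: power2_eq_square inner_commute)
      have S: "integrable M (\<lambda>\<omega>. (\<Sum>i<n. a i * \<epsilon> i \<omega>)\<^sup>2) \<and>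
          expectation (\<lambda>\<omega>. (\<Sum>i<n. a i * \<epsilon> i \<omega>)\<^sup>2) = \<sigma>\<^sup>2 * (\<Sum>i<n. (a i)\<^sup>2)" for a
        by (rule second_moment_weighted_sum[OF indep i1 i2 m1 m2])
      have 1: "integrable M (\<lambda>\<omega>. (b \<bullet> W n \<omega>)\<^sup>2)" "expectation (\<lambda>\<omega>. (b \<bullet> W n \<omega>)\<^sup>2) = \<sigma>\<^sup>2 * (b \<bullet> (Cn n *v b))" for b
        unfolding Wdot using S[of "\<lambda>i. b \<bullet> x i / sqrt (real n)"] by (auto simp: adot)
      show "integrable M (\<lambda>\<omega>. (norm (W n \<omega>))\<^sup>2)" unfolding nW by (intro Bochner_Integration.integrable_sum 1)
      show "expectation (\<lambda>\<omega>. (norm (W n \<omega>))\<^sup>2) = (\<Sum>b\<in>Basis. \<sigma>\<^sup>2 * (b \<bullet> (Cn n *v b)))"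
        unfolding nW by (simp add: 1)
    qed
    define T where "T = (\<Sum>b\<in>Basis. \<sigma>\<^sup>2 * (b \<bullet> (C *v b)))"
    have lim: "(\<lambda>n. \<Sum>b\<in>Basis. \<sigma>\<^sup>2 * (b \<bullet> (Cn n *v b))) \<longlonglongrightarrow> T"
      unfolding T_def by (intro tendsto_intros qlim)
    have T: "T \<ge> 0" by (rule LIMSEQ_le_const[OF lim]) (auto simp flip: W2(2))
    \<comment> \<open>\<open>T\<close> is \<sigma> squared times the trace of \<open>C\<close>. The
      second moment of \<open>W n\<close> is eventually below \<open>T + 1\<close>, so Chebyshev
      with this \<open>K\<close> gives a probability strictly below \<open>e\<close>.\<close>
    define K where "K = sqrt ((T + 2) / e)"
    have K: "K > 0" "K\<^sup>2 = (T + 2) / e" using T e by (auto simp: K_def)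
    have "\<forall>\<^sub>F n in sequentially. (\<Sum>b\<in>Basis. \<sigma>\<^sup>2 * (b \<bullet> (Cn n *v b))) < T + 1"
      by (rule order_tendstoD(2)[OF lim]) simp
    then have "\<forall>\<^sub>F n in sequentially. prob {\<omega> \<in> space M. norm (W n \<omega>) > K} < e"
    proof eventually_elim
      case (elim n)
      have "prob {\<omega> \<in> space M. norm (W n \<omega>) > K} \<le> prob {\<omega> \<in> space M. \<bar>norm (W n \<omega>)\<bar> \<ge> K}"
        by (rule finite_measure_mono) auto
      also have "\<dots> \<le> expectation (\<lambda>\<omega>. (norm (W n \<omega>))\<^sup>2) / K\<^sup>2"
        by (rule second_moment_method) (use K W2 in auto)
      also have "\<dots> < (T + 2) / K\<^sup>2"
        using elim zero_less_power[OF K(1), of 2] by (intro divide_strict_right_mono) (auto simp: W2)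
      also have "\<dots> = e" using K T e by simp
      finally show ?case .
    qed
    then show ?thesis using K(1) by (intro exI[of _ K]) auto
  qed
  define \<Gamma> where "\<Gamma> = inv_on A (submat A C)"
  note pdA = pos_def_on_submat[OF Cpd, of A]
  have inv_left: "(\<Sum>j\<in>A. \<Gamma> i j * C $ j $ k) = (if i = k then 1 else 0)" if "i \<in> A" "k \<in> A" for i k
    using inv_on_left[OF pdA that] by (simp only: \<Gamma>_def submat_def)
  \<comment> \<open>The linear approximation of the rescaled estimator: an exact linear function of
    the noise, to which the central limit theorem applies directly.\<close>
  define V where "V n \<omega> i = (\<Sum>j\<in>A. \<Gamma> i j * W n \<omega> $ j)" for n \<omega> i
  define D where "D n \<omega> j = sqrt (real n) * (\<beta>1 n \<omega> $ j - \<beta>star $ j)" for n \<omega> j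
  have selection: "\<forall>\<^sub>F n in sequentially. \<forall>\<omega>. norm (W n \<omega>) \<le> K \<longrightarrow>
      {j. \<beta>1 n \<omega> $ j \<noteq> 0} = A \<and> (\<forall>i\<in>A. \<bar>D n \<omega> i - V n \<omega> i\<bar> \<le> \<delta>)" if "K \<ge> 0" "\<delta> > 0" for K \<delta>
    by (rule eventually_mono[OF gdp_os_selection_eventually[OF A2 Cpd \<alpha>pos[rule_format] \<eta>pos[rule_format]
          \<alpha>inf \<alpha>rate \<eta>rate meta_eq_to_obj_eq[OF A_def] inv_left that]])
      (assumption, assumption, simp only: W_def V_def D_def \<beta>1_def, rule allI, erule spec)
  obtain \<kappa> where "\<forall>\<^sub>F n in sequentially. coercive (\<kappa> * real n) (gram x n)"
    using eventually_coercive_gram[OF A2 Cpd] by blast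
  then have \<beta>m: "\<forall>\<^sub>F n in sequentially. \<beta>1 n \<in> borel_measurable M"
    unfolding \<beta>1_def
    by eventually_elim (rule gdp_os_measurable, assumption, use \<alpha>pos \<eta>pos in auto)
  have part1: "(\<lambda>n. prob {\<omega> \<in> space M. {j. \<beta>1 n \<omega> $ j \<noteq> 0} = A}) \<longlonglongrightarrow> 1"
  proof (rule tendstoI)
    fix e :: real assume e: "e > 0"
    obtain K where K: "K \<ge> 0" "\<forall>\<^sub>F n in sequentially. prob {\<omega> \<in> space M. norm (W n \<omega>) > K} < e"
      using tight[OF e] by blast
    show "\<forall>\<^sub>F n in sequentially. dist (prob {\<omega> \<in> space M. {j. \<beta>1 n \<omega> $ j \<noteq> 0} = A}) 1 < e"
      using K(2) selection[OF K(1) zero_less_one] \<beta>m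
    proof eventually_elim
      case (elim n)
      let ?E = "{\<omega> \<in> space M. norm (W n \<omega>) > K}" and ?S = "{\<omega> \<in> space M. {j. \<beta>1 n \<omega> $ j \<noteq> 0} = A}"
      note elim(3)[measurable]
      have "?S = {\<omega> \<in> space M. \<forall>j. (\<beta>1 n \<omega> \<bullet> axis j 1 \<noteq> 0) = (j \<in> A)}" by (auto simp: inner_axis)
      also have "\<dots> \<in> sets M" by measurable
      finally have S: "?S \<in> sets M" .
      have "1 - prob ?E = prob (space M - ?E)" by (rule prob_compl[symmetric]) measurable
      also have "\<dots> \<le> prob ?S"
      proof (rule finite_measure_mono[OF _ S], rule subsetI)
        fix \<omega> assume \<omega>: "\<omega> \<in> space M - ?E"
        then have "norm (W n \<omega>) \<le> K" by (simp add: not_less)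
        then have "{j. \<beta>1 n \<omega> $ j \<noteq> 0} = A" using elim(2) by blast
        then show "\<omega> \<in> ?S" using \<omega> by simp
      qed
      finally show ?case using elim(1) prob_le_1[of ?S] by (simp add: dist_real_def)
    qed
  qed
  \<comment> \<open>The convergence criterion is for Euclidean spaces, the limit law lives on
    functions on \<open>A\<close>. Padding with zeros passes from the latter to the former; it also
    covers an empty \<open>A\<close>.\<close>
  define emb where "emb f = (\<Sum>j\<in>A. f j *\<^sub>R axis j (1::real))" for f :: "'p \<Rightarrow> real"
  have emb_nth: "emb f $ i = (if i \<in> A then f i else 0)" for f i
    by (simp add: emb_def axis_def if_distrib cong: if_cong)
  have dot_emb: "t \<bullet> emb f = (\<Sum>j\<in>A. t $ j * f j)" for t f
    by (simp add: emb_def inner_sum_right inner_axis mult.commute)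
  \<comment> \<open>\<open>S\<close> is the limiting covariance and \<open>Q\<close> its precision
    matrix, the block of \<open>C\<close> divided by \<sigma> squared.\<close>
  define S where "S = (\<lambda>i j. \<sigma>\<^sup>2 * \<Gamma> i j)"
  define Q where "Q = (\<lambda>i j. C $ i $ j / \<sigma>\<^sup>2)"
  have pdQ: "pos_def_on A Q"
    unfolding pos_def_on_def
  proof (intro conjI ballI allI impI)
    fix i j assume "i \<in> A" "j \<in> A"
    then show "Q i j = Q j i" using pos_def_on_sym[OF pdA, of i j] by (simp add: Q_def submat_def)
  next
    fix z :: "'p \<Rightarrow> real" assume "\<exists>i\<in>A. z i \<noteq> 0"
    then obtain i where i: "i \<in> A" "z i \<noteq> 0" by blast
    have "0 < (\<Sum>i\<in>A. \<Sum>j\<in>A. z i * submat A C i j * z j) / \<sigma>\<^sup>2"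
      using pos_def_on_pos[OF pdA, of i z, OF i] \<sigma>pos by simp
    also have "\<dots> = (\<Sum>i\<in>A. \<Sum>j\<in>A. z i * Q i j * z j)"
      by (simp add: sum_divide_distrib Q_def submat_def)
    finally show "0 < (\<Sum>i\<in>A. \<Sum>j\<in>A. z i * Q i j * z j)" .
  qed
  have SQ: "(\<Sum>j\<in>A. S i j * Q j k) = (if i = k then 1 else 0)" if "i \<in> A" "k \<in> A" for i k
  proof -
    have "(\<Sum>j\<in>A. S i j * Q j k) = (\<Sum>j\<in>A. \<Gamma> i j * C $ j $ k)"
      using \<sigma>pos by (intro sum.cong) (auto simp: S_def Q_def)
    then show ?thesis using inv_left[OF that] by simp
  qed
  let ?N = "mvn_on A S"
  interpret N: prob_space ?N by (rule prob_space_mvn_on[OF pdQ SQ])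
  have cosN: "(\<integral>z. cos (t \<bullet> emb z + s) \<partial>?N) = exp (- ((\<Sum>i\<in>A. t $ i * (\<Sum>j\<in>A. S i j * t $ j)) / 2)) * cos s" for t s
    unfolding dot_emb by (rule integral_mvn_on_cos[OF pdQ SQ])
  have setsN: "sets ?N = sets (PiM A (\<lambda>_. lborel))" "space ?N = PiE A (\<lambda>_. UNIV)"
    by (simp_all add: mvn_on_def space_PiM)
  have Ym: "emb \<in> borel_measurable ?N"
    unfolding measurable_cong_sets[OF setsN(1) refl] emb_def by measurable
  have Vm[measurable]: "(\<lambda>\<omega>. t \<bullet> emb (V n \<omega>)) \<in> borel_measurable M" for t n
  proof -
    have "t \<bullet> emb (V n \<omega>) = (\<Sum>i\<in>A. t $ i * (\<Sum>j\<in>A. \<Gamma> i j * (axis j 1 \<bullet> W n \<omega>)))" for \<omega>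
      by (simp add: dot_emb V_def inner_axis')
    then show ?thesis by simp
  qed
  have cosV: "(\<lambda>n. expectation (\<lambda>\<omega>. cos (t \<bullet> emb (V n \<omega>) + s))) \<longlonglongrightarrow> (\<integral>z. cos (t \<bullet> emb z + s) \<partial>?N)" for t s
  proof -
    \<comment> \<open>The transpose of \<Gamma> applied to \<open>t\<close>. It turns the functional
      of \<open>V\<close> into the inner product of \<tau> with \<open>W\<close>, so a single
      weighted sum of the noise remains, and its limiting variance
      \<open>\<tau> \<bullet> (C *v \<tau>)\<close> collapses to the form of \<Gamma> at
      \<open>t\<close>.\<close>
    define \<tau> where "\<tau> = emb (\<lambda>j. \<Sum>i\<in>A. t $ i * \<Gamma> i j)"
    have tV: "t \<bullet> emb (V n \<omega>) = (\<Sum>i<n. (\<tau> \<bullet> x i / sqrt (real n)) * \<epsilon> i \<omega>)" for n \<omega>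
    proof -
      have "t \<bullet> emb (V n \<omega>) = (\<Sum>j\<in>A. W n \<omega> $ j * (\<Sum>i\<in>A. t $ i * \<Gamma> i j))"
        unfolding dot_emb V_def sum_distrib_left by (subst sum.swap) (simp only: mult_ac)
      also have "\<dots> = \<tau> \<bullet> W n \<omega>" unfolding \<tau>_def by (subst inner_commute) (simp only: dot_emb)
      finally show ?thesis unfolding Wdot .
    qed
    have \<tau>C: "\<tau> \<bullet> (C *v \<tau>) = (\<Sum>i\<in>A. t $ i * (\<Sum>j\<in>A. \<Gamma> i j * t $ j))"
    proof -
      have "\<tau> \<bullet> (C *v \<tau>) = (\<Sum>j\<in>A. \<tau> $ j * (\<Sum>k\<in>A. C $ j $ k * \<tau> $ k))"
      proof -
        have "\<tau> \<bullet> (C *v \<tau>) = (\<Sum>j\<in>UNIV. \<tau> $ j * (\<Sum>k\<in>UNIV. C $ j $ k * \<tau> $ k))"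
          by (simp add: inner_vec_def matrix_vector_mult_def)
        also have "\<dots> = (\<Sum>j\<in>A. \<tau> $ j * (\<Sum>k\<in>UNIV. C $ j $ k * \<tau> $ k))"
          by (rule sum.mono_neutral_right) (auto simp: \<tau>_def emb_nth)
        also have "\<dots> = (\<Sum>j\<in>A. \<tau> $ j * (\<Sum>k\<in>A. C $ j $ k * \<tau> $ k))"
          by (intro sum.cong refl arg_cong2[of _ _ _ _ "(*)"] sum.mono_neutral_right) (auto simp: \<tau>_def emb_nth)
        finally show ?thesis .
      qed
      also have "\<dots> = (\<Sum>k\<in>A. (\<Sum>j\<in>A. \<tau> $ j * C $ j $ k) * \<tau> $ k)"
        unfolding sum_distrib_left sum_distrib_right by (subst sum.swap) (simp only: mult.assoc)
      also have "\<dots> = (\<Sum>k\<in>A. t $ k * \<tau> $ k)"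
      proof (rule sum.cong[OF refl])
        fix k assume k: "k \<in> A"
        have "(\<Sum>j\<in>A. \<tau> $ j * C $ j $ k) = (\<Sum>i\<in>A. t $ i * (\<Sum>j\<in>A. \<Gamma> i j * C $ j $ k))"
          by (simp add: \<tau>_def emb_nth sum_distrib_left sum_distrib_right mult.assoc) (rule sum.swap)
        also have "\<dots> = (\<Sum>i\<in>A. if i = k then t $ i else 0)"
          by (rule sum.cong) (auto simp: inv_left k)
        also have "\<dots> = t $ k" using k by simp
        finally show "(\<Sum>j\<in>A. \<tau> $ j * C $ j $ k) * \<tau> $ k = t $ k * \<tau> $ k" by simp
      qed
      also have "\<dots> = (\<Sum>i\<in>A. t $ i * (\<Sum>j\<in>A. \<Gamma> i j * t $ j))"
        by (simp add: \<tau>_def emb_nth sum_distrib_left mult_ac) (subst sum.swap, simp only: mult_ac)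
      finally show ?thesis .
    qed
    have sq: "(\<lambda>n. \<Sum>i<n. (\<tau> \<bullet> x i / sqrt (real n))\<^sup>2) \<longlonglongrightarrow> \<tau> \<bullet> (C *v \<tau>)"
      unfolding adot by (rule qlim)
    have small: "\<forall>\<^sub>F n in sequentially. \<forall>i<n. \<bar>\<tau> \<bullet> x i / sqrt (real n)\<bar> < r" if r: "r > 0" for r
    proof -
      have "(\<lambda>n. (\<Sum>i<n. (\<tau> \<bullet> x i)\<^sup>2) / real n) \<longlonglongrightarrow> \<tau> \<bullet> (C *v \<tau>)"
        using sq by (simp add: power_divide sum_divide_distrib)
      then have "\<forall>\<^sub>F n in sequentially. \<forall>i<n. (\<tau> \<bullet> x i)\<^sup>2 < r\<^sup>2 * real n"
        by (rule terms_negligible_of_average_tendsto) (use r in auto)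
      then show ?thesis
      proof eventually_elim
        case (elim n)
        show ?case
        proof (intro allI impI)
          fix i assume i: "i < n"
          then have "(\<tau> \<bullet> x i / sqrt (real n))\<^sup>2 < r\<^sup>2"
            using elim by (simp add: power_divide pos_divide_less_eq)
          then show "\<bar>\<tau> \<bullet> x i / sqrt (real n)\<bar> < r"
            using r by (metis abs_le_square_iff abs_of_pos not_less)
        qed
      qed
    qed
    have "(\<lambda>n. CLINT \<omega>|M. iexp (t \<bullet> emb (V n \<omega>))) \<longlonglongrightarrow> of_real (exp (- (\<sigma>\<^sup>2 * (\<tau> \<bullet> (C *v \<tau>)) / 2)))"
      unfolding tV
      by (rule char_weighted_sum_tendsto[OF indep ident[rule_format] int1 int2 mean0 var sq small])
    then have "(\<lambda>n. Re (iexp s * (CLINT \<omega>|M. iexp (t \<bullet> emb (V n \<omega>)))))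
        \<longlonglongrightarrow> Re (iexp s * of_real (exp (- (\<sigma>\<^sup>2 * (\<tau> \<bullet> (C *v \<tau>)) / 2))))"
      by (intro tendsto_intros)
    moreover have "Re (iexp s * of_real (exp (- (\<sigma>\<^sup>2 * (\<tau> \<bullet> (C *v \<tau>)) / 2)))) = (\<integral>z. cos (t \<bullet> emb z + s) \<partial>?N)"
    proof -
      have "\<sigma>\<^sup>2 * (\<tau> \<bullet> (C *v \<tau>)) = (\<Sum>i\<in>A. t $ i * (\<Sum>j\<in>A. S i j * t $ j))"
        unfolding \<tau>C S_def sum_distrib_left by (simp only: mult_ac)
      moreover have "Re (iexp s * of_real e) = e * cos s" for e
        by (simp add: Re_exp)
      ultimately show ?thesis unfolding cosN by (simp only:)
    qed
    ultimately show ?thesis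
      using expectation_cos_shift[OF Vm] by simp
  qed
  have Dm: "\<forall>\<^sub>F n in sequentially. (\<lambda>\<omega>. emb (D n \<omega>)) \<in> borel_measurable M"
    using \<beta>m
  proof eventually_elim
    case (elim n)
    note elim[measurable]
    have "emb (D n \<omega>) = (\<Sum>j\<in>A. (sqrt (real n) * (axis j 1 \<bullet> (\<beta>1 n \<omega> - \<beta>star))) *\<^sub>R axis j 1)" for \<omega>
      by (simp add: emb_def D_def inner_axis')
    then show ?case by simp
  qed
  have cosD: "(\<lambda>n. expectation (\<lambda>\<omega>. cos (t \<bullet> emb (D n \<omega>) + s))) \<longlonglongrightarrow> (\<integral>z. cos (t \<bullet> emb z + s) \<partial>?N)" for t s
  proof -
    have "(\<lambda>n. expectation (\<lambda>\<omega>. cos (t \<bullet> emb (D n \<omega>) + s)) - expectation (\<lambda>\<omega>. cos (t \<bullet> emb (V n \<omega>) + s))) \<longlonglongrightarrow> 0"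
    proof (rule tendstoI)
      fix e :: real assume e: "e > 0"
      define B where "B = (\<Sum>j\<in>A. \<bar>t $ j\<bar>)"
      have B: "B \<ge> 0" by (simp add: B_def sum_nonneg)
      \<comment> \<open>The approximation error costs at most \<open>B * \<delta>\<close>, hence
        \<open>e / 2\<close>, and the exceptional event less than \<open>2 * (e / 4)\<close>.
        Dividing by \<open>B + 1\<close> is safe when \<open>B\<close> is 0, as for empty
        \<open>A\<close>.\<close>
      define \<delta> where "\<delta> = e / (2 * (B + 1))"
      have \<delta>: "\<delta> > 0" using e B by (simp add: \<delta>_def)
      have B\<delta>: "B * \<delta> \<le> e / 2"
      proof -
        have "B * \<delta> \<le> (B + 1) * \<delta>" using \<delta> by (intro mult_right_mono) auto
        also have "\<dots> = e / 2" using B by (simp add: \<delta>_def add_nonneg_eq_0_iff field_simps)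
        finally show ?thesis .
      qed
      have "e / 4 > 0" using e by simp
      then obtain K where K: "K \<ge> 0" "\<forall>\<^sub>F n in sequentially. prob {\<omega> \<in> space M. norm (W n \<omega>) > K} < e / 4"
        using tight by blast
      show "\<forall>\<^sub>F n in sequentially. dist (expectation (\<lambda>\<omega>. cos (t \<bullet> emb (D n \<omega>) + s)) - expectation (\<lambda>\<omega>. cos (t \<bullet> emb (V n \<omega>) + s))) 0 < e"
        using K(2) selection[OF K(1) \<delta>] Dm
      proof eventually_elim
        case (elim n)
        let ?E = "{\<omega> \<in> space M. norm (W n \<omega>) > K}"
        note elim(3)[measurable]
        have "\<bar>t \<bullet> emb (D n \<omega>) - t \<bullet> emb (V n \<omega>)\<bar> \<le> B * \<delta>" if "norm (W n \<omega>) \<le> K" for \<omega>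
        proof -
          have "t \<bullet> emb (D n \<omega>) - t \<bullet> emb (V n \<omega>) = (\<Sum>j\<in>A. t $ j * (D n \<omega> j - V n \<omega> j))"
            by (simp add: dot_emb sum_subtractf right_diff_distrib)
          also have "\<bar>\<dots>\<bar> \<le> (\<Sum>j\<in>A. \<bar>t $ j\<bar> * \<delta>)"
            by (rule order_trans[OF sum_abs sum_mono]) (use elim(2) that in \<open>auto simp: abs_mult intro!: mult_left_mono\<close>)
          finally show ?thesis by (simp add: B_def sum_distrib_right)
        qed
        then have "\<bar>expectation (\<lambda>\<omega>. cos (t \<bullet> emb (D n \<omega>) + s)) - expectation (\<lambda>\<omega>. cos (t \<bullet> emb (V n \<omega>) + s))\<bar> \<le> B * \<delta> + 2 * prob ?E"
          using B \<delta> by (intro expectation_cos_diff_le) auto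
        then show ?case using elim(1) B\<delta> unfolding dist_real_def diff_zero by linarith
      qed
    qed
    from tendsto_add[OF this cosV[of t s]] show ?thesis by simp
  qed
  have tightD: "\<exists>K. \<forall>\<^sub>F n in sequentially. prob {\<omega> \<in> space M. norm (emb (D n \<omega>)) > K} < e" if e: "e > 0" for e
  proof -
    obtain K where K: "K \<ge> 0" "\<forall>\<^sub>F n in sequentially. prob {\<omega> \<in> space M. norm (W n \<omega>) > K} < e"
      using tight[OF e] by blast
    \<comment> \<open>Coordinatewise, the sum bounds \<open>V\<close> on the event that
      \<open>W\<close> lies in the ball, and the extra 1 is the tolerance with which
      \<open>D\<close> approximates \<open>V\<close>.\<close>
    define R where "R = (\<Sum>i\<in>A. (\<Sum>j\<in>A. \<bar>\<Gamma> i j\<bar> * K) + 1)"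
    have "\<forall>\<^sub>F n in sequentially. prob {\<omega> \<in> space M. norm (emb (D n \<omega>)) > R} < e"
      using K(2) selection[OF K(1) zero_less_one]
    proof eventually_elim
      case (elim n)
      have "norm (emb (D n \<omega>)) \<le> R" if W: "norm (W n \<omega>) \<le> K" for \<omega>
      proof -
        have V: "\<bar>V n \<omega> i\<bar> \<le> (\<Sum>j\<in>A. \<bar>\<Gamma> i j\<bar> * K)" for i
          unfolding V_def
        proof (rule order_trans[OF sum_abs sum_mono])
          fix j show "\<bar>\<Gamma> i j * W n \<omega> $ j\<bar> \<le> \<bar>\<Gamma> i j\<bar> * K"
            unfolding abs_mult using order_trans[OF component_le_norm_cart W] by (rule mult_left_mono) simp
        qed
        have "norm (emb (D n \<omega>)) \<le> (\<Sum>i\<in>A. \<bar>D n \<omega> i\<bar>)"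
          unfolding emb_def by (rule order_trans[OF norm_sum]) simp
        also have "\<dots> \<le> R"
          unfolding R_def
        proof (rule sum_mono)
          fix i assume "i \<in> A"
          then have "\<bar>D n \<omega> i - V n \<omega> i\<bar> \<le> 1" using elim(2) W by blast
          then show "\<bar>D n \<omega> i\<bar> \<le> (\<Sum>j\<in>A. \<bar>\<Gamma> i j\<bar> * K) + 1" using V[of i] by linarith
        qed
        finally show ?thesis .
      qed
      then have "prob {\<omega> \<in> space M. norm (emb (D n \<omega>)) > R} \<le> prob {\<omega> \<in> space M. norm (W n \<omega>) > K}"
        by (intro finite_measure_mono) (auto simp: not_le[symmetric])
      then show ?case using elim(1) by linarith
    qed
    then show ?thesis by blast
  qed
  have part2: "conv_distr_on M A (\<lambda>n \<omega>. restrict (D n \<omega>) A) ?N"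
    unfolding conv_distr_on_def
  proof (intro allI impI)
    fix g :: "('p \<Rightarrow> real) \<Rightarrow> real"
    assume g: "continuous_on (PiE A (\<lambda>_. UNIV)) g" and bg: "bounded (g ` PiE A (\<lambda>_. UNIV))"
    \<comment> \<open>\<open>g\<close> is continuous only on functions that are undefined off
      \<open>A\<close>. Reading off the coordinates in \<open>A\<close> extends it to a continuous
      function on the whole space, and composing with \<open>emb\<close> gives \<open>g\<close>
      back.\<close>
    define h where "h v = g (restrict (\<lambda>j. v $ j) A)" for v :: "real^'p"
    have "continuous_on UNIV (\<lambda>v::real^'p. restrict (\<lambda>j. v $ j) A)"
    proof (rule continuous_on_coordinatewise_then_product)
      fix j show "continuous_on UNIV (\<lambda>v::real^'p. restrict (\<lambda>j. v $ j) A j)"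
        by (cases "j \<in> A") (auto intro!: continuous_intros)
    qed
    then have h: "continuous_on UNIV h"
      unfolding h_def by (rule continuous_on_compose2[OF g]) auto
    obtain B where B: "\<And>z. z \<in> PiE A (\<lambda>_. UNIV) \<Longrightarrow> norm (g z) \<le> B"
      using bg unfolding bounded_iff by blast
    have hB: "\<bar>h v\<bar> \<le> B" for v using B[of "restrict (\<lambda>j. v $ j) A"] by (simp add: h_def)
    have hemb: "h (emb f) = g (restrict f A)" for f
      unfolding h_def by (rule arg_cong[of _ _ g]) (auto simp: emb_nth fun_eq_iff)
    have "(\<lambda>n. expectation (\<lambda>\<omega>. h (emb (D n \<omega>)))) \<longlonglongrightarrow> (\<integral>z. h (emb z) \<partial>?N)"
      by (rule expectation_tendsto_of_cos[OF M N.prob_space_axioms Dm Ym cosD tightD h hB])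
    moreover have "(\<integral>z. h (emb z) \<partial>?N) = (\<integral>z. g z \<partial>?N)"
      by (rule Bochner_Integration.integral_cong[OF refl]) (simp add: hemb setsN PiE_restrict)
    ultimately show "(\<lambda>n. \<integral>\<omega>. g (restrict (D n \<omega>) A) \<partial>M) \<longlonglongrightarrow> (\<integral>z. g z \<partial>?N)"
      by (simp add: hemb)
  qed
  show ?thesis
    using part1 part2 unfolding D_def S_def \<Gamma>_def by blast
qed

end
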